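(* Let $n\in\mathbb N$, $n\ge2$, and $p\in(1,n)$. Let $k\in\mathbb N$ be such that $$2\le k<\frac np+1.$$ Then there is a constant $C>0$ such that $$\left(\int_0^t(f^{**}(s)-f^*(s))^p\,ds\right)^{\frac1p}+t^{\frac kn}\left(\int_t^\infty(f^{**}(s)-f^*(s))^p\,s^{-\frac{kp}n}\,ds\right)^{\frac1p}\le C\,\omega_k(f,t^{\frac1n})_p$$ for all $t\in(0,\infty)$ and every $(k-1)$-times weakly differentiable function $f\colon\mathbb R^n\to\mathbb R$, $f\in L^p(\mathbb R^n)$, such that $$\lim_{t\to\infty}|\nabla^jf|^{**}(t)=0\quad\text{for each }j\in\{0,\dots,k-1\}.$$
   Context: For a measurable function $g$ on $\mathbb R^n$ (with Lebesgue measure $|\cdot|$), $g^*(t)=\inf\{\lambda\ge0:|\{x:|g(x)|>\lambda\}|\le t\}$ and $g^{**}(t)=\frac1t\int_0^tg^*(s)\,ds$. $\nabla^jf$ denotes the vector of all weak derivatives of $f$ of order $j$ (with $\nabla^0f=f$) and $|\nabla^jf|$ its Euclidean length. For $h\in\mathbb R^n$, $\Delta_hf(x)=f(x+h)-f(x)$ and inductively $\Delta_h^kf=\Delta_h(\Delta_h^{k-1}f)$ for $k\ge2$. For $f\in L^p(\mathbb R^n)$, the $p$-modulus of smoothness of order $k$ is $\omega_k(f,t)_p=\sup_{|h|\le t}\|\Delta_h^kf\|_{L^p(\mathbb R^n)}$, $t\in(0,\infty)$. *)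

theory Defs
  imports "HOL-Analysis.Analysis"
begin

definition ennpowr :: "ennreal \<Rightarrow> real \<Rightarrow> ennreal" where
  \<comment> \<open>Only used for exponents \<open>a > 0\<close>, where \<open>\<infinity>\<close> to the power \<open>a\<close> is \<open>\<infinity>\<close>.\<close>
  "ennpowr x a = (if x = \<infinity> then \<infinity> else ennreal (enn2real x powr a))"

definition rearrangement :: "('a::euclidean_space \<Rightarrow> real) \<Rightarrow> real \<Rightarrow> ennreal" where
  \<comment> \<open>Extended-valued, so that the infimum of the empty set is \<open>\<infinity>\<close>.\<close>
  "rearrangement g t =
     (INF l \<in> {l::real. 0 \<le> l \<and> emeasure lebesgue {x. \<bar>g x\<bar> > l} \<le> ennreal t}. ennreal l)"

definition maximal_rearrangement :: "('a::euclidean_space \<Rightarrow> real) \<Rightarrow> real \<Rightarrow> ennreal" where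
  "maximal_rearrangement g t = (\<integral>\<^sup>+ s \<in> {0<..<t}. rearrangement g s \<partial>lborel) / ennreal t"

definition Lp_norm :: "real \<Rightarrow> ('a::euclidean_space \<Rightarrow> real) \<Rightarrow> ennreal" where
  "Lp_norm p f = ennpowr (\<integral>\<^sup>+ x. ennreal (\<bar>f x\<bar> powr p) \<partial>lebesgue) (1 / p)"

definition Lp_space :: "real \<Rightarrow> ('a::euclidean_space \<Rightarrow> real) set" where
  "Lp_space p = {f \<in> borel_measurable lebesgue. Lp_norm p f < \<infinity>}"

definition difference :: "'a::euclidean_space \<Rightarrow> ('a \<Rightarrow> real) \<Rightarrow> 'a \<Rightarrow> real" where
  "difference h f x = f (x + h) - f x"

definition modulus_of_smoothness ::
    "nat \<Rightarrow> ('a::euclidean_space \<Rightarrow> real) \<Rightarrow> real \<Rightarrow> real \<Rightarrow> ennreal" where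
  "modulus_of_smoothness k f t p = (SUP h \<in> {h. norm h \<le> t}. Lp_norm p ((difference h ^^ k) f))"

definition partial_derivative :: "'n::finite \<Rightarrow> (real^'n \<Rightarrow> real) \<Rightarrow> real^'n \<Rightarrow> real" where
  "partial_derivative i \<phi> x = frechet_derivative \<phi> (at x) (axis i 1)"

abbreviation iterated_partial :: "'n::finite list \<Rightarrow> (real^'n \<Rightarrow> real) \<Rightarrow> real^'n \<Rightarrow> real" where
  "iterated_partial is \<phi> \<equiv> foldr partial_derivative is \<phi>"

definition test_function :: "(real^'n::finite \<Rightarrow> real) \<Rightarrow> bool" where
  \<comment> \<open>Differentiability of all iterated partial derivatives makes each of them continuous,
      so this is smoothness together with compact support.\<close>
  "test_function \<phi> \<longleftrightarrow>
     (\<forall>is x. iterated_partial is \<phi> differentiable (at x)) \<and> compact (closure {x. \<phi> x \<noteq> 0})"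

definition locally_integrable :: "('a::euclidean_space \<Rightarrow> real) \<Rightarrow> bool" where
  "locally_integrable g \<longleftrightarrow> (\<forall>K. compact K \<longrightarrow> g absolutely_integrable_on K)"

text \<open>Multi-indices are functions \<open>\<alpha> :: 'n \<Rightarrow> nat\<close>.\<close>

definition mi_order :: "('n::finite \<Rightarrow> nat) \<Rightarrow> nat" where
  "mi_order \<alpha> = (\<Sum>i\<in>UNIV. \<alpha> i)"

definition has_weak_derivative ::
    "('n::finite \<Rightarrow> nat) \<Rightarrow> (real^'n \<Rightarrow> real) \<Rightarrow> (real^'n \<Rightarrow> real) \<Rightarrow> bool" where
  \<comment> \<open>The lists \<open>is\<close> range over the orders in which the partial derivatives making up the
      multi-index \<open>\<alpha>\<close> can be taken; on a test function all orders give the same result.\<close>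
  "has_weak_derivative \<alpha> f g \<longleftrightarrow>
     locally_integrable f \<and> locally_integrable g \<and>
     (\<forall>\<phi> is. test_function \<phi> \<and> (\<forall>i. count_list is i = \<alpha> i) \<longrightarrow>
        (\<integral>x. f x * iterated_partial is \<phi> x \<partial>lebesgue)
          = (- 1) ^ mi_order \<alpha> * (\<integral>x. g x * \<phi> x \<partial>lebesgue))"

definition weakly_differentiable :: "nat \<Rightarrow> (real^'n::finite \<Rightarrow> real) \<Rightarrow> bool" where
  "weakly_differentiable m f \<longleftrightarrow> (\<forall>\<alpha>. mi_order \<alpha> \<le> m \<longrightarrow> (\<exists>g. has_weak_derivative \<alpha> f g))"

definition weak_derivative :: "('n::finite \<Rightarrow> nat) \<Rightarrow> (real^'n \<Rightarrow> real) \<Rightarrow> real^'n \<Rightarrow> real" where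
  \<comment> \<open>Weak derivatives are unique up to null sets, which rearrangements do not see.\<close>
  "weak_derivative \<alpha> f = (SOME g. has_weak_derivative \<alpha> f g)"

definition grad_length :: "nat \<Rightarrow> (real^'n::finite \<Rightarrow> real) \<Rightarrow> real^'n \<Rightarrow> real" where
  "grad_length j f x =
     (if j = 0 then \<bar>f x\<bar> else sqrt (\<Sum>\<alpha> | mi_order \<alpha> = j. (weak_derivative \<alpha> f x)\<^sup>2))"

end

theory Submission
  imports Defs
begin

text \<open>
  The gap \<open>f\<^sup>*\<^sup>*(s) - f\<^sup>*(s)\<close> is at most twice the largest mean of
  \<open>\<bar>f(x + h) - f(x)\<bar>\<close> over a set of measure at most \<open>s\<close>, for \<open>h\<close> in a ball of volume \<open>2 s\<close>: half
  of the points \<open>x + h\<close> lie outside the superlevel set. To bound these first differences by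
  \<open>k\<close>-th differences of step at most \<open>r = t\<^bsup>1/n\<^esup>\<close>, write
  \<open>f = (f - B\<^sub>m f) + \<Sum>\<^sub>j (B\<^sub>j - B\<^sub>j\<^sub>+\<^sub>1) f\<close> with \<open>B\<^sub>j = A\<^sub>j\<^sup>2\<close>, where \<open>A\<^sub>j\<close> is the smoothing at scale
  \<open>2\<^sup>j r\<close> for which \<open>1 - A\<^sub>j\<close> is an average of \<open>k\<close>-th differences. Since
  \<open>B\<^sub>j - B\<^sub>j\<^sub>+\<^sub>1 = (A\<^sub>j + A\<^sub>j\<^sub>+\<^sub>1) ((1 - A\<^sub>j\<^sub>+\<^sub>1) - (1 - A\<^sub>j))\<close>, one factor turns \<open>k\<close>-th differences into
  uniform bounds, and its Lipschitz kernel gains \<open>\<bar>h\<bar> / (2\<^sup>j r)\<close>. The resulting pointwise estimate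
  is summable because \<open>k - 1 < n / p\<close>, and the Hardy inequality closes the argument.
\<close>

section \<open>Powers of extended nonnegative reals\<close>

text \<open>Only steps of length at most \<open>r\<close> are controlled, while smoothing at scale
  \<open>2 ^ j * r\<close> involves steps of that length. Reducing them by repeated doubling costs
  \<open>2 ^ (k * j)\<close>, and the Lipschitz kernel returns only \<open>2 ^ j\<close>, so level
  \<open>j\<close> loses \<open>2 ^ ((k - 1) * j)\<close>. The smoothing factor pays for this: it
  replaces a k-th difference by a maximal average over measure \<open>(2 ^ j * r) ^ n\<close>, and
  in the dyadic \<open>p\<close>-sum this is smaller by \<open>2 powr (- j * n / p)\<close>. The
  ratio \<open>2 powr (k - 1 - n / p)\<close> is below 1 exactly when \<open>k < n / p + 1\<close>.
  Hence the square in \<open>B\<^sub>j\<close>: a difference of two unsquared smoothings is a bare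
  average of k-th differences, with no smoothing left over to make it uniformly bounded and
  Lipschitz. For \<open>s\<close> comparable with \<open>(2 ^ m * r) ^ n\<close> the vectors
  \<open>h\<close> have length comparable with \<open>2 ^ m * r\<close>, so the decomposition must
  start at level \<open>m\<close>. The resulting loss \<open>2 ^ (k * m)\<close> is what the weight
  \<open>s powr (- k * p / n)\<close> absorbs. Maximal averages are formed for each step separately
  and only then averaged over the step, so that Jensen's inequality and the Hardy inequality can be
  used one step at a time.\<close>

lemma ennpowr_ennreal: "0 \<le> x \<Longrightarrow> ennpowr (ennreal x) a = ennreal (x powr a)"
  by (simp add: ennpowr_def)

lemma ennpowr_top [simp]: "ennpowr top a = top"
  by (simp add: ennpowr_def)

lemma ennpowr_0 [simp]: "ennpowr 0 a = 0"
  by (simp add: ennpowr_def)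

lemma ennpowr_mono:
  assumes "x \<le> y" "0 \<le> a"
  shows "ennpowr x a \<le> ennpowr y a"
proof (cases y)
  case (real r)
  with assms obtain q where q: "0 \<le> q" "x = ennreal q"
    by (cases x) (auto simp: top_unique)
  with real assms have "q \<le> r" by simp
  then show ?thesis using q real assms
    by (simp add: ennpowr_ennreal powr_mono2 ennreal_leI)
qed simp

lemma ennpowr_mult:
  assumes "0 < a"
  shows "ennpowr (x * y) a = ennpowr x a * ennpowr y a"
proof (cases "x = top \<or> y = top")
  case True
  then show ?thesis
    by (cases x; cases y)
       (auto simp: ennpowr_ennreal ennreal_mult_eq_top_iff ennreal_top_mult ennreal_mult_top
          simp flip: ennreal_mult intro: ennpowr_ennreal)
next
  case False
  then obtain r q where "0 \<le> r" "x = ennreal r" "0 \<le> q" "y = ennreal q"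
    by (cases x; cases y) auto
  then show ?thesis
    by (simp add: ennpowr_ennreal powr_mult flip: ennreal_mult)
qed

lemma ennpowr_ennpowr: "ennpowr (ennpowr x a) b = ennpowr x (a * b)"
  by (cases x) (simp_all add: ennpowr_ennreal powr_powr)

lemma ennpowr_1 [simp]: "ennpowr x 1 = x"
  by (cases x) (simp_all add: ennpowr_ennreal)

lemma measurable_ennpowr [measurable]:
  assumes [measurable]: "g \<in> borel_measurable M"
  shows "(\<lambda>x. ennpowr (g x) a) \<in> borel_measurable M"
  unfolding ennpowr_def by measurable

lemma ennpowr_add_le:
  assumes "0 < p"
  shows "ennpowr (x + y) p \<le> ennreal (2 powr p) * (ennpowr x p + ennpowr y p)"
proof -
  have "x + y \<le> ennreal 2 * max x y"
    by (metis add_mono ennreal_numeral max.cobounded1 max.cobounded2 mult_2)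
  then have "ennpowr (x + y) p \<le> ennpowr (ennreal 2 * max x y) p"
    using assms by (intro ennpowr_mono) auto
  also have "\<dots> = ennreal (2 powr p) * ennpowr (max x y) p"
    using assms by (simp add: ennpowr_mult ennpowr_ennreal del: ennreal_numeral)
  also have "\<dots> \<le> ennreal (2 powr p) * (ennpowr x p + ennpowr y p)"
    by (intro mult_left_mono) (simp_all add: max_def)
  finally show ?thesis .
qed

section \<open>Layer cake, tangent inequality and Jensen's inequality\<close>

lemma nn_integral_powr_from_0:
  assumes "0 < a" "0 \<le> c"
  shows "(\<integral>\<^sup>+ l \<in> {0<..<c}. ennreal (a * l powr (a - 1)) \<partial>lborel) = ennreal (c powr a)"
proof -
  have "((\<lambda>x. a * x powr (a - 1)) has_integral a * (c powr (a - 1 + 1) / (a - 1 + 1))) {0..c}"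
    using assms by (intro has_integral_mult_right has_integral_powr_from_0) auto
  then have "((\<lambda>x. a * x powr (a - 1)) has_integral (c powr a)) {0..c}"
    using assms by simp
  then have "(\<integral>\<^sup>+ l \<in> {0..c}. ennreal (a * l powr (a - 1)) \<partial>lborel) = ennreal (c powr a)"
    using assms by (intro nn_integral_has_integral_lebesgue') auto
  moreover have "(\<integral>\<^sup>+ l \<in> {0<..<c}. ennreal (a * l powr (a - 1)) \<partial>lborel)
     = (\<integral>\<^sup>+ l \<in> {0..c}. ennreal (a * l powr (a - 1)) \<partial>lborel)"
  proof (rule nn_integral_cong_AE)
    have "AE l in lborel. l \<noteq> (0::real)" "AE l in lborel. l \<noteq> c"
      by (auto simp: AE_lborel_singleton)
    then show "AE l in lborel. ennreal (a * l powr (a - 1)) * indicator {0<..<c} l =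
           ennreal (a * l powr (a - 1)) * indicator {0..c} l"
      by eventually_elim (auto simp: indicator_def)
  qed
  ultimately show ?thesis by simp
qed

text \<open>For finite \<open>y\<close> this is the primitive of \<open>a * l powr (a - 1)\<close>;
  for \<open>y = \<infinity>\<close> the same primitive on bounded intervals makes the integral
  exceed every real.\<close>

lemma ennpowr_layer_cake:
  assumes "0 < a"
  shows "ennpowr y a = (\<integral>\<^sup>+ l \<in> {0<..}. ennreal (a * l powr (a - 1)) * indicator {l. ennreal l < y} l \<partial>lborel)"
proof (cases y)
  case (real c)
  have "(\<integral>\<^sup>+ l \<in> {0<..}. ennreal (a * l powr (a - 1)) * indicator {l. ennreal l < y} l \<partial>lborel)
     = (\<integral>\<^sup>+ l \<in> {0<..<c}. ennreal (a * l powr (a - 1)) \<partial>lborel)"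
    using real by (intro nn_integral_cong) (auto simp: indicator_def ennreal_less_iff)
  then show ?thesis
    using nn_integral_powr_from_0[OF assms real(1)] real by (simp add: ennpowr_ennreal)
next
  case top
  let ?I = "\<integral>\<^sup>+ l \<in> {0<..}. ennreal (a * l powr (a - 1)) * indicator {l. ennreal l < y} l \<partial>lborel"
  have "ennreal c \<le> ?I" if "0 \<le> c" for c
  proof -
    have "ennreal c = (\<integral>\<^sup>+ l \<in> {0<..<c powr (1/a)}. ennreal (a * l powr (a - 1)) \<partial>lborel)"
      using nn_integral_powr_from_0[OF assms, of "c powr (1/a)"] that assms by (simp add: powr_powr)
    also have "\<dots> \<le> ?I"
      using top by (intro nn_integral_mono) (auto simp: indicator_def)
    finally show ?thesis .
  qed
  note le = this
  have "?I = top"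
  proof (cases ?I)
    case (real b)
    then have "ennreal (b + 1) \<le> ennreal b"
      using le[of "b + 1"] by simp
    then show ?thesis using real(1) by simp
  qed
  then show ?thesis using top by simp
qed

text \<open>Convexity: the graph of \<open>g powr p\<close> lies above its tangent at
  \<open>a\<close>. The terms are arranged so that none is negative, which lets the inequality pass
  to \<open>ennreal\<close>.\<close>

lemma Young_tangent:
  fixes a g :: real
  assumes "1 < p" "0 \<le> a" "0 \<le> g"
  shows "p * a powr (p - 1) * g \<le> g powr p + (p - 1) * a powr p"
proof (cases "a = 0 \<or> g = 0")
  case True
  then show ?thesis using assms by auto
next
  case False
  then have pos: "0 < a" "0 < g" using assms by auto
  define q where "q = p / (p - 1)"
  have "(a powr (p - 1)) * g \<le> (a powr (p - 1)) powr q / q + g powr p / p"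
    using assms pos Youngs_inequality[of q p "a powr (p - 1)" g]
    by (simp add: q_def field_simps)
  also have "(a powr (p - 1)) powr q = a powr p"
    using assms by (simp add: powr_powr q_def)
  finally have "p * (a powr (p - 1) * g) \<le> p * (a powr p / q + g powr p / p)"
    using assms by (intro mult_left_mono) auto
  also have "\<dots> = g powr p + (p - 1) * a powr p"
    using assms by (simp add: q_def field_simps)
  finally show ?thesis by (simp add: mult.assoc)
qed

text \<open>The tangent inequality is integrated and then used at the mean \<open>a\<close> itself,
  where it collapses to the claim. An infinite mean is handled by the tangent at 1, which forces the
  right side to be infinite.\<close>

lemma Jensen_ennpowr:
  assumes [measurable]: "g \<in> borel_measurable M" and M: "emeasure M (space M) = 1" and p: "1 < p"
  shows "ennpowr (\<integral>\<^sup>+x. g x \<partial>M) p \<le> (\<integral>\<^sup>+x. ennpowr (g x) p \<partial>M)"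
proof -
  let ?I = "\<integral>\<^sup>+x. g x \<partial>M" and ?J = "\<integral>\<^sup>+x. ennpowr (g x) p \<partial>M"
  have *: "ennreal (p * a powr (p - 1)) * ?I \<le> ?J + ennreal ((p - 1) * a powr p)" if "0 \<le> a" for a
  proof -
    have pt: "ennreal (p * a powr (p - 1)) * y \<le> ennpowr y p + ennreal ((p - 1) * a powr p)" for y
    proof (cases y)
      case (real c)
      then show ?thesis using Young_tangent[OF p that, of c] p
        by (auto simp: ennpowr_ennreal simp flip: ennreal_mult ennreal_plus intro!: ennreal_leI)
    qed simp
    have "ennreal (p * a powr (p - 1)) * ?I = (\<integral>\<^sup>+x. ennreal (p * a powr (p - 1)) * g x \<partial>M)"
      by (simp add: nn_integral_cmult)
    also have "\<dots> \<le> (\<integral>\<^sup>+x. ennpowr (g x) p + ennreal ((p - 1) * a powr p) \<partial>M)"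
      by (intro nn_integral_mono pt)
    also have "\<dots> = ?J + ennreal ((p - 1) * a powr p)"
      by (simp add: nn_integral_add M)
    finally show ?thesis .
  qed
  show ?thesis
  proof (cases ?I)
    case (real a)
    show ?thesis
    proof (cases ?J)
      case J: (real b)
      have "p * a powr (p - 1) * a \<le> b + (p - 1) * a powr p"
        using *[OF real(1)] real J p by (simp flip: ennreal_mult ennreal_plus)
      moreover have "a powr (p - 1) * a = a powr p"
        using real(1) by (cases "a = 0") (auto simp: powr_diff)
      then have "p * a powr (p - 1) * a = p * a powr p"
        by simp
      ultimately have "a powr p \<le> b"
        by (simp add: left_diff_distrib)
      then show ?thesis using real J by (simp add: ennpowr_ennreal)
    qed simp
  next
    case top
    then have "?J = top"
      using *[of 1] p by (auto simp: ennreal_mult_top top_unique)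
    then show ?thesis by simp
  qed
qed

section \<open>Maximal averages\<close>

text \<open>Subtraction in \<open>ennreal\<close> is truncated at 0, so this is the integral of the
  part of \<open>g\<close> above level \<open>q\<close>.\<close>

definition excess :: "('a::euclidean_space \<Rightarrow> ennreal) \<Rightarrow> real \<Rightarrow> ennreal" where
  "excess g q = (\<integral>\<^sup>+ x. g x - ennreal q \<partial>lborel)"

text \<open>This is \<open>g\<^sup>*\<^sup>*\<close>, in a form that is visibly measurable in parameters.\<close>
definition maxavg :: "('a::euclidean_space \<Rightarrow> ennreal) \<Rightarrow> real \<Rightarrow> ennreal" where
  "maxavg g s = (INF q\<in>{0::rat<..}. ennreal (of_rat q) + ennreal (1 / s) * excess g (of_rat q))"

lemma maxavg_le: "0 < q \<Longrightarrow> maxavg g s \<le> ennreal (of_rat q) + ennreal (1 / s) * excess g (of_rat q)"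
  unfolding maxavg_def by (rule INF_lower) simp

lemma le_maxavgI:
  assumes c: "0 < c"
    and le: "\<And>q::rat. 0 < q \<Longrightarrow> X \<le> ennreal c * (ennreal (of_rat q) + ennreal (1 / s) * excess g (of_rat q))"
  shows "X \<le> ennreal c * maxavg g s"
proof -
  have cc: "ennreal (1 / c) * ennreal c = 1" "ennreal c * ennreal (1 / c) = 1"
    using c by (simp_all flip: ennreal_mult)
  have "ennreal (1 / c) * X \<le> maxavg g s"
    unfolding maxavg_def
  proof (rule INF_greatest)
    fix q :: rat assume "q \<in> {0<..}"
    then have "ennreal (1 / c) * X \<le> ennreal (1 / c) * (ennreal c * (ennreal (of_rat q) + ennreal (1 / s) * excess g (of_rat q)))"
      by (intro mult_left_mono le) auto
    then show "ennreal (1 / c) * X \<le> ennreal (of_rat q) + ennreal (1 / s) * excess g (of_rat q)"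
      by (simp add: cc flip: mult.assoc)
  qed
  then have "ennreal c * (ennreal (1 / c) * X) \<le> ennreal c * maxavg g s"
    by (rule mult_left_mono) simp
  then show ?thesis by (simp add: cc flip: mult.assoc)
qed

lemma maxavg_antimono:
  assumes "0 < s" "s \<le> s'"
  shows "maxavg g s' \<le> maxavg g s"
  unfolding maxavg_def
  using assms by (intro INF_mono) (auto intro!: add_mono mult_right_mono ennreal_leI simp: frac_le)

lemma ennreal_le_add_diff: "(a::ennreal) \<le> b + (a - b)"
  by (metis ennreal_minus_le_iff linear)

section \<open>Averages over sets, dilated balls and translates\<close>

lemma nn_integral_translate:
  assumes [measurable]: "g \<in> borel_measurable borel"
  shows "(\<integral>\<^sup>+ x. g (x + v) \<partial>lborel) = (\<integral>\<^sup>+ x. g x \<partial>(lborel :: 'a::euclidean_space measure))"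
proof -
  have "(\<integral>\<^sup>+ x. g x \<partial>lborel) = (\<integral>\<^sup>+ x. g x \<partial>distr lborel borel ((+) v))"
    by (simp add: lborel_distr_plus)
  also have "\<dots> = (\<integral>\<^sup>+ x. g (v + x) \<partial>lborel)"
    by (rule nn_integral_distr) auto
  finally show ?thesis by (simp add: add.commute)
qed

lemma nn_integral_scale:
  fixes g :: "'a::euclidean_space \<Rightarrow> ennreal"
  assumes [measurable]: "g \<in> borel_measurable borel" and "0 < c"
  shows "(\<integral>\<^sup>+ x. g (a + c *\<^sub>R x) \<partial>lborel) = ennreal (1 / c ^ DIM('a)) * (\<integral>\<^sup>+ x. g x \<partial>lborel)"
proof -
  have "(\<integral>\<^sup>+ x. g x \<partial>lborel) = (\<integral>\<^sup>+ x. g x \<partial>density (distr lborel borel (\<lambda>x. a + c *\<^sub>R x)) (\<lambda>x. ennreal (\<bar>c\<bar> ^ DIM('a))))"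
    using lborel_affine[of c a] \<open>0 < c\<close> by simp
  also have "\<dots> = ennreal (c ^ DIM('a)) * (\<integral>\<^sup>+ x. g (a + c *\<^sub>R x) \<partial>lborel)"
    using \<open>0 < c\<close> by (subst nn_integral_density) (auto simp: nn_integral_distr nn_integral_cmult)
  finally show ?thesis
    using \<open>0 < c\<close> by (simp flip: mult.assoc ennreal_mult)
qed

text \<open>Splitting \<open>g\<close> at level \<open>q\<close> gives \<open>q\<close> times the
  measure of \<open>F\<close> plus the excess, whatever the position of \<open>F\<close>; the
  infimum over \<open>q\<close> is the maximal average.\<close>

lemma set_nn_integral_le_maxavg:
  fixes g :: "'a::euclidean_space \<Rightarrow> ennreal"
  assumes [measurable]: "g \<in> borel_measurable borel" "F \<in> sets borel"
    and s: "0 < s" and F: "emeasure lborel F \<le> ennreal s"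
  shows "(\<integral>\<^sup>+ x \<in> F. g x \<partial>lborel) \<le> ennreal s * maxavg g s"
proof (rule le_maxavgI[OF s])
  fix q :: rat assume q: "0 < q"
  have "(\<integral>\<^sup>+ x \<in> F. g x \<partial>lborel) \<le> (\<integral>\<^sup>+ x. ennreal (of_rat q) * indicator F x + (g x - ennreal (of_rat q)) \<partial>lborel)"
    by (intro nn_integral_mono) (auto simp: indicator_def ennreal_le_add_diff)
  also have "\<dots> = ennreal (of_rat q) * emeasure lborel F + excess g (of_rat q)"
    by (simp add: nn_integral_add nn_integral_cmult excess_def)
  also have "\<dots> \<le> ennreal (of_rat q) * ennreal s + excess g (of_rat q)"
    using F by (intro add_mono mult_left_mono) auto
  also have "\<dots> = ennreal s * (ennreal (of_rat q) + ennreal (1 / s) * excess g (of_rat q))"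
    using s by (simp add: distrib_left mult.commute flip: mult.assoc ennreal_mult)
  finally show "(\<integral>\<^sup>+ x \<in> F. g x \<partial>lborel) \<le> \<dots>" .
qed

text \<open>The same splitting after a dilation: in dimension \<open>n\<close> the excess scales by
  \<open>1 / c ^ n\<close>, so averages around all centres \<open>x\<close> are bounded by one
  number. This is the passage from integrals to uniform bounds.\<close>

lemma scaled_nn_integral_le_maxavg:
  fixes g :: "'a::euclidean_space \<Rightarrow> ennreal"
  assumes [measurable]: "g \<in> borel_measurable borel" "F \<in> sets borel"
    and F: "emeasure lborel F \<le> ennreal L" and L: "1 \<le> L" and c: "0 < c"
  shows "(\<integral>\<^sup>+ \<theta> \<in> F. g (x + c *\<^sub>R \<theta>) \<partial>lborel) \<le> ennreal L * maxavg g (c ^ DIM('a))"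
proof (rule le_maxavgI)
  show "0 < L" using L by simp
  fix q :: rat assume q: "0 < q"
  have "(\<integral>\<^sup>+ \<theta> \<in> F. g (x + c *\<^sub>R \<theta>) \<partial>lborel) \<le> (\<integral>\<^sup>+ \<theta>. ennreal (of_rat q) * indicator F \<theta> + (g (x + c *\<^sub>R \<theta>) - ennreal (of_rat q)) \<partial>lborel)"
    by (intro nn_integral_mono) (auto simp: indicator_def ennreal_le_add_diff)
  also have "\<dots> = ennreal (of_rat q) * emeasure lborel F + ennreal (1 / c ^ DIM('a)) * excess g (of_rat q)"
    using c nn_integral_scale[of "\<lambda>x. g x - ennreal (of_rat q)" c x]
    by (simp add: nn_integral_add nn_integral_cmult excess_def)
  also have "\<dots> \<le> ennreal (of_rat q) * ennreal L + ennreal L * (ennreal (1 / c ^ DIM('a)) * excess g (of_rat q))"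
  proof (intro add_mono mult_left_mono F)
    have "1 * (ennreal (1 / c ^ DIM('a)) * excess g (of_rat q)) \<le> ennreal L * (ennreal (1 / c ^ DIM('a)) * excess g (of_rat q))"
      using L by (intro mult_right_mono) auto
    then show "ennreal (1 / c ^ DIM('a)) * excess g (of_rat q) \<le> ennreal L * (ennreal (1 / c ^ DIM('a)) * excess g (of_rat q))"
      by simp
  qed auto
  also have "\<dots> = ennreal L * (ennreal (of_rat q) + ennreal (1 / c ^ DIM('a)) * excess g (of_rat q))"
    by (simp add: distrib_left mult.commute)
  finally show "(\<integral>\<^sup>+ \<theta> \<in> F. g (x + c *\<^sub>R \<theta>) \<partial>lborel) \<le> \<dots>" .
qed

lemma measurable_maxavg [measurable]:
  fixes g :: "'b \<Rightarrow> 'a::euclidean_space \<Rightarrow> ennreal"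
  assumes [measurable]: "(\<lambda>(y, x). g y x) \<in> borel_measurable (M \<Otimes>\<^sub>M lborel)" "s \<in> borel_measurable M"
  shows "(\<lambda>y. maxavg (g y) (s y)) \<in> borel_measurable M"
  unfolding maxavg_def excess_def by measurable

lemma measurable_maxavg_const [measurable]:
  fixes g :: "'a::euclidean_space \<Rightarrow> ennreal"
  assumes [measurable]: "s \<in> borel_measurable M"
  shows "(\<lambda>y. maxavg g (s y)) \<in> borel_measurable M"
  unfolding maxavg_def by measurable

text \<open>Truncating \<open>h\<close> at \<open>q\<close> corresponds to truncating
  \<open>g\<close> at \<open>B * q\<close>, and the excess of \<open>h\<close> is not changed by
  translation. This plays the part of subadditivity for finite sums of translates.\<close>

lemma maxavg_le_translates:
  fixes g h :: "'a::euclidean_space \<Rightarrow> ennreal" and b :: "'i \<Rightarrow> nat"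
  assumes [measurable]: "h \<in> borel_measurable borel" "g \<in> borel_measurable borel" and A: "finite A"
    and le: "\<And>x. g x \<le> (\<Sum>i\<in>A. of_nat (b i) * h (x + v i))"
    and B: "B = (\<Sum>i\<in>A. b i)" "0 < B"
  shows "maxavg g s \<le> ennreal (real B) * maxavg h s"
proof (rule le_maxavgI)
  show "0 < real B" using B(2) by simp
  fix q :: rat assume q: "0 < q"
  define q' where "q' = of_nat B * q"
  have "ennreal (of_rat q') = of_nat B * ennreal (of_rat q)"
    using q by (simp add: q'_def of_rat_mult ennreal_mult flip: ennreal_of_nat_eq_real_of_nat)
  moreover have "0 < q'" using q B(2) by (simp add: q'_def)
  ultimately have q': "0 < q'" "ennreal (of_rat q') = (\<Sum>i\<in>A. of_nat (b i) * ennreal (of_rat q))"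
    by (auto simp: B(1) sum_distrib_right)
  have pt: "g x - ennreal (of_rat q') \<le> (\<Sum>i\<in>A. of_nat (b i) * (h (x + v i) - ennreal (of_rat q)))" for x
  proof -
    have "g x \<le> (\<Sum>i\<in>A. of_nat (b i) * (ennreal (of_rat q) + (h (x + v i) - ennreal (of_rat q))))"
      by (rule order_trans[OF le]) (intro sum_mono mult_left_mono ennreal_le_add_diff, simp)
    also have "\<dots> = ennreal (of_rat q') + (\<Sum>i\<in>A. of_nat (b i) * (h (x + v i) - ennreal (of_rat q)))"
      by (simp add: distrib_left sum.distrib q'(2))
    finally show ?thesis by (auto simp: ennreal_minus_le_iff)
  qed
  have tr: "(\<integral>\<^sup>+x. h (x + v i) - ennreal (of_rat q) \<partial>lborel) = excess h (of_rat q)" for i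
    using nn_integral_translate[of "\<lambda>x. h x - ennreal (of_rat q)" "v i"] by (simp add: excess_def)
  have "excess g (of_rat q') \<le> (\<integral>\<^sup>+x. (\<Sum>i\<in>A. of_nat (b i) * (h (x + v i) - ennreal (of_rat q))) \<partial>lborel)"
    unfolding excess_def by (intro nn_integral_mono pt)
  also have "\<dots> = (\<Sum>i\<in>A. of_nat (b i) * excess h (of_rat q))"
    using A by (simp add: nn_integral_sum nn_integral_cmult tr)
  also have "\<dots> = ennreal (real B) * excess h (of_rat q)"
    unfolding ennreal_of_nat_eq_real_of_nat[symmetric] B(1) by (simp add: sum_distrib_right)
  finally have ex: "excess g (of_rat q') \<le> ennreal (real B) * excess h (of_rat q)" .
  have "maxavg g s \<le> ennreal (of_rat q') + ennreal (1 / s) * excess g (of_rat q')"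
    by (rule maxavg_le[OF q'(1)])
  also have "\<dots> \<le> ennreal (real B) * ennreal (of_rat q) + ennreal (1 / s) * (ennreal (real B) * excess h (of_rat q))"
    using q by (intro add_mono mult_left_mono ex) (auto simp: q'_def of_rat_mult ennreal_mult)
  also have "\<dots> = ennreal (real B) * (ennreal (of_rat q) + ennreal (1 / s) * excess h (of_rat q))"
    by (simp add: distrib_left mult_ac)
  finally show "maxavg g s \<le> \<dots>" .
qed

text \<open>Interpolation: \<open>maxavg g s > l\<close> forces \<open>s\<close> to be at most \<open>2 / l\<close> times the integral of
  \<open>(g - l / 4)\<^sub>+\<close>.\<close>
lemma Hardy_maxavg:
  fixes g :: "'a::euclidean_space \<Rightarrow> ennreal"
  assumes [measurable]: "g \<in> borel_measurable borel" and fin: "\<And>x. g x \<noteq> top" and p: "1 < p"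
  shows "(\<integral>\<^sup>+ s \<in> {0<..}. ennpowr (maxavg g s) p \<partial>lborel)
    \<le> ennreal (2 * p / (p - 1) * 4 powr (p - 1)) * (\<integral>\<^sup>+ x. ennpowr (g x) p \<partial>lborel)"
proof -
  have level: "emeasure lborel {s. 0 < s \<and> ennreal l < maxavg g s} \<le> ennreal (2 / l) * excess g (l / 4)"
    if l: "0 < l" for l
  proof -
    \<comment> \<open>Levels in \<open>maxavg\<close> are rational. One strictly between
      \<open>l / 4\<close> and \<open>l / 2\<close> leaves at least \<open>l / 2\<close> to be
      covered by the excess, and the excess at \<open>q\<close> is at most that at
      \<open>l / 4\<close>.\<close>
    obtain q where q: "l / 4 < of_rat q" "of_rat q < l / 2"
      using of_rat_dense[of "l / 4" "l / 2"] l by auto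
    then have q0: "0 < (q::rat)" using l by (metis (no_types) divide_pos_pos less_trans zero_less_numeral zero_less_of_rat_iff)
    let ?c = "ennreal (2 / l) * excess g (l / 4)"
    have "ennreal s \<le> ?c" if s: "0 < s" "ennreal l < maxavg g s" for s
    proof -
      have "ennreal l \<le> ennreal (of_rat q) + ennreal (1 / s) * excess g (of_rat q)"
        using s maxavg_le[OF q0, of g s] by simp
      also have "\<dots> \<le> ennreal (l / 2) + ennreal (1 / s) * excess g (l / 4)"
        using q unfolding excess_def
        by (intro add_mono mult_left_mono nn_integral_mono ennreal_minus_mono ennreal_leI) auto
      finally have *: "ennreal l \<le> ennreal (l / 2) + ennreal (1 / s) * excess g (l / 4)" .
      show ?thesis
      proof (cases "excess g (l / 4)")
        case (real b)
        with * have "l \<le> l / 2 + b / s"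
          using l s by (simp flip: ennreal_mult ennreal_plus)
        then show ?thesis using real l s
          by (simp add: field_simps flip: ennreal_mult)
      qed (use l in \<open>simp add: ennreal_mult_top\<close>)
    qed
    then have sub: "{s. 0 < s \<and> ennreal l < maxavg g s} \<subseteq> {s. 0 < s \<and> ennreal s \<le> ?c}"
      by auto
    show ?thesis
    proof (cases ?c)
      case (real b)
      then have "{s. 0 < s \<and> ennreal l < maxavg g s} \<subseteq> {0..b}"
        using sub by auto
      then have "emeasure lborel {s. 0 < s \<and> ennreal l < maxavg g s} \<le> emeasure lborel {0..b}"
        by (intro emeasure_mono) auto
      then show ?thesis using real by simp
    qed simp
  qed
  \<comment> \<open>Layer cake in the value of \<open>maxavg g s\<close>, then the level estimate; a
    second use of Tonelli moves the \<open>l\<close>-integral inside the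
    \<open>x\<close>-integral.\<close>
  have "(\<integral>\<^sup>+ s \<in> {0<..}. ennpowr (maxavg g s) p \<partial>lborel)
     = (\<integral>\<^sup>+ s. (\<integral>\<^sup>+ l. ennreal (p * l powr (p - 1)) * indicator {0<..} l * indicator {l. ennreal l < maxavg g s} l * indicator {0<..} s \<partial>lborel) \<partial>lborel)"
    using p by (intro nn_integral_cong)
      (auto simp: ennpowr_layer_cake[of p] indicator_def intro!: nn_integral_cong)
  also have "\<dots> = (\<integral>\<^sup>+ l. (\<integral>\<^sup>+ s. ennreal (p * l powr (p - 1)) * indicator {0<..} l * indicator {l. ennreal l < maxavg g s} l * indicator {0<..} s \<partial>lborel) \<partial>lborel)"
    by (rule lborel_pair.Fubini') (simp add: indicator_def)
  also have "\<dots> = (\<integral>\<^sup>+ l. ennreal (p * l powr (p - 1)) * indicator {0<..} l * emeasure lborel {s. 0 < s \<and> ennreal l < maxavg g s} \<partial>lborel)"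
  proof (intro nn_integral_cong)
    fix l :: real
    have "(\<integral>\<^sup>+ s. ennreal (p * l powr (p - 1)) * indicator {0<..} l * indicator {l. ennreal l < maxavg g s} l * indicator {0<..} s \<partial>lborel)
       = (\<integral>\<^sup>+ s. ennreal (p * l powr (p - 1)) * indicator {0<..} l * indicator {s. 0 < s \<and> ennreal l < maxavg g s} s \<partial>lborel)"
      by (intro nn_integral_cong) (auto simp: indicator_def)
    then show "(\<integral>\<^sup>+ s. ennreal (p * l powr (p - 1)) * indicator {0<..} l * indicator {l. ennreal l < maxavg g s} l * indicator {0<..} s \<partial>lborel)
      = ennreal (p * l powr (p - 1)) * indicator {0<..} l * emeasure lborel {s. 0 < s \<and> ennreal l < maxavg g s}"
      by (simp add: nn_integral_cmult)
  qed
  also have "\<dots> \<le> (\<integral>\<^sup>+ l. ennreal (p * l powr (p - 1)) * indicator {0<..} l * (ennreal (2 / l) * excess g (l / 4)) \<partial>lborel)"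
  proof (intro nn_integral_mono)
    fix l :: real
    show "ennreal (p * l powr (p - 1)) * indicator {0<..} l * emeasure lborel {s. 0 < s \<and> ennreal l < maxavg g s}
      \<le> ennreal (p * l powr (p - 1)) * indicator {0<..} l * (ennreal (2 / l) * excess g (l / 4))"
      using level[of l] by (cases "0 < l") (auto intro!: mult_left_mono)
  qed
  also have "\<dots> = (\<integral>\<^sup>+ l. (\<integral>\<^sup>+ x. ennreal (2 * p * l powr (p - 2)) * indicator {0<..} l * (g x - ennreal (l / 4)) \<partial>lborel) \<partial>lborel)"
  proof (intro nn_integral_cong)
    fix l :: real
    show "ennreal (p * l powr (p - 1)) * indicator {0<..} l * (ennreal (2 / l) * excess g (l / 4))
      = (\<integral>\<^sup>+ x. ennreal (2 * p * l powr (p - 2)) * indicator {0<..} l * (g x - ennreal (l / 4)) \<partial>lborel)"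
    proof (cases "0 < l")
      case True
      have "p * l powr (p - 1) * (2 / l) = 2 * p * l powr (p - 2)"
        using True by (simp add: powr_diff field_simps power2_eq_square)
      then have "ennreal (p * l powr (p - 1)) * ennreal (2 / l) = ennreal (2 * p * l powr (p - 2))"
        using True p by (simp flip: ennreal_mult)
      then show ?thesis using True
        by (simp add: excess_def nn_integral_cmult flip: mult.assoc)
    qed simp
  qed
  also have "\<dots> = (\<integral>\<^sup>+ x. (\<integral>\<^sup>+ l. ennreal (2 * p * l powr (p - 2)) * indicator {0<..} l * (g x - ennreal (l / 4)) \<partial>lborel) \<partial>lborel)"
    by (rule pair_sigma_finite.Fubini'[of lborel lborel]) (simp_all add: pair_sigma_finite_def sigma_finite_lborel)
  also have "\<dots> \<le> (\<integral>\<^sup>+ x. ennreal (2 * p / (p - 1) * 4 powr (p - 1)) * ennpowr (g x) p \<partial>lborel)"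
  proof (intro nn_integral_mono)
    fix x
    obtain y where y: "0 \<le> y" "g x = ennreal y"
      using fin[of x] by (cases "g x") auto
    \<comment> \<open>The truncated factor is at most \<open>y\<close> and vanishes for
      \<open>l \<ge> 4 * y\<close>; the remaining power is integrable at 0 because
      \<open>p > 1\<close>.\<close>
    have "(\<integral>\<^sup>+ l. ennreal (2 * p * l powr (p - 2)) * indicator {0<..} l * (g x - ennreal (l / 4)) \<partial>lborel)
      \<le> (\<integral>\<^sup>+ l. ennreal (2 * p / (p - 1) * y) * (ennreal ((p - 1) * l powr (p - 1 - 1)) * indicator {0<..<4 * y} l) \<partial>lborel)"
    proof (intro nn_integral_mono)
      fix l :: real
      show "ennreal (2 * p * l powr (p - 2)) * indicator {0<..} l * (g x - ennreal (l / 4))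
        \<le> ennreal (2 * p / (p - 1) * y) * (ennreal ((p - 1) * l powr (p - 1 - 1)) * indicator {0<..<4 * y} l)"
      proof (cases "0 < l \<and> l < 4 * y")
        case True
        then have "(2 * p * l powr (p - 2)) * (y - l / 4) \<le> (2 * p * l powr (p - 2)) * y"
          using p by (intro mult_left_mono) auto
        then show ?thesis using True p y
          by (simp add: ennreal_minus indicator_def flip: ennreal_mult)
      next
        case False
        then show ?thesis using y
          by (auto simp: indicator_def ennreal_minus ennreal_neg)
      qed
    qed
    also have "\<dots> = ennreal (2 * p / (p - 1) * y) * (\<integral>\<^sup>+ l. (ennreal ((p - 1) * l powr (p - 1 - 1)) * indicator {0<..<4 * y} l) \<partial>lborel)"
      by (intro nn_integral_cmult) auto
    also have "\<dots> = ennreal (2 * p / (p - 1) * y) * ennreal ((4 * y) powr (p - 1))"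
      using nn_integral_powr_from_0[of "p - 1" "4 * y"] p y by simp
    also have "\<dots> = ennreal (2 * p / (p - 1) * 4 powr (p - 1)) * ennpowr (g x) p"
      using y p by (cases "y = 0") (auto simp: ennpowr_ennreal powr_mult powr_diff simp flip: ennreal_mult)
    finally show "(\<integral>\<^sup>+ l. ennreal (2 * p * l powr (p - 2)) * indicator {0<..} l * (g x - ennreal (l / 4)) \<partial>lborel)
      \<le> \<dots>" .
  qed
  also have "\<dots> = ennreal (2 * p / (p - 1) * 4 powr (p - 1)) * (\<integral>\<^sup>+ x. ennpowr (g x) p \<partial>lborel)"
    by (simp add: nn_integral_cmult)
  finally show ?thesis .
qed

text \<open>Where \<open>g > q\<close>, the truncated value is at most \<open>g\<close>, and
  \<open>g \<le> q powr (1 - p) * g powr p\<close> since \<open>p > 1\<close>.\<close>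

lemma excess_finite:
  fixes g :: "'a::euclidean_space \<Rightarrow> ennreal"
  assumes [measurable]: "g \<in> borel_measurable borel"
    and int: "(\<integral>\<^sup>+ x. ennpowr (g x) p \<partial>lborel) < top" and p: "1 < p" and q: "0 < q"
  shows "excess g q < top"
proof -
  have "excess g q \<le> (\<integral>\<^sup>+ x. ennreal (q powr (1 - p)) * ennpowr (g x) p \<partial>lborel)"
    unfolding excess_def
  proof (intro nn_integral_mono)
    fix x
    show "g x - ennreal q \<le> ennreal (q powr (1 - p)) * ennpowr (g x) p"
    proof (cases "g x")
      case (real y)
      show ?thesis
      proof (cases "q < y")
        case True
        have "y = y powr (1 - p) * y powr p"
          using True q by (simp flip: powr_add)
        also have "\<dots> \<le> q powr (1 - p) * y powr p"
          using True q p by (intro mult_right_mono powr_mono2') auto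
        finally have "y - q \<le> q powr (1 - p) * y powr p" using q by simp
        then show ?thesis using real q
          by (simp add: ennpowr_ennreal ennreal_minus ennreal_leI flip: ennreal_mult)
      next
        case False
        then show ?thesis using real q by (simp add: ennreal_minus ennreal_neg)
      qed
    next
      case top
      then show ?thesis using q by (simp add: ennreal_mult_top)
    qed
  qed
  also have "\<dots> = ennreal (q powr (1 - p)) * (\<integral>\<^sup>+ x. ennpowr (g x) p \<partial>lborel)"
    by (simp add: nn_integral_cmult)
  also have "\<dots> < top"
    using int by (simp add: ennreal_mult_less_top)
  finally show ?thesis .
qed

lemma maxavg_finite:
  fixes g :: "'a::euclidean_space \<Rightarrow> ennreal"
  assumes "g \<in> borel_measurable borel"
    and "(\<integral>\<^sup>+ x. ennpowr (g x) p \<partial>lborel) < top" and "1 < p"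
  shows "maxavg g s < top"
proof -
  have "excess g 1 < top"
    by (rule excess_finite[OF assms]) simp
  then have "ennreal (of_rat 1) + ennreal (1 / s) * excess g (of_rat 1) < top"
    by (simp add: ennreal_mult_less_top)
  then show ?thesis
    using maxavg_le[of 1 g s] by (simp add: order_le_less_trans)
qed

text \<open>A small level \<open>q\<close> bounds the first term, and then a large \<open>s\<close>
  dilutes the excess above \<open>q\<close>, which is finite.\<close>

lemma maxavg_tendsto_0:
  fixes g :: "'a::euclidean_space \<Rightarrow> ennreal"
  assumes "g \<in> borel_measurable borel"
    and "(\<integral>\<^sup>+ x. ennpowr (g x) p \<partial>lborel) < top" and "1 < p"
  shows "(maxavg g \<longlongrightarrow> 0) at_top"
proof (rule order_tendstoI)
  fix e :: ennreal assume "0 < e"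
  then obtain e' where e': "0 < e'" "ennreal e' < e"
  proof -
    obtain d where d: "0 < d" "d < e" using dense \<open>0 < e\<close> by blast
    then obtain d' where "0 \<le> d'" "d = ennreal d'" by (cases d) auto
    with d that[of d'] show ?thesis by auto
  qed
  obtain q where q: "0 < (of_rat q :: real)" "of_rat q < e' / 2"
    using of_rat_dense[of 0 "e' / 2"] e' by auto
  then have q0: "0 < (q::rat)" by simp
  obtain b where b: "0 \<le> b" "excess g (of_rat q) = ennreal b"
    using excess_finite[OF assms q(1)] by (cases "excess g (of_rat q)") auto
  have "\<forall>\<^sub>F s in at_top. 2 * b / e' + 1 < s"
    by (rule eventually_gt_at_top)
  then show "\<forall>\<^sub>F s in at_top. maxavg g s < e"
  proof eventually_elim
    case (elim s)
    have s: "0 < s" using elim b e' by (smt (verit) divide_nonneg_pos)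
    have "b / s < e' / 2"
    proof -
      have "2 * b / e' < s" using elim by simp
      then show ?thesis using s e' by (simp add: field_simps)
    qed
    have "maxavg g s \<le> ennreal (of_rat q) + ennreal (1 / s) * ennreal b"
      using maxavg_le[OF q0, of g s] b by simp
    also have "\<dots> = ennreal (of_rat q + b / s)"
      using s b q by (simp flip: ennreal_mult ennreal_plus)
    also have "\<dots> \<le> ennreal e'"
      using q \<open>b / s < e' / 2\<close> by (intro ennreal_leI) linarith
    finally show ?case using e' by simp
  qed
qed simp

section \<open>The gap between the maximal and the decreasing rearrangement\<close>

lemma emeasure_lebesgue_borel: "A \<in> sets borel \<Longrightarrow> emeasure lebesgue A = emeasure lborel A"
  by simp

text \<open>Beyond \<open>l0\<close>, the rearrangement at \<open>\<sigma>\<close> is at most the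
  length of the set of levels whose superlevel sets have measure more than \<open>\<sigma>\<close>.
  Integrating in \<open>\<sigma>\<close> and exchanging the order turns this into the integral of
  the distribution function over \<open>l > l0\<close>, that is, into the excess.\<close>

lemma maximal_rearrangement_le_excess:
  fixes f :: "'a::euclidean_space \<Rightarrow> real"
  assumes [measurable]: "f \<in> borel_measurable borel" and s: "0 < s" and l0: "0 \<le> l0"
  shows "maximal_rearrangement f s \<le> ennreal l0 + ennreal (1 / s) * excess (\<lambda>x. ennreal \<bar>f x\<bar>) l0"
proof -
  define \<mu> where "\<mu> l = emeasure lborel {x. \<bar>f x\<bar> > l}" for l
  have \<mu>_eq: "emeasure lebesgue {x. \<bar>f x\<bar> > l} = \<mu> l" for l
    unfolding \<mu>_def by (rule emeasure_lebesgue_borel) measurable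
  have [measurable]: "\<mu> \<in> borel_measurable borel"
    unfolding \<mu>_def by measurable
  define J where "J \<sigma> = (\<integral>\<^sup>+ l \<in> {l0<..}. indicator {l. ennreal \<sigma> < \<mu> l} l \<partial>lborel)" for \<sigma>
  have [measurable]: "J \<in> borel_measurable borel"
    unfolding J_def by measurable
  have rearr: "rearrangement f \<sigma> \<le> ennreal l0 + J \<sigma>" for \<sigma>
  proof -
    have "rearrangement f \<sigma> \<le> ennreal l0 + ennreal c" if c: "0 \<le> c" "J \<sigma> = ennreal c" for c
    proof (rule ennreal_le_epsilon)
      fix e :: real assume e: "0 < e"
      \<comment> \<open>If every level in this interval were inadmissible, its whole length
        \<open>c + e\<close> would count towards \<open>J \<sigma> = c\<close>.\<close>
      have "\<exists>l\<in>{l0<..l0 + c + e}. \<mu> l \<le> ennreal \<sigma>"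
      proof (rule ccontr)
        assume "\<not> ?thesis"
        then have "\<And>l. l \<in> {l0<..l0 + c + e} \<Longrightarrow> ennreal \<sigma> < \<mu> l" by force
        then have "(\<integral>\<^sup>+ l. indicator {l0<..l0 + c + e} l \<partial>lborel) \<le> J \<sigma>"
          unfolding J_def by (intro nn_integral_mono) (auto simp: indicator_def)
        then show False using c e by simp
      qed
      then obtain l where l: "l0 < l" "l \<le> l0 + c + e" "\<mu> l \<le> ennreal \<sigma>" by auto
      then have "rearrangement f \<sigma> \<le> ennreal l"
        unfolding rearrangement_def using l0 by (intro INF_lower) (auto simp: \<mu>_eq)
      also have "\<dots> \<le> ennreal l0 + ennreal c + ennreal e"
        using l l0 c e by (simp flip: ennreal_plus)
      finally show "rearrangement f \<sigma> \<le> ennreal l0 + ennreal c + ennreal e" .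
    qed
    then show ?thesis by (cases "J \<sigma>") auto
  qed
  have "(\<integral>\<^sup>+ \<sigma> \<in> {0<..<s}. rearrangement f \<sigma> \<partial>lborel)
      \<le> (\<integral>\<^sup>+ \<sigma>. ennreal l0 * indicator {0<..<s} \<sigma> + J \<sigma> * indicator {0<..} \<sigma> \<partial>lborel)"
    by (intro nn_integral_mono) (auto simp: indicator_def rearr)
  also have "\<dots> = ennreal l0 * ennreal s + (\<integral>\<^sup>+ \<sigma>. J \<sigma> * indicator {0<..} \<sigma> \<partial>lborel)"
    using s by (simp add: nn_integral_add nn_integral_cmult)
  also have "(\<integral>\<^sup>+ \<sigma>. J \<sigma> * indicator {0<..} \<sigma> \<partial>lborel)
    = (\<integral>\<^sup>+ \<sigma>. (\<integral>\<^sup>+ l. indicator {l. ennreal \<sigma> < \<mu> l} l * indicator {l0<..} l * indicator {0<..} \<sigma> \<partial>lborel) \<partial>lborel)"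
    unfolding J_def by (intro nn_integral_cong) (simp add: nn_integral_multc)
  also have "\<dots> = (\<integral>\<^sup>+ l. (\<integral>\<^sup>+ \<sigma>. indicator {l. ennreal \<sigma> < \<mu> l} l * indicator {l0<..} l * indicator {0<..} \<sigma> \<partial>lborel) \<partial>lborel)"
    by (rule lborel_pair.Fubini') (simp add: indicator_def)
  also have "\<dots> \<le> (\<integral>\<^sup>+ l. \<mu> l * indicator {l0<..} l \<partial>lborel)"
  proof (intro nn_integral_mono)
    fix l
    have "(\<integral>\<^sup>+ \<sigma>. indicator {l. ennreal \<sigma> < \<mu> l} l * indicator {0<..} \<sigma> \<partial>lborel) \<le> \<mu> l"
    proof (cases "\<mu> l")
      case (real b)
      then have "(\<integral>\<^sup>+ \<sigma>. indicator {l. ennreal \<sigma> < \<mu> l} l * indicator {0<..} \<sigma> \<partial>lborel)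
         \<le> (\<integral>\<^sup>+ \<sigma>. indicator {0..b} \<sigma> \<partial>lborel)"
        by (intro nn_integral_mono) (auto simp: indicator_def ennreal_less_iff)
      then show ?thesis using real by simp
    qed simp
    then show "(\<integral>\<^sup>+ \<sigma>. indicator {l. ennreal \<sigma> < \<mu> l} l * indicator {l0<..} l * indicator {0<..} \<sigma> \<partial>lborel)
      \<le> \<mu> l * indicator {l0<..} l"
      by (auto simp: indicator_def)
  qed
  also have "\<dots> = (\<integral>\<^sup>+ l. (\<integral>\<^sup>+ x. indicator {x. \<bar>f x\<bar> > l} x * indicator {l0<..} l \<partial>lborel) \<partial>lborel)"
    unfolding \<mu>_def by (intro nn_integral_cong) (simp add: nn_integral_multc)
  also have "\<dots> = (\<integral>\<^sup>+ x. (\<integral>\<^sup>+ l. indicator {x. \<bar>f x\<bar> > l} x * indicator {l0<..} l \<partial>lborel) \<partial>lborel)"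
    by (rule pair_sigma_finite.Fubini'[of lborel lborel])
       (simp_all add: pair_sigma_finite_def sigma_finite_lborel indicator_def)
  also have "\<dots> = excess (\<lambda>x. ennreal \<bar>f x\<bar>) l0"
    unfolding excess_def
  proof (intro nn_integral_cong)
    fix x
    have "(\<integral>\<^sup>+ l. indicator {x. \<bar>f x\<bar> > l} x * indicator {l0<..} l \<partial>lborel) = (\<integral>\<^sup>+ l. indicator {l0<..<\<bar>f x\<bar>} l \<partial>lborel)"
      by (intro nn_integral_cong) (auto simp: indicator_def)
    also have "\<dots> = ennreal \<bar>f x\<bar> - ennreal l0"
      using l0 by (cases "l0 \<le> \<bar>f x\<bar>") (simp_all add: ennreal_minus ennreal_neg)
    finally show "(\<integral>\<^sup>+ l. indicator {x. \<bar>f x\<bar> > l} x * indicator {l0<..} l \<partial>lborel) = ennreal \<bar>f x\<bar> - ennreal l0" .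
  qed
  finally have main: "(\<integral>\<^sup>+ \<sigma> \<in> {0<..<s}. rearrangement f \<sigma> \<partial>lborel) \<le> ennreal l0 * ennreal s + excess (\<lambda>x. ennreal \<bar>f x\<bar>) l0"
    by (auto intro: add_left_mono)
  have "maximal_rearrangement f s = ennreal (1 / s) * (\<integral>\<^sup>+ \<sigma> \<in> {0<..<s}. rearrangement f \<sigma> \<partial>lborel)"
    using s by (simp add: maximal_rearrangement_def divide_ennreal_def inverse_ennreal mult.commute inverse_eq_divide)
  also have "\<dots> \<le> ennreal (1 / s) * (ennreal l0 * ennreal s + excess (\<lambda>x. ennreal \<bar>f x\<bar>) l0)"
    by (intro mult_left_mono main) simp
  also have "\<dots> = ennreal l0 + ennreal (1 / s) * excess (\<lambda>x. ennreal \<bar>f x\<bar>) l0"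
    using s l0 by (simp add: distrib_left flip: ennreal_mult)
  finally show ?thesis .
qed

text \<open>At least half of the translates \<open>x + h\<close> with \<open>h\<close> in a set of measure \<open>2 s\<close> leave the
  superlevel set \<open>{x. \<bar>f x\<bar> > l}\<close>, and there \<open>\<bar>f x\<bar> - l \<le> \<bar>f x - f (x + h)\<bar>\<close>.\<close>
lemma excess_le_differences:
  fixes f :: "'a::euclidean_space \<Rightarrow> real"
  assumes [measurable]: "f \<in> borel_measurable borel" "Q \<in> sets borel" and s: "0 < s"
    and E: "emeasure lborel {x. \<bar>f x\<bar> > l} \<le> ennreal s" and Q: "emeasure lborel Q = ennreal (2 * s)"
    and l: "0 \<le> l"
    and X: "\<And>h. h \<in> Q \<Longrightarrow> (\<integral>\<^sup>+ x \<in> {x. \<bar>f x\<bar> > l}. ennreal \<bar>f (x + h) - f x\<bar> \<partial>lborel) \<le> X"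
  shows "excess (\<lambda>x. ennreal \<bar>f x\<bar>) l \<le> ennreal 2 * X"
proof -
  let ?E = "{x. \<bar>f x\<bar> > l}"
  \<comment> \<open>The right side stays an integral over \<open>h\<close>, so that after Tonelli
    every fixed \<open>h\<close> is paired with the same set \<open>?E\<close>, of measure at most
    \<open>s\<close>.\<close>
  have pt: "ennreal s * (ennreal \<bar>f x\<bar> - ennreal l)
     \<le> (\<integral>\<^sup>+ h. ennreal \<bar>f (x + h) - f x\<bar> * indicator ?E x * indicator Q h \<partial>lborel)" for x
  proof (cases "x \<in> ?E")
    case True
    define G where "G = {h \<in> Q. \<bar>f (x + h)\<bar> \<le> l}"
    have [measurable]: "G \<in> sets borel" unfolding G_def by measurable
    have "emeasure lborel {h. \<bar>f (x + h)\<bar> > l} = (\<integral>\<^sup>+ h. indicator {h. \<bar>f (x + h)\<bar> > l} h \<partial>lborel)"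
      by simp
    also have "\<dots> = (\<integral>\<^sup>+ h. indicator ?E (h + x) \<partial>lborel)"
      by (intro nn_integral_cong) (simp add: indicator_def add.commute)
    also have "\<dots> = emeasure lborel ?E"
      by (subst nn_integral_translate) auto
    finally have bad: "emeasure lborel {h. \<bar>f (x + h)\<bar> > l} \<le> ennreal s" using E by simp
    have "ennreal (2 * s) \<le> emeasure lborel (G \<union> {h. \<bar>f (x + h)\<bar> > l})"
      unfolding Q[symmetric] by (intro emeasure_mono) (auto simp: G_def)
    also have "\<dots> \<le> emeasure lborel G + emeasure lborel {h. \<bar>f (x + h)\<bar> > l}"
      by (intro emeasure_subadditive) auto
    also have "\<dots> \<le> emeasure lborel G + ennreal s"
      by (intro add_left_mono bad)
    finally have G: "ennreal s \<le> emeasure lborel G"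
      using s by (cases "emeasure lborel G") (auto simp flip: ennreal_plus)
    have "ennreal s * (ennreal \<bar>f x\<bar> - ennreal l) \<le> (\<integral>\<^sup>+ h. (ennreal \<bar>f x\<bar> - ennreal l) * indicator G h \<partial>lborel)"
      using mult_right_mono[OF G, of "ennreal \<bar>f x\<bar> - ennreal l"]
      by (simp add: nn_integral_cmult) (simp add: mult.commute)
    also have "\<dots> \<le> (\<integral>\<^sup>+ h. ennreal \<bar>f (x + h) - f x\<bar> * indicator ?E x * indicator Q h \<partial>lborel)"
      using True l by (intro nn_integral_mono) (auto simp: indicator_def G_def ennreal_minus intro!: ennreal_leI)
    finally show ?thesis .
  next
    case False
    then show ?thesis using l by (simp add: ennreal_minus ennreal_neg)
  qed
  have "ennreal s * excess (\<lambda>x. ennreal \<bar>f x\<bar>) l = (\<integral>\<^sup>+ x. ennreal s * (ennreal \<bar>f x\<bar> - ennreal l) \<partial>lborel)"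
    by (simp add: excess_def nn_integral_cmult)
  also have "\<dots> \<le> (\<integral>\<^sup>+ x. (\<integral>\<^sup>+ h. ennreal \<bar>f (x + h) - f x\<bar> * indicator ?E x * indicator Q h \<partial>lborel) \<partial>lborel)"
    by (intro nn_integral_mono pt)
  also have "\<dots> = (\<integral>\<^sup>+ h. (\<integral>\<^sup>+ x. ennreal \<bar>f (x + h) - f x\<bar> * indicator ?E x * indicator Q h \<partial>lborel) \<partial>lborel)"
    by (rule lborel_pair.Fubini') measurable
  also have "\<dots> \<le> (\<integral>\<^sup>+ h. X * indicator Q h \<partial>lborel)"
    using X by (intro nn_integral_mono) (auto simp: indicator_def)
  also have "\<dots> = X * ennreal (2 * s)"
    by (simp add: nn_integral_cmult Q)
  finally have "ennreal (1 / s) * (ennreal s * excess (\<lambda>x. ennreal \<bar>f x\<bar>) l) \<le> ennreal (1 / s) * (X * ennreal (2 * s))"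
    by (rule mult_left_mono) simp
  moreover have "ennreal (1 / s) * (X * ennreal (2 * s)) = ennreal 2 * X"
  proof -
    have "ennreal (1 / s) * ennreal (2 * s) = ennreal 2"
      using s by (simp flip: ennreal_mult)
    then show ?thesis by (metis mult.left_commute mult.commute)
  qed
  moreover have "ennreal (1 / s) * (ennreal s * excess (\<lambda>x. ennreal \<bar>f x\<bar>) l) = excess (\<lambda>x. ennreal \<bar>f x\<bar>) l"
    using s by (simp flip: mult.assoc ennreal_mult)
  ultimately show ?thesis by simp
qed

text \<open>Chebyshev's inequality. Finiteness matters because \<open>top - top\<close> is
  \<open>top\<close> in \<open>ennreal\<close>, so the gap would be infinite if both rearrangements
  were.\<close>

lemma rearrangement_finite:
  fixes f :: "'a::euclidean_space \<Rightarrow> real"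
  assumes [measurable]: "f \<in> borel_measurable borel" and s: "0 < s"
    and int: "(\<integral>\<^sup>+ x. ennreal (\<bar>f x\<bar> powr p) \<partial>lborel) < top" and p: "0 < p"
  shows "rearrangement f s < top"
proof -
  obtain b where b: "0 \<le> b" "(\<integral>\<^sup>+ x. ennreal (\<bar>f x\<bar> powr p) \<partial>lborel) = ennreal b"
    using int by (cases "\<integral>\<^sup>+ x. ennreal (\<bar>f x\<bar> powr p) \<partial>lborel") auto
  \<comment> \<open>Chosen with \<open>l powr p \<ge> b / s\<close>; the summand 1 keeps
    \<open>l\<close> positive when \<open>b = 0\<close>.\<close>
  define l where "l = (b / s + 1) powr (1 / p)"
  have lp: "l powr p = b / s + 1" using p b s by (simp add: l_def powr_powr)
  have l: "0 < l" using b s by (simp add: l_def add_nonneg_eq_0_iff)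
  have "ennreal (l powr p) * emeasure lborel {x. \<bar>f x\<bar> > l} = (\<integral>\<^sup>+ x. ennreal (l powr p) * indicator {x. \<bar>f x\<bar> > l} x \<partial>lborel)"
    by (simp add: nn_integral_cmult)
  also have "\<dots> \<le> (\<integral>\<^sup>+ x. ennreal (\<bar>f x\<bar> powr p) \<partial>lborel)"
    using l p by (intro nn_integral_mono) (auto simp: indicator_def intro!: powr_mono2)
  finally have *: "ennreal (b / s + 1) * emeasure lborel {x. \<bar>f x\<bar> > l} \<le> ennreal b"
    using b lp by simp
  have "emeasure lborel {x. \<bar>f x\<bar> > l} \<le> ennreal s"
  proof (cases "emeasure lborel {x. \<bar>f x\<bar> > l}")
    case (real c)
    with * b s have "ennreal ((b / s + 1) * c) \<le> ennreal b"
      by (simp add: ennreal_mult)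
    with b have "(b / s + 1) * c \<le> b" by simp
    then have "(b / s) * c \<le> (b / s) * s" "c \<le> b"
      using s real(1) b by (auto simp: distrib_right intro: order_trans[rotated])
    then have "c \<le> s"
      using b s by (cases "b = 0") (auto simp: field_simps)
    then show ?thesis using real by (simp add: ennreal_leI)
  next
    case top
    then show ?thesis using * b s by (auto simp: ennreal_mult_top top_unique add_nonneg_eq_0_iff)
  qed
  then have "emeasure lebesgue {x. \<bar>f x\<bar> > l} \<le> ennreal s"
    by (subst emeasure_lebesgue_borel) auto
  then have "rearrangement f s \<le> ennreal l"
    unfolding rearrangement_def using l by (intro INF_lower) auto
  then show ?thesis by (simp add: order_le_less_trans)
qed

text \<open>Every admissible level \<open>l\<close> in the infimum defining
  \<open>rearrangement f s\<close> gives \<open>maximal_rearrangement f s \<le> 2 * X + l\<close>.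
  The superlevel set varies with \<open>l\<close>, so \<open>X\<close> is asked to work for all sets
  of measure at most \<open>s\<close>.\<close>

lemma rearrangement_gap_le:
  fixes f :: "'a::euclidean_space \<Rightarrow> real"
  assumes [measurable]: "f \<in> borel_measurable borel" "Q \<in> sets borel" and s: "0 < s"
    and int: "(\<integral>\<^sup>+ x. ennreal (\<bar>f x\<bar> powr p) \<partial>lborel) < top" and p: "0 < p"
    and Q: "emeasure lborel Q = ennreal (2 * s)"
    and X: "\<And>h E. h \<in> Q \<Longrightarrow> E \<in> sets borel \<Longrightarrow> emeasure lborel E \<le> ennreal s \<Longrightarrow>
        (\<integral>\<^sup>+ x \<in> E. ennreal \<bar>f (x + h) - f x\<bar> \<partial>lborel) \<le> ennreal s * X"
  shows "maximal_rearrangement f s - rearrangement f s \<le> ennreal 2 * X"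
proof -
  have fin: "rearrangement f s < top"
    by (rule rearrangement_finite[OF assms(1) s int p])
  have "maximal_rearrangement f s \<le> ennreal 2 * X + ennreal l"
    if l: "0 \<le> l" "emeasure lebesgue {x. \<bar>f x\<bar> > l} \<le> ennreal s" for l
  proof -
    have E: "emeasure lborel {x. \<bar>f x\<bar> > l} \<le> ennreal s"
      using l by (subst (asm) emeasure_lebesgue_borel) auto
    have "excess (\<lambda>x. ennreal \<bar>f x\<bar>) l \<le> ennreal 2 * (ennreal s * X)"
      using E by (intro excess_le_differences[OF assms(1,2) s E Q l(1)] X) auto
    then have "ennreal (1 / s) * excess (\<lambda>x. ennreal \<bar>f x\<bar>) l \<le> ennreal (1 / s) * (ennreal 2 * (ennreal s * X))"
      by (rule mult_left_mono) simp
    also have "\<dots> = (ennreal (1 / s) * ennreal s) * (ennreal 2 * X)"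
      by (simp only: mult_ac)
    also have "ennreal (1 / s) * ennreal s = 1"
      using s by (simp flip: ennreal_mult)
    finally show ?thesis
      using maximal_rearrangement_le_excess[OF assms(1) s l(1)]
      by (simp add: add.commute) (meson add_left_mono order_trans)
  qed
  then have "maximal_rearrangement f s - ennreal 2 * X \<le> rearrangement f s" if "ennreal 2 * X \<noteq> top"
    unfolding rearrangement_def using that by (intro INF_greatest) (auto simp: ennreal_minus_le_iff)
  then show ?thesis
    using fin by (cases "ennreal 2 * X = top") (auto simp: ennreal_minus_le_iff add.commute)
qed

section \<open>Averages against a Lipschitz kernel\<close>

definition tent_mass :: "'a::euclidean_space itself \<Rightarrow> real" where
  "tent_mass _ = (\<integral>\<theta>. max 0 (1 - norm (\<theta>::'a)) \<partial>lborel)"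

text \<open>A pointwise Lipschitz kernel has an increment that is small on a full ball. For the
  indicator of a ball the increment would be of full size on a thin shell, and the maximal average
  at measure \<open>c ^ n\<close> would give no gain there. The support in the unit ball keeps the
  steps \<open>r *\<^sub>R \<theta>\<close> within length \<open>r\<close>.\<close>

definition tent :: "'a::euclidean_space \<Rightarrow> real" where
  "tent \<theta> = max 0 (1 - norm \<theta>) / tent_mass TYPE('a)"

definition tent_measure :: "'a::euclidean_space measure" where
  "tent_measure = density lborel (\<lambda>\<theta>. ennreal (tent \<theta>))"

lemma integrable_tent_profile: "integrable lborel (\<lambda>\<theta>::'a::euclidean_space. max 0 (1 - norm \<theta>))"
proof (rule Bochner_Integration.integrable_bound)
  show "integrable lborel (\<lambda>\<theta>::'a. indicator (cball 0 1) \<theta> :: real)"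
    using emeasure_lborel_cball_finite[of 0 1] by (intro integrable_real_indicator) auto
qed (auto simp: indicator_def)

lemma tent_mass_pos: "0 < tent_mass TYPE('a::euclidean_space)"
proof -
  have "(\<integral>\<theta>. (1/2) * indicator (cball (0::'a) (1/2)) \<theta> \<partial>lborel) \<le> tent_mass TYPE('a)"
    unfolding tent_mass_def
  proof (intro integral_mono)
    show "integrable lborel (\<lambda>\<theta>::'a. (1/2) * indicator (cball 0 (1/2)) \<theta> :: real)"
      using emeasure_lborel_cball_finite[of 0 "1/2"]
      by (intro integrable_mult_right integrable_real_indicator) auto
  qed (auto simp: integrable_tent_profile indicator_def)
  then have "measure lborel (cball (0::'a) (1/2)) \<le> 2 * tent_mass TYPE('a)"
    by simp
  moreover have "0 < measure lborel (cball (0::'a) (1/2))"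
    by (simp add: content_cball_pos)
  ultimately show ?thesis by linarith
qed

lemma tent_nonneg: "0 \<le> tent \<theta>"
  using tent_mass_pos[where 'a = 'a] by (simp add: tent_def)

lemma measurable_tent [measurable]: "tent \<in> borel_measurable borel"
  unfolding tent_def[abs_def] by measurable

lemma tent_eq_0: "1 \<le> norm \<theta> \<Longrightarrow> tent \<theta> = 0"
  by (simp add: tent_def)

lemma tent_le: "tent (\<theta>::'a::euclidean_space) \<le> 1 / tent_mass TYPE('a)"
  using tent_mass_pos[where 'a = 'a] by (simp add: tent_def divide_right_mono)

lemma tent_Lipschitz: "\<bar>tent (\<theta>::'a::euclidean_space) - tent \<theta>'\<bar> \<le> norm (\<theta> - \<theta>') / tent_mass TYPE('a)"
proof -
  have "\<bar>max 0 (1 - norm \<theta>) - max 0 (1 - norm \<theta>')\<bar> \<le> norm (\<theta> - \<theta>')"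
    using norm_triangle_ineq3[of \<theta> \<theta>'] by (auto simp: max_def)
  then show ?thesis using tent_mass_pos[where 'a = 'a]
    by (simp add: tent_def divide_right_mono flip: diff_divide_distrib)
qed

lemma sets_tent_measure [measurable_cong, simp]: "sets (tent_measure :: 'a::euclidean_space measure) = sets borel"
  by (simp add: tent_measure_def)

lemma space_tent_measure [simp]: "space tent_measure = UNIV"
  by (simp add: tent_measure_def)

lemma emeasure_tent_measure: "emeasure (tent_measure :: 'a::euclidean_space measure) UNIV = 1"
proof -
  have int: "integrable lborel (tent :: 'a \<Rightarrow> real)"
    unfolding tent_def[abs_def] by (intro integrable_divide_zero integrable_tent_profile)
  have "emeasure (tent_measure :: 'a measure) UNIV = (\<integral>\<^sup>+ \<theta>. ennreal (tent (\<theta>::'a)) \<partial>lborel)"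
    by (simp add: tent_measure_def emeasure_density)
  also have "\<dots> = ennreal (\<integral>\<theta>. tent (\<theta>::'a) \<partial>lborel)"
    by (intro nn_integral_eq_integral int) (simp add: tent_nonneg)
  also have "(\<integral>\<theta>. tent (\<theta>::'a) \<partial>lborel) = 1"
    using tent_mass_pos[where 'a = 'a] by (simp add: tent_def tent_mass_def)
  finally show ?thesis by simp
qed

lemma finite_measure_tent: "finite_measure (tent_measure :: 'a::euclidean_space measure)"
  by (rule finite_measureI) (simp add: emeasure_tent_measure)

lemma sigma_finite_tent: "sigma_finite_measure (tent_measure :: 'a::euclidean_space measure)"
  using finite_measure_tent by (rule finite_measure.axioms(1))

lemma pair_sigma_finite_tent:
  "pair_sigma_finite (tent_measure :: 'a::euclidean_space measure) (tent_measure :: 'a measure)"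
  "pair_sigma_finite (tent_measure :: 'a measure) (lborel :: 'b::euclidean_space measure)"
  "pair_sigma_finite (lborel :: 'b measure) (tent_measure :: 'a measure)"
  by (simp_all add: pair_sigma_finite_def sigma_finite_tent sigma_finite_lborel)

lemma AE_tent_measure: "AE \<theta> in tent_measure. norm (\<theta>::'a::euclidean_space) \<le> 1"
proof -
  have "norm \<theta> \<le> 1" if "0 < tent \<theta>" for \<theta> :: 'a
    using that tent_eq_0[of \<theta>] by (cases "1 \<le> norm \<theta>") auto
  then show ?thesis
    unfolding tent_measure_def by (subst AE_density) auto
qed

text \<open>The maximum with 1 supplies the hypothesis \<open>1 \<le> L\<close> of
  \<open>scaled_nn_integral_le_maxavg\<close>.\<close>

definition ball_const :: "'a::euclidean_space itself \<Rightarrow> real \<Rightarrow> real" where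
  "ball_const _ L = max 1 (measure lborel (cball (0::'a) L))"

lemma ball_const: "1 \<le> ball_const TYPE('a::euclidean_space) L"
  "emeasure lborel (cball (0::'a) L) \<le> ennreal (ball_const TYPE('a) L)"
proof -
  have "emeasure lborel (cball (0::'a) L) = ennreal (measure lborel (cball (0::'a) L))"
    using emeasure_lborel_cball_finite[of "0::'a" L] by (intro emeasure_eq_ennreal_measure) auto
  then show "emeasure lborel (cball (0::'a) L) \<le> ennreal (ball_const TYPE('a) L)"
    by (simp add: ball_const_def ennreal_leI)
qed (simp add: ball_const_def)

text \<open>The inverse mass bounds both the values and the Lipschitz constant of
  \<open>tent\<close>; the ball of radius \<open>1 + K\<close> contains its support and every
  translate of it by a vector of length at most \<open>K\<close>.\<close>

definition tent_const :: "'a::euclidean_space itself \<Rightarrow> real \<Rightarrow> real" where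
  "tent_const _ K = 1 / tent_mass TYPE('a) * ball_const TYPE('a) (1 + K)"

lemma tent_const_pos: "0 < tent_const TYPE('a::euclidean_space) K"
  using tent_mass_pos[where 'a = 'a] ball_const(1)[of "1 + K", where 'a = 'a] by (simp add: tent_const_def)

lemma tent_average_le:
  fixes g :: "'a::euclidean_space \<Rightarrow> ennreal"
  assumes [measurable]: "g \<in> borel_measurable borel" and c: "0 < c"
  shows "(\<integral>\<^sup>+ \<theta>. g (x + c *\<^sub>R \<theta>) \<partial>tent_measure)
     \<le> ennreal (tent_const TYPE('a) 0) * maxavg g (c ^ DIM('a))"
proof -
  let ?Z = "tent_mass TYPE('a)" and ?L = "ball_const TYPE('a) 1"
  have Z: "0 < ?Z" by (rule tent_mass_pos)
  have [measurable]: "cball (0::'a) L \<in> sets borel" for L by simp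
  have "(\<integral>\<^sup>+ \<theta>. g (x + c *\<^sub>R \<theta>) \<partial>tent_measure) = (\<integral>\<^sup>+ \<theta>. ennreal (tent \<theta>) * g (x + c *\<^sub>R \<theta>) \<partial>lborel)"
    unfolding tent_measure_def by (subst nn_integral_density) auto
  also have "\<dots> \<le> (\<integral>\<^sup>+ \<theta>. ennreal (1 / ?Z) * (g (x + c *\<^sub>R \<theta>) * indicator (cball 0 1) \<theta>) \<partial>lborel)"
  proof (intro nn_integral_mono)
    fix \<theta> :: 'a
    show "ennreal (tent \<theta>) * g (x + c *\<^sub>R \<theta>) \<le> ennreal (1 / ?Z) * (g (x + c *\<^sub>R \<theta>) * indicator (cball 0 1) \<theta>)"
      using tent_le[of \<theta>] tent_eq_0[of \<theta>]
      by (cases "norm \<theta> \<le> 1") (auto simp: intro!: mult_right_mono ennreal_leI)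
  qed
  also have "\<dots> = ennreal (1 / ?Z) * (\<integral>\<^sup>+ \<theta> \<in> cball 0 1. g (x + c *\<^sub>R \<theta>) \<partial>lborel)"
    by (rule nn_integral_cmult) measurable
  also have "\<dots> \<le> ennreal (1 / ?Z) * (ennreal ?L * maxavg g (c ^ DIM('a)))"
    by (intro mult_left_mono scaled_nn_integral_le_maxavg ball_const c) auto
  also have "\<dots> = ennreal (tent_const TYPE('a) 0) * maxavg g (c ^ DIM('a))"
    using Z ball_const(1)[of 1, where 'a = 'a]
    unfolding tent_const_def by (subst ennreal_mult) (auto simp: mult.assoc)
  finally show ?thesis .
qed

text \<open>Substitution moves the translation by \<open>h\<close> from \<open>g\<close> to the
  kernel, where it becomes a translation by \<open>h /\<^sub>R c\<close>; the Lipschitz bound then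
  yields the factor \<open>norm h / c\<close>.\<close>

lemma tent_difference_le:
  fixes g :: "'a::euclidean_space \<Rightarrow> real"
  assumes [measurable]: "g \<in> borel_measurable borel" and c: "0 < c" and h: "norm h \<le> K * c"
    and int: "\<And>x. integrable tent_measure (\<lambda>\<theta>. g (x + c *\<^sub>R \<theta>))"
  shows "ennreal \<bar>(\<integral>\<theta>. g (x + h + c *\<^sub>R \<theta>) - g (x + c *\<^sub>R \<theta>) \<partial>tent_measure)\<bar>
    \<le> ennreal (tent_const TYPE('a) K * (norm h / c)) * maxavg (\<lambda>x. ennreal \<bar>g x\<bar>) (c ^ DIM('a))"
proof -
  let ?Z = "tent_mass TYPE('a)" and ?L = "ball_const TYPE('a) (1 + K)"
  let ?h = "h /\<^sub>R c"
  have Z: "0 < ?Z" by (rule tent_mass_pos)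
  have [measurable]: "cball (0::'a) L \<in> sets borel" for L by simp
  have h': "norm ?h = norm h / c" "norm ?h \<le> K"
    using c h by (simp_all add: field_simps)
  have i1: "integrable lborel (\<lambda>\<theta>. tent \<theta> * g (y + c *\<^sub>R \<theta>))" for y
    using int[of y] unfolding tent_measure_def
    by (subst (asm) integrable_real_density) (auto simp: tent_nonneg)
  have sh: "x + h + c *\<^sub>R (\<theta> - ?h) = x + c *\<^sub>R \<theta>" for \<theta>
    using c by (simp add: algebra_simps)
  have tr: "integrable lborel (\<lambda>\<theta>. tent (\<theta> - ?h) * g (x + c *\<^sub>R \<theta>))"
    "(\<integral>\<theta>. tent \<theta> * g (x + h + c *\<^sub>R \<theta>) \<partial>lborel) = (\<integral>\<theta>. tent (\<theta> - ?h) * g (x + c *\<^sub>R \<theta>) \<partial>lborel)"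
  proof -
    let ?F = "\<lambda>\<theta>. tent \<theta> * g (x + h + c *\<^sub>R \<theta>)"
    have "integrable (distr lborel borel ((+) (- ?h))) ?F"
      using i1[of "x + h"] by (simp add: lborel_distr_plus)
    then have "integrable lborel (\<lambda>\<theta>. ?F (- ?h + \<theta>))"
      by (subst (asm) integrable_distr_eq) auto
    then show "integrable lborel (\<lambda>\<theta>. tent (\<theta> - ?h) * g (x + c *\<^sub>R \<theta>))"
      using sh by simp
    have "(\<integral>\<theta>. ?F \<theta> \<partial>lborel) = (\<integral>\<theta>. ?F \<theta> \<partial>distr lborel borel ((+) (- ?h)))"
      by (simp add: lborel_distr_plus)
    also have "\<dots> = (\<integral>\<theta>. ?F (- ?h + \<theta>) \<partial>lborel)"
      by (rule integral_distr) auto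
    finally show "(\<integral>\<theta>. ?F \<theta> \<partial>lborel) = (\<integral>\<theta>. tent (\<theta> - ?h) * g (x + c *\<^sub>R \<theta>) \<partial>lborel)"
      using sh by simp
  qed
  have "(\<integral>\<theta>. g (x + h + c *\<^sub>R \<theta>) - g (x + c *\<^sub>R \<theta>) \<partial>tent_measure)
    = (\<integral>\<theta>. g (x + h + c *\<^sub>R \<theta>) \<partial>tent_measure) - (\<integral>\<theta>. g (x + c *\<^sub>R \<theta>) \<partial>tent_measure)"
    by (intro Bochner_Integration.integral_diff int)
  also have "\<dots> = (\<integral>\<theta>. tent \<theta> * g (x + h + c *\<^sub>R \<theta>) \<partial>lborel) - (\<integral>\<theta>. tent \<theta> * g (x + c *\<^sub>R \<theta>) \<partial>lborel)"
    unfolding tent_measure_def by (subst (1 2) integral_real_density) (auto simp: tent_nonneg)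
  also have "\<dots> = (\<integral>\<theta>. (tent (\<theta> - ?h) - tent \<theta>) * g (x + c *\<^sub>R \<theta>) \<partial>lborel)"
    using tr i1 by (simp add: left_diff_distrib)
  finally have eq: "(\<integral>\<theta>. g (x + h + c *\<^sub>R \<theta>) - g (x + c *\<^sub>R \<theta>) \<partial>tent_measure)
    = (\<integral>\<theta>. (tent (\<theta> - ?h) - tent \<theta>) * g (x + c *\<^sub>R \<theta>) \<partial>lborel)" .
  have i2: "integrable lborel (\<lambda>\<theta>. (tent (\<theta> - ?h) - tent \<theta>) * g (x + c *\<^sub>R \<theta>))"
    using tr(1) i1[of x] by (simp add: left_diff_distrib)
  have "ennreal \<bar>(\<integral>\<theta>. g (x + h + c *\<^sub>R \<theta>) - g (x + c *\<^sub>R \<theta>) \<partial>tent_measure)\<bar>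
    \<le> (\<integral>\<^sup>+ \<theta>. ennreal \<bar>(tent (\<theta> - ?h) - tent \<theta>) * g (x + c *\<^sub>R \<theta>)\<bar> \<partial>lborel)"
    unfolding eq using integral_norm_bound_ennreal[OF i2] by simp
  also have "\<dots> \<le> (\<integral>\<^sup>+ \<theta>. ennreal (norm h / c / ?Z) * (ennreal \<bar>g (x + c *\<^sub>R \<theta>)\<bar> * indicator (cball 0 (1 + K)) \<theta>) \<partial>lborel)"
  proof (intro nn_integral_mono)
    fix \<theta> :: 'a
    show "ennreal \<bar>(tent (\<theta> - ?h) - tent \<theta>) * g (x + c *\<^sub>R \<theta>)\<bar>
      \<le> ennreal (norm h / c / ?Z) * (ennreal \<bar>g (x + c *\<^sub>R \<theta>)\<bar> * indicator (cball 0 (1 + K)) \<theta>)"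
    proof (cases "norm \<theta> \<le> 1 + K")
      case True
      have "\<bar>tent (\<theta> - ?h) - tent \<theta>\<bar> \<le> norm h / c / ?Z"
        using tent_Lipschitz[of "\<theta> - ?h" \<theta>] h' by simp
      then have "\<bar>(tent (\<theta> - ?h) - tent \<theta>) * g (x + c *\<^sub>R \<theta>)\<bar> \<le> norm h / c / ?Z * \<bar>g (x + c *\<^sub>R \<theta>)\<bar>"
        unfolding abs_mult by (rule mult_right_mono) simp
      then show ?thesis using True c Z by (simp add: ennreal_leI flip: ennreal_mult)
    next
      case False
      have K: "0 \<le> K" using h'(2) norm_ge_zero[of ?h] by linarith
      have "1 \<le> norm (\<theta> - ?h)"
        using False h'(2) norm_triangle_ineq2[of \<theta> ?h] by linarith
      then show ?thesis using False K by (simp add: tent_eq_0)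
    qed
  qed
  also have "\<dots> = ennreal (norm h / c / ?Z) * (\<integral>\<^sup>+ \<theta> \<in> cball 0 (1 + K). ennreal \<bar>g (x + c *\<^sub>R \<theta>)\<bar> \<partial>lborel)"
    by (rule nn_integral_cmult) measurable
  also have "\<dots> \<le> ennreal (norm h / c / ?Z) * (ennreal ?L * maxavg (\<lambda>x. ennreal \<bar>g x\<bar>) (c ^ DIM('a)))"
    by (intro mult_left_mono scaled_nn_integral_le_maxavg ball_const c) auto
  also have "\<dots> = ennreal (tent_const TYPE('a) K * (norm h / c)) * maxavg (\<lambda>x. ennreal \<bar>g x\<bar>) (c ^ DIM('a))"
    unfolding tent_const_def using Z c ball_const(1)[of "1 + K", where 'a = 'a] by (simp flip: mult.assoc ennreal_mult) (simp add: mult_ac)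
  finally show ?thesis .
qed

section \<open>Differences of higher order\<close>

text \<open>The binomial theorem for \<open>a + b T\<close>, with \<open>T\<close> the translation
  by \<open>v\<close>. It is applied both to the difference \<open>T - 1\<close> and to the doubling
  factor \<open>T + 1\<close>.\<close>

lemma shift_operator_funpow:
  fixes g :: "'a::real_vector \<Rightarrow> real" and a b :: real
  shows "((\<lambda>g x. a * g x + b * g (x + v)) ^^ k) g x
    = (\<Sum>l\<le>k. real (k choose l) * a ^ (k - l) * b ^ l * g (x + real l *\<^sub>R v))"
proof (induction k arbitrary: x)
  case (Suc k)
  let ?A = "\<lambda>l. real (k choose l) * a ^ (k - l) * b ^ Suc l * g (x + real (Suc l) *\<^sub>R v)"
  let ?B = "\<lambda>l. real (k choose Suc l) * a ^ (k - l) * b ^ Suc l * g (x + real (Suc l) *\<^sub>R v)"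
  have "(\<Sum>l\<le>Suc k. real (Suc k choose l) * a ^ (Suc k - l) * b ^ l * g (x + real l *\<^sub>R v))
    = a ^ Suc k * g x + (\<Sum>l\<le>k. ?A l + ?B l)"
    by (subst sum.atMost_Suc_shift) (auto simp: algebra_simps intro!: sum.cong)
  also have "\<dots> = (\<Sum>l\<le>k. ?A l) + (a ^ Suc k * g x + (\<Sum>l\<le>k. ?B l))"
    by (simp add: sum.distrib)
  also have "a ^ Suc k * g x + (\<Sum>l\<le>k. ?B l) = (\<Sum>l\<le>Suc k. real (k choose l) * a ^ (Suc k - l) * b ^ l * g (x + real l *\<^sub>R v))"
    by (subst sum.atMost_Suc_shift) simp
  also have "\<dots> = (\<Sum>l\<le>k. real (k choose l) * a ^ (Suc k - l) * b ^ l * g (x + real l *\<^sub>R v))"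
    by simp
  also have "\<dots> = a * (\<Sum>l\<le>k. real (k choose l) * a ^ (k - l) * b ^ l * g (x + real l *\<^sub>R v))"
    by (auto simp: sum_distrib_left Suc_diff_le intro!: sum.cong)
  also have "(\<Sum>l\<le>k. ?A l) = b * (\<Sum>l\<le>k. real (k choose l) * a ^ (k - l) * b ^ l * g (x + v + real l *\<^sub>R v))"
    by (auto simp: sum_distrib_left algebra_simps intro!: sum.cong)
  finally show ?case by (simp add: Suc.IH)
qed simp

text \<open>The sign is normalised so that \<open>f x\<close> has coefficient 1; \<open>f x\<close>
  can then be written as a k-th difference plus a combination of proper shifts.\<close>

definition kdiff :: "nat \<Rightarrow> ('a::real_vector \<Rightarrow> real) \<Rightarrow> 'a \<Rightarrow> 'a \<Rightarrow> real" where
  "kdiff k f v x = (\<Sum>l\<le>k. real (k choose l) * (- 1) ^ l * f (x + real l *\<^sub>R v))"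

lemma kdiff_eq_difference: "(difference v ^^ k) f x = (- 1) ^ k * kdiff k f v x"
proof -
  have "difference v = (\<lambda>g x. (- 1) * g x + 1 * g (x + v))"
    by (auto simp: difference_def fun_eq_iff)
  then have "(difference v ^^ k) f x = (\<Sum>l\<le>k. real (k choose l) * (- 1) ^ (k - l) * 1 ^ l * f (x + real l *\<^sub>R v))"
    by (simp only: shift_operator_funpow)
  also have "\<dots> = (- 1) ^ k * kdiff k f v x"
    by (auto simp: kdiff_def sum_distrib_left uminus_power_if intro!: sum.cong)
  finally show ?thesis .
qed

lemma abs_kdiff: "\<bar>kdiff k f v x\<bar> = \<bar>(difference v ^^ k) f x\<bar>"
  by (simp add: kdiff_eq_difference abs_mult power_abs)

text \<open>With \<open>T\<close> the translation by \<open>v\<close>,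
  \<open>T\<^sup>2 - 1 = (T + 1) (T - 1)\<close>, and the two factors commute.\<close>

lemma difference_double:
  "(difference (2 *\<^sub>R v) ^^ k) f = ((\<lambda>g x. 1 * g x + 1 * g (x + v)) ^^ k) ((difference v ^^ k) f)"
proof (induction k)
  case (Suc k)
  let ?S = "\<lambda>g x. 1 * g x + 1 * g (x + v)"
  have step: "difference (2 *\<^sub>R v) g = ?S (difference v g)" for g
    by (auto simp: difference_def fun_eq_iff scaleR_2 add.assoc)
  have comm: "difference v ((?S ^^ j) g) = (?S ^^ j) (difference v g)" for j g
  proof (induction j)
    case (Suc j)
    have "difference v (?S h) = ?S (difference v h)" for h
      by (auto simp: difference_def fun_eq_iff)
    with Suc show ?case by simp
  qed simp
  have "(difference (2 *\<^sub>R v) ^^ Suc k) f = ?S (difference v ((?S ^^ k) ((difference v ^^ k) f)))"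
    unfolding funpow.simps o_apply Suc by (rule step)
  also have "\<dots> = (?S ^^ Suc k) ((difference v ^^ Suc k) f)"
    by (simp only: funpow.simps o_apply comm)
  finally show ?case .
qed simp

lemma abs_kdiff_double_le:
  fixes f :: "'a::euclidean_space \<Rightarrow> real"
  shows "\<bar>kdiff k f (2 *\<^sub>R v) x\<bar> \<le> (\<Sum>l\<le>k. real (k choose l) * \<bar>kdiff k f v (x + real l *\<^sub>R v)\<bar>)"
proof -
  have "\<bar>kdiff k f (2 *\<^sub>R v) x\<bar> = \<bar>\<Sum>l\<le>k. real (k choose l) * (difference v ^^ k) f (x + real l *\<^sub>R v)\<bar>"
    by (simp only: abs_kdiff difference_double shift_operator_funpow) simp
  also have "\<dots> \<le> (\<Sum>l\<le>k. \<bar>real (k choose l) * (difference v ^^ k) f (x + real l *\<^sub>R v)\<bar>)"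
    by (rule sum_abs)
  finally show ?thesis by (simp add: abs_mult abs_kdiff)
qed

lemma measurable_kdiff [measurable]:
  fixes f :: "'a::euclidean_space \<Rightarrow> real"
  assumes [measurable]: "f \<in> borel_measurable borel" "v \<in> borel_measurable M" "x \<in> borel_measurable M"
  shows "(\<lambda>z. kdiff k f (v z) (x z)) \<in> borel_measurable M"
  unfolding kdiff_def by measurable

text \<open>Each doubling of the step bounds a k-th difference by \<open>2 ^ k\<close> translates of
  the previous one, counted with binomial multiplicity. Long steps are thereby reduced to short
  ones.\<close>

lemma maxavg_kdiff_power2:
  fixes f :: "'a::euclidean_space \<Rightarrow> real"
  assumes [measurable]: "f \<in> borel_measurable borel"
  shows "maxavg (\<lambda>x. ennreal \<bar>kdiff k f (2 ^ l *\<^sub>R v) x\<bar>) s \<le> ennreal (2 ^ (k * l)) * maxavg (\<lambda>x. ennreal \<bar>kdiff k f v x\<bar>) s"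
proof (induction l)
  case (Suc l)
  let ?w = "2 ^ l *\<^sub>R v"
  have "maxavg (\<lambda>x. ennreal \<bar>kdiff k f (2 *\<^sub>R ?w) x\<bar>) s \<le> ennreal (real (2 ^ k)) * maxavg (\<lambda>x. ennreal \<bar>kdiff k f ?w x\<bar>) s"
  proof (rule maxavg_le_translates[where A = "{..k}" and b = "\<lambda>i. k choose i" and v = "\<lambda>i. real i *\<^sub>R ?w"])
    fix x
    have "ennreal \<bar>kdiff k f (2 *\<^sub>R ?w) x\<bar> \<le> ennreal (\<Sum>i\<le>k. real (k choose i) * \<bar>kdiff k f ?w (x + real i *\<^sub>R ?w)\<bar>)"
      by (intro ennreal_leI abs_kdiff_double_le)
    also have "\<dots> = (\<Sum>i\<le>k. of_nat (k choose i) * ennreal \<bar>kdiff k f ?w (x + real i *\<^sub>R ?w)\<bar>)"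
      by (simp add: ennreal_mult ennreal_of_nat_eq_real_of_nat flip: sum_ennreal)
    finally show "ennreal \<bar>kdiff k f (2 *\<^sub>R ?w) x\<bar> \<le> \<dots>" .
  qed (auto simp: choose_row_sum)
  also have "\<dots> \<le> ennreal (real (2 ^ k)) * (ennreal (2 ^ (k * l)) * maxavg (\<lambda>x. ennreal \<bar>kdiff k f v x\<bar>) s)"
    by (intro mult_left_mono Suc) simp
  also have "\<dots> = ennreal (2 ^ (k * Suc l)) * maxavg (\<lambda>x. ennreal \<bar>kdiff k f v x\<bar>) s"
    by (simp add: power_add flip: mult.assoc ennreal_mult)
  finally show ?case by simp
qed simp

section \<open>Smoothing at dyadic scales\<close>

lemma ennreal_four_times: "x + x + x + x = ennreal 4 * x"
proof -
  have "ennreal 4 = 1 + 1 + 1 + 1" by simp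
  then show ?thesis by (simp only: distrib_right mult_1)
qed

locale Lp_function =
  fixes f :: "'a::euclidean_space \<Rightarrow> real" and k :: nat and p r :: real
  assumes meas [measurable]: "f \<in> borel_measurable borel"
    and Lp: "(\<integral>\<^sup>+ x. ennreal (\<bar>f x\<bar> powr p) \<partial>lborel) < top"
    and p: "1 < p" and r: "0 < r"
begin

abbreviation d :: "'a \<Rightarrow> 'a \<Rightarrow> real" where "d \<equiv> kdiff k f"

abbreviation \<nu> :: "'a measure" where "\<nu> \<equiv> tent_measure"

abbreviation \<nu>2 :: "('a \<times> 'a) measure" where "\<nu>2 \<equiv> tent_measure \<Otimes>\<^sub>M tent_measure"

definition c :: "nat \<Rightarrow> real" where "c i = - (real (k choose i) * (- 1) ^ i)"

lemma sum_abs_c: "(\<Sum>i=1..k. \<bar>c i\<bar>) \<le> 2 ^ k"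
proof -
  have "(\<Sum>i=1..k. \<bar>c i\<bar>) = (\<Sum>i=1..k. real (k choose i))"
    by (simp add: c_def abs_mult power_abs)
  also have "\<dots> \<le> (\<Sum>i\<le>k. real (k choose i))"
    by (rule sum_mono2) auto
  also have "\<dots> = real (2 ^ k)"
    by (simp only: flip: of_nat_sum choose_row_sum)
  finally show ?thesis by simp
qed

lemma reconstruct: "f x = d v x + (\<Sum>i=1..k. c i * f (x + real i *\<^sub>R v))"
  unfolding kdiff_def c_def atMost_atLeast0
  by (subst sum.atLeast_Suc_atMost) (auto simp: sum_negf)

text \<open>With \<open>a\<^sub>v = 1 - d v\<close>, a combination of the shifts by \<open>v, \<dots>, k v\<close>, the operators below are
  \<open>P v w = a\<^sub>v (1 - a\<^sub>w)\<close> and \<open>aa v w = a\<^sub>v a\<^sub>w\<close>.\<close>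
definition P :: "'a \<Rightarrow> 'a \<Rightarrow> 'a \<Rightarrow> real" where
  "P v w x = (\<Sum>i=1..k. c i * d w (x + real i *\<^sub>R v))"

definition aa :: "'a \<Rightarrow> 'a \<Rightarrow> 'a \<Rightarrow> real" where
  "aa v w x = (\<Sum>i=1..k. \<Sum>j=1..k. c i * c j * f (x + real i *\<^sub>R v + real j *\<^sub>R w))"

lemma P_aa: "(\<Sum>i=1..k. c i * f (x + real i *\<^sub>R v)) = P v w x + aa v w x"
proof -
  have "c i * f (x + real i *\<^sub>R v) = c i * d w (x + real i *\<^sub>R v) + (\<Sum>j=1..k. c i * c j * f (x + real i *\<^sub>R v + real j *\<^sub>R w))" for i
    using reconstruct[of "x + real i *\<^sub>R v" w]
    by (simp add: distrib_left sum_distrib_left mult.assoc)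
  then show ?thesis by (simp add: P_def aa_def sum.distrib)
qed

lemma aa_commute: "aa v w x = aa w v x"
  unfolding aa_def by (subst sum.swap) (simp add: algebra_simps)

lemma f_eq: "f x = d v x + P v w x + aa v w x"
  using reconstruct[of x v] P_aa[of x v w] by simp

text \<open>The factors are exchanged one at a time, from \<open>a\<^sub>v a\<^sub>w\<close> to
  \<open>a\<^sub>v a\<^sub>w\<^sub>'\<close> and then, after commuting, to
  \<open>a\<^sub>w\<^sub>' a\<^sub>v\<^sub>'\<close>. Each exchange is a difference of two terms in
  which a shift operator acts on a k-th difference.\<close>

lemma aa_diff: "aa v w x - aa v' w' x = P v w' x - P v w x + P w' v' x - P w' v x"
  using P_aa[of x v w] P_aa[of x v w'] P_aa[of x w' v'] P_aa[of x w' v]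
    aa_commute[of v w'] aa_commute[of v' w'] by simp

section \<open>Integrability of averages against the tent measure\<close>

lemma Lp': "(\<integral>\<^sup>+ x. ennpowr (ennreal \<bar>f x\<bar>) p \<partial>lborel) < top"
  using Lp by (simp add: ennpowr_ennreal)

lemma tent_f_le:
  assumes "0 < a"
  shows "(\<integral>\<^sup>+ \<theta>. ennreal \<bar>f (x + a *\<^sub>R \<theta>)\<bar> \<partial>\<nu>) \<le> ennreal (tent_const TYPE('a) 0) * maxavg (\<lambda>x. ennreal \<bar>f x\<bar>) (a ^ DIM('a))"
  using assms by (intro tent_average_le[of "\<lambda>x. ennreal \<bar>f x\<bar>"]) auto

text \<open>The average over the first variable is already bounded uniformly in the centre; the
  second variable only moves the centre.\<close>

lemma tent2_f_le:
  assumes "0 < a"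
  shows "(\<integral>\<^sup>+ z. ennreal \<bar>f (x + a *\<^sub>R fst z + b *\<^sub>R snd z)\<bar> \<partial>\<nu>2) \<le> ennreal (tent_const TYPE('a) 0) * maxavg (\<lambda>x. ennreal \<bar>f x\<bar>) (a ^ DIM('a))"
proof -
  have "(\<integral>\<^sup>+ z. ennreal \<bar>f (x + a *\<^sub>R fst z + b *\<^sub>R snd z)\<bar> \<partial>\<nu>2)
     = (\<integral>\<^sup>+ \<theta>'. (\<integral>\<^sup>+ \<theta>. ennreal \<bar>f ((x + b *\<^sub>R \<theta>') + a *\<^sub>R \<theta>)\<bar> \<partial>\<nu>) \<partial>\<nu>)"
    by (subst pair_sigma_finite.nn_integral_snd[OF pair_sigma_finite_tent(1), symmetric])
       (auto simp: algebra_simps)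
  also have "\<dots> \<le> (\<integral>\<^sup>+ \<theta>'. ennreal (tent_const TYPE('a) 0) * maxavg (\<lambda>x. ennreal \<bar>f x\<bar>) (a ^ DIM('a)) \<partial>\<nu>)"
    by (intro nn_integral_mono tent_f_le assms)
  also have "\<dots> = ennreal (tent_const TYPE('a) 0) * maxavg (\<lambda>x. ennreal \<bar>f x\<bar>) (a ^ DIM('a))"
    by (simp add: emeasure_tent_measure)
  finally show ?thesis .
qed

lemma maxavg_f_finite: "ennreal C * maxavg (\<lambda>x. ennreal \<bar>f x\<bar>) s < top"
  using maxavg_finite[OF _ Lp' p] by (simp add: ennreal_mult_less_top)

lemma integrable_f: 
  assumes "0 < a"
  shows "integrable \<nu> (\<lambda>\<theta>. f (x + a *\<^sub>R \<theta>))"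
proof (rule integrableI_bounded)
  show "(\<integral>\<^sup>+ \<theta>. ennreal (norm (f (x + a *\<^sub>R \<theta>))) \<partial>\<nu>) < \<infinity>"
    using tent_f_le[OF assms, of x] maxavg_f_finite by (auto intro: order_le_less_trans)
qed measurable

lemma integrable_f2: 
  assumes "0 < a"
  shows "integrable \<nu>2 (\<lambda>z. f (x + a *\<^sub>R fst z + b *\<^sub>R snd z))"
proof (rule integrableI_bounded)
  show "(\<integral>\<^sup>+ z. ennreal (norm (f (x + a *\<^sub>R fst z + b *\<^sub>R snd z))) \<partial>\<nu>2) < \<infinity>"
    using tent2_f_le[OF assms, of x b] maxavg_f_finite by (auto intro: order_le_less_trans)
qed measurable

lemma emeasure_\<nu>2: "emeasure \<nu>2 UNIV = 1"
proof -
  interpret sigma_finite_measure \<nu> by (rule sigma_finite_tent)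
  have "emeasure \<nu>2 (UNIV \<times> UNIV) = emeasure \<nu> UNIV * emeasure \<nu> UNIV"
    by (intro emeasure_pair_measure_Times) auto
  then show ?thesis by (simp add: emeasure_tent_measure)
qed

lemma space_\<nu>2 [simp]: "space \<nu>2 = UNIV"
  by (simp add: space_pair_measure)

lemma integrable_const2: "integrable \<nu>2 (\<lambda>z. y :: real)"
  by (intro finite_measure.integrable_const finite_measureI) (simp add: emeasure_\<nu>2)

lemma integral_const2: "(\<integral>z. y \<partial>\<nu>2) = (y :: real)"
  by (simp add: measure_def emeasure_\<nu>2)

lemma integrable_d2: 
  assumes "0 < a"
  shows "integrable \<nu>2 (\<lambda>z. d (b *\<^sub>R snd z) (x + a *\<^sub>R fst z))"
  unfolding kdiff_def using assms integrable_f2[OF assms]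
  by (intro Bochner_Integration.integrable_sum integrable_mult_right) simp

lemma integrable_d: 
  assumes "0 < a"
  shows "integrable \<nu> (\<lambda>\<theta>. d w (x + a *\<^sub>R \<theta>))"
proof -
  have "x + a *\<^sub>R \<theta> + real l *\<^sub>R w = (x + real l *\<^sub>R w) + a *\<^sub>R \<theta>" for \<theta> l
    by simp
  then show ?thesis
    unfolding kdiff_def using integrable_f[OF assms]
    by (intro Bochner_Integration.integrable_sum integrable_mult_right) (simp only:)
qed

lemma integrable_P: 
  assumes "0 < a"
  shows "integrable \<nu>2 (\<lambda>z. P (a *\<^sub>R fst z) (b *\<^sub>R snd z) x)"
proof -
  \<comment> \<open>The sums start at \<open>i = 1\<close>, so the smoothing scale
    \<open>real i * a\<close> is positive.\<close>
  have "integrable \<nu>2 (\<lambda>z. d (b *\<^sub>R snd z) (x + real i *\<^sub>R a *\<^sub>R fst z))" if "i \<in> {1..k}" for i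
    using integrable_d2[of "real i * a" b x] assms that by simp
  then show ?thesis
    unfolding P_def by (intro Bochner_Integration.integrable_sum integrable_mult_right)
qed

lemma integrable_aa: 
  assumes "0 < a"
  shows "integrable \<nu>2 (\<lambda>z. aa (a *\<^sub>R fst z) (b *\<^sub>R snd z) x)"
proof -
  have "integrable \<nu>2 (\<lambda>z. f (x + real i *\<^sub>R a *\<^sub>R fst z + real j *\<^sub>R b *\<^sub>R snd z))" if "i \<in> {1..k}" for i j
    using integrable_f2[of "real i * a" x "real j * b"] assms that by simp
  then show ?thesis
    unfolding aa_def by (intro Bochner_Integration.integrable_sum integrable_mult_right)
qed

lemma measurable_P [measurable]:
  assumes [measurable]: "v \<in> borel_measurable M" "w \<in> borel_measurable M" "x \<in> borel_measurable M"
  shows "(\<lambda>z. P (v z) (w z) (x z)) \<in> borel_measurable M"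
  unfolding P_def by measurable

text \<open>With \<open>A\<^sub>a\<close> the mean of \<open>1 - d (a *\<^sub>R \<theta>)\<close>
  over the tent measure, this is \<open>A\<^sub>a (1 - A\<^sub>b) f\<close>, while
  \<open>smooth a\<close> is \<open>A\<^sub>a\<^sup>2 f\<close>.\<close>

definition Q :: "real \<Rightarrow> real \<Rightarrow> 'a \<Rightarrow> real" where
  "Q a b x = (\<integral>z. P (a *\<^sub>R fst z) (b *\<^sub>R snd z) x \<partial>\<nu>2)"

definition smooth :: "real \<Rightarrow> 'a \<Rightarrow> real" where
  "smooth a x = (\<integral>z. aa (a *\<^sub>R fst z) (a *\<^sub>R snd z) x \<partial>\<nu>2)"

text \<open>Comes from \<open>1 - A\<^sub>a\<^sup>2 = (1 - A\<^sub>a) + A\<^sub>a (1 -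
  A\<^sub>a)\<close>, with the absolute values taken inside the averages so that Tonelli applies to
  it directly.\<close>

definition rest :: "real \<Rightarrow> 'a \<Rightarrow> ennreal" where
  "rest a x = (\<integral>\<^sup>+z. ennreal \<bar>d (a *\<^sub>R fst z) x\<bar> + (\<Sum>i=1..k. ennreal \<bar>c i\<bar> * ennreal \<bar>d (a *\<^sub>R snd z) (x + real i *\<^sub>R a *\<^sub>R fst z)\<bar>) \<partial>\<nu>2)"

lemma f_minus_smooth_le:
  assumes "0 < a"
  shows "ennreal \<bar>f x - smooth a x\<bar> \<le> rest a x"
proof -
  have "f x - smooth a x = (\<integral>z. f x \<partial>\<nu>2) - (\<integral>z. aa (a *\<^sub>R fst z) (a *\<^sub>R snd z) x \<partial>\<nu>2)"
    by (simp only: smooth_def integral_const2)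
  also have "\<dots> = (\<integral>z. f x - aa (a *\<^sub>R fst z) (a *\<^sub>R snd z) x \<partial>\<nu>2)"
    by (intro Bochner_Integration.integral_diff[symmetric] integrable_const2 integrable_aa assms)
  also have "\<dots> = (\<integral>z. d (a *\<^sub>R fst z) x + P (a *\<^sub>R fst z) (a *\<^sub>R snd z) x \<partial>\<nu>2)"
    using f_eq by (intro Bochner_Integration.integral_cong) (auto simp: algebra_simps)
  finally have eq: "f x - smooth a x = \<dots>" .
  have int: "integrable \<nu>2 (\<lambda>z. d (a *\<^sub>R fst z) x + P (a *\<^sub>R fst z) (a *\<^sub>R snd z) x)"
  proof -
    have "integrable \<nu>2 (\<lambda>z. f x - aa (a *\<^sub>R fst z) (a *\<^sub>R snd z) x)"
      by (intro Bochner_Integration.integrable_diff integrable_const2 integrable_aa assms)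
    moreover have "f x - aa v w x = d v x + P v w x" for v w
      using f_eq[of x v w] by simp
    ultimately show ?thesis by simp
  qed
  have "ennreal \<bar>f x - smooth a x\<bar> \<le> (\<integral>\<^sup>+z. ennreal \<bar>d (a *\<^sub>R fst z) x + P (a *\<^sub>R fst z) (a *\<^sub>R snd z) x\<bar> \<partial>\<nu>2)"
    unfolding eq using integral_norm_bound_ennreal[OF int] by simp
  also have "\<dots> \<le> rest a x"
    unfolding rest_def
  proof (intro nn_integral_mono)
    fix z :: "'a \<times> 'a"
    have "\<bar>d (a *\<^sub>R fst z) x + P (a *\<^sub>R fst z) (a *\<^sub>R snd z) x\<bar>
      \<le> \<bar>d (a *\<^sub>R fst z) x\<bar> + (\<Sum>i=1..k. \<bar>c i\<bar> * \<bar>d (a *\<^sub>R snd z) (x + real i *\<^sub>R a *\<^sub>R fst z)\<bar>)"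
      unfolding P_def abs_mult[symmetric] by (intro order_trans[OF abs_triangle_ineq] add_left_mono sum_abs)
    then have "ennreal \<bar>d (a *\<^sub>R fst z) x + P (a *\<^sub>R fst z) (a *\<^sub>R snd z) x\<bar>
      \<le> ennreal (\<bar>d (a *\<^sub>R fst z) x\<bar> + (\<Sum>i=1..k. \<bar>c i\<bar> * \<bar>d (a *\<^sub>R snd z) (x + real i *\<^sub>R a *\<^sub>R fst z)\<bar>))"
      by (rule ennreal_leI)
    then show "ennreal \<bar>d (a *\<^sub>R fst z) x + P (a *\<^sub>R fst z) (a *\<^sub>R snd z) x\<bar>
      \<le> ennreal \<bar>d (a *\<^sub>R fst z) x\<bar> + (\<Sum>i=1..k. ennreal \<bar>c i\<bar> * ennreal \<bar>d (a *\<^sub>R snd z) (x + real i *\<^sub>R a *\<^sub>R fst z)\<bar>)"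
      by (simp add: sum_nonneg ennreal_mult flip: sum_ennreal)
  qed
  finally show ?thesis .
qed

lemma smooth_diff:
  assumes "0 < a" "0 < b"
  shows "smooth a x - smooth b x = Q a b x - Q a a x + Q b b x - Q b a x"
proof -
  \<comment> \<open>\<open>aa_diff\<close> leaves its last two terms with the variables
    interchanged; the product of the tent measure with itself is symmetric.\<close>
  have sw: "(\<integral>z. P (u *\<^sub>R snd z) (v *\<^sub>R fst z) x \<partial>\<nu>2) = Q u v x" for u v
    using pair_sigma_finite.integral_product_swap[OF pair_sigma_finite_tent(1),
       of "\<lambda>z. P (u *\<^sub>R fst z) (v *\<^sub>R snd z) x"]
    by (simp add: Q_def case_prod_unfold)
  have isw: "integrable \<nu>2 (\<lambda>z. P (u *\<^sub>R snd z) (v *\<^sub>R fst z) x)" if "0 < u" for u v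
    using pair_sigma_finite.integrable_product_swap[OF pair_sigma_finite_tent(1) integrable_P[OF that, of v x]]
    by (simp add: case_prod_unfold)
  have "smooth a x - smooth b x = (\<integral>z. aa (a *\<^sub>R fst z) (a *\<^sub>R snd z) x - aa (b *\<^sub>R fst z) (b *\<^sub>R snd z) x \<partial>\<nu>2)"
    unfolding smooth_def
    by (intro Bochner_Integration.integral_diff[symmetric] integrable_aa assms)
  also have "\<dots> = (\<integral>z. P (a *\<^sub>R fst z) (b *\<^sub>R snd z) x - P (a *\<^sub>R fst z) (a *\<^sub>R snd z) x
      + P (b *\<^sub>R snd z) (b *\<^sub>R fst z) x - P (b *\<^sub>R snd z) (a *\<^sub>R fst z) x \<partial>\<nu>2)"
    by (intro Bochner_Integration.integral_cong refl aa_diff)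
  also have "\<dots> = Q a b x - Q a a x + Q b b x - Q b a x"
    using integrable_P[of a] isw[of b] assms
    by (simp add: sw) (simp add: Q_def)
  finally show ?thesis .
qed

text \<open>The inner integral runs over the smoothing variable with the step
  \<open>b *\<^sub>R \<theta>'\<close> frozen, so the Lipschitz estimate applies to the single
  function \<open>d (b *\<^sub>R \<theta>')\<close>.\<close>

lemma d_difference_average_le:
  assumes a: "0 < a" and h: "norm h \<le> K * a"
  shows "ennreal \<bar>\<integral>z. d (b *\<^sub>R snd z) (x + h + a *\<^sub>R fst z) - d (b *\<^sub>R snd z) (x + a *\<^sub>R fst z) \<partial>\<nu>2\<bar>
    \<le> ennreal (tent_const TYPE('a) K * (norm h / a)) * (\<integral>\<^sup>+\<theta>. maxavg (\<lambda>x. ennreal \<bar>d (b *\<^sub>R \<theta>) x\<bar>) (a ^ DIM('a)) \<partial>\<nu>)"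
proof -
  let ?F = "\<lambda>\<theta> \<theta>'. d (b *\<^sub>R \<theta>') (x + h + a *\<^sub>R \<theta>) - d (b *\<^sub>R \<theta>') (x + a *\<^sub>R \<theta>)"
  have int: "integrable \<nu>2 (\<lambda>(\<theta>, \<theta>'). ?F \<theta> \<theta>')"
    unfolding case_prod_unfold by (intro Bochner_Integration.integrable_diff integrable_d2 a)
  have "(\<integral>z. ?F (fst z) (snd z) \<partial>\<nu>2) = (\<integral>\<theta>'. (\<integral>\<theta>. ?F \<theta> \<theta>' \<partial>\<nu>) \<partial>\<nu>)"
    using pair_sigma_finite.integral_snd[OF pair_sigma_finite_tent(1) int] by (simp add: case_prod_unfold)
  moreover have "ennreal \<bar>\<integral>\<theta>'. (\<integral>\<theta>. ?F \<theta> \<theta>' \<partial>\<nu>) \<partial>\<nu>\<bar> \<le> (\<integral>\<^sup>+\<theta>'. ennreal \<bar>\<integral>\<theta>. ?F \<theta> \<theta>' \<partial>\<nu>\<bar> \<partial>\<nu>)"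
  \<comment> \<open>If the inner integral is not integrable in \<open>\<theta>'\<close>, the Bochner
    integral is 0 by convention and the bound is trivial.\<close>
  proof (cases "integrable \<nu> (\<lambda>\<theta>'. \<integral>\<theta>. ?F \<theta> \<theta>' \<partial>\<nu>)")
    case True
    then show ?thesis using integral_norm_bound_ennreal[OF True] by simp
  qed (simp add: not_integrable_integral_eq)
  moreover have "(\<integral>\<^sup>+\<theta>'. ennreal \<bar>\<integral>\<theta>. ?F \<theta> \<theta>' \<partial>\<nu>\<bar> \<partial>\<nu>)
    \<le> (\<integral>\<^sup>+\<theta>'. ennreal (tent_const TYPE('a) K * (norm h / a)) * maxavg (\<lambda>x. ennreal \<bar>d (b *\<^sub>R \<theta>') x\<bar>) (a ^ DIM('a)) \<partial>\<nu>)"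
    by (intro nn_integral_mono tent_difference_le a h integrable_d) measurable
  moreover have "\<dots> = ennreal (tent_const TYPE('a) K * (norm h / a)) * (\<integral>\<^sup>+\<theta>. maxavg (\<lambda>x. ennreal \<bar>d (b *\<^sub>R \<theta>) x\<bar>) (a ^ DIM('a)) \<partial>\<nu>)"
    by (rule nn_integral_cmult) measurable
  ultimately show ?thesis by simp
qed

text \<open>The \<open>i\<close>-th shift smooths at scale \<open>real i * a \<ge> a\<close>, where
  both \<open>norm h / (real i * a)\<close> and the maximal average are no larger than at scale
  \<open>a\<close>. The factor \<open>2 ^ k\<close> bounds the sum of the
  \<open>\<bar>c i\<bar>\<close>.\<close>

lemma Q_difference_le:
  assumes a: "0 < a" and h: "norm h \<le> K * a"
  shows "ennreal \<bar>Q a b (x + h) - Q a b x\<bar>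
    \<le> ennreal (2 ^ k * (tent_const TYPE('a) K * (norm h / a))) * (\<integral>\<^sup>+\<theta>. maxavg (\<lambda>x. ennreal \<bar>d (b *\<^sub>R \<theta>) x\<bar>) (a ^ DIM('a)) \<partial>\<nu>)"
proof -
  let ?I = "\<lambda>i. \<integral>z. d (b *\<^sub>R snd z) (x + h + (real i * a) *\<^sub>R fst z) - d (b *\<^sub>R snd z) (x + (real i * a) *\<^sub>R fst z) \<partial>\<nu>2"
  let ?M = "\<lambda>a. \<integral>\<^sup>+\<theta>. maxavg (\<lambda>x. ennreal \<bar>d (b *\<^sub>R \<theta>) x\<bar>) (a ^ DIM('a)) \<partial>\<nu>"
  let ?T = "tent_const TYPE('a) K"
  have K: "0 \<le> K" using order_trans[OF norm_ge_zero h] a by (simp add: zero_le_mult_iff)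
  have T: "0 < ?T" by (rule tent_const_pos)
  have I: "ennreal \<bar>?I i\<bar> \<le> ennreal (?T * (norm h / a)) * ?M a" if i: "i \<in> {1..k}" for i
  proof -
    have ia: "a \<le> real i * a" using i a by simp
    have "ennreal \<bar>?I i\<bar> \<le> ennreal (?T * (norm h / (real i * a))) * ?M (real i * a)"
      using ia a by (intro d_difference_average_le order_trans[OF h] mult_left_mono K) auto
    also have "\<dots> \<le> ennreal (?T * (norm h / a)) * ?M a"
      using ia a T by (intro mult_mono ennreal_leI mult_left_mono divide_left_mono nn_integral_mono maxavg_antimono power_mono)
        auto
    finally show ?thesis .
  qed
  have i1: "integrable \<nu>2 (\<lambda>z. c i * d (b *\<^sub>R snd z) (y + (real i * a) *\<^sub>R fst z))" if "i \<in> {1..k}" for i y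
    using that a by (intro integrable_mult_right integrable_d2) auto
  have Qe: "Q a b y = (\<Sum>i=1..k. \<integral>z. c i * d (b *\<^sub>R snd z) (y + (real i * a) *\<^sub>R fst z) \<partial>\<nu>2)" for y
    unfolding Q_def P_def scaleR_scaleR by (intro Bochner_Integration.integral_sum i1)
  have "Q a b (x + h) - Q a b x = (\<Sum>i=1..k. c i * ?I i)"
    unfolding Qe sum_subtractf[symmetric]
  proof (intro sum.cong refl)
    fix i assume i: "i \<in> {1..k}"
    have "integrable \<nu>2 (\<lambda>z. d (b *\<^sub>R snd z) (y + (real i * a) *\<^sub>R fst z))" for y
      using i a by (intro integrable_d2) auto
    then show "(\<integral>z. c i * d (b *\<^sub>R snd z) (x + h + (real i * a) *\<^sub>R fst z) \<partial>\<nu>2) - (\<integral>z. c i * d (b *\<^sub>R snd z) (x + (real i * a) *\<^sub>R fst z) \<partial>\<nu>2)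
      = c i * ?I i"
      by (simp add: right_diff_distrib)
  qed
  then have "\<bar>Q a b (x + h) - Q a b x\<bar> \<le> (\<Sum>i=1..k. \<bar>c i\<bar> * \<bar>?I i\<bar>)"
    by (simp only: abs_mult[symmetric] sum_abs)
  then have "ennreal \<bar>Q a b (x + h) - Q a b x\<bar> \<le> (\<Sum>i=1..k. ennreal \<bar>c i\<bar> * ennreal \<bar>?I i\<bar>)"
    by (simp add: sum_nonneg ennreal_leI flip: ennreal_mult)
  also have "\<dots> \<le> (\<Sum>i=1..k. ennreal \<bar>c i\<bar> * (ennreal (?T * (norm h / a)) * ?M a))"
    by (intro sum_mono mult_left_mono I) auto
  also have "\<dots> = ennreal (\<Sum>i=1..k. \<bar>c i\<bar>) * (ennreal (?T * (norm h / a)) * ?M a)"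
    by (simp add: sum_distrib_right flip: sum_ennreal)
  also have "\<dots> \<le> ennreal (2 ^ k) * (ennreal (?T * (norm h / a)) * ?M a)"
    by (intro mult_right_mono ennreal_leI sum_abs_c) simp
  also have "\<dots> = ennreal (2 ^ k * (?T * (norm h / a))) * ?M a"
    using T a by (subst ennreal_mult) (auto simp: mult.assoc)
  finally show ?thesis .
qed

text \<open>\<open>f\<close> enters the final bound for the gap only through this function. It sees
  steps of length at most \<open>r\<close>, because the tent measure lives on the unit ball.\<close>

definition V :: "real \<Rightarrow> ennreal" where
  "V s = (\<integral>\<^sup>+\<theta>. maxavg (\<lambda>x. ennreal \<bar>d (r *\<^sub>R \<theta>) x\<bar>) s \<partial>\<nu>)"

definition \<rho> :: "nat \<Rightarrow> real" where "\<rho> j = 2 ^ j * r"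

lemma \<rho>_pos: "0 < \<rho> j"
  using r by (simp add: \<rho>_def)

lemma average_maxavg_le: "(\<integral>\<^sup>+\<theta>. maxavg (\<lambda>x. ennreal \<bar>d (\<rho> l *\<^sub>R \<theta>) x\<bar>) s \<partial>\<nu>) \<le> ennreal (2 ^ (k * l)) * V s"
proof -
  have "(\<integral>\<^sup>+\<theta>. maxavg (\<lambda>x. ennreal \<bar>d (\<rho> l *\<^sub>R \<theta>) x\<bar>) s \<partial>\<nu>) \<le> (\<integral>\<^sup>+\<theta>. ennreal (2 ^ (k * l)) * maxavg (\<lambda>x. ennreal \<bar>d (r *\<^sub>R \<theta>) x\<bar>) s \<partial>\<nu>)"
    unfolding \<rho>_def scaleR_scaleR[symmetric] by (intro nn_integral_mono maxavg_kdiff_power2 meas)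
  also have "\<dots> = ennreal (2 ^ (k * l)) * V s"
    unfolding V_def by (rule nn_integral_cmult) measurable
  finally show ?thesis .
qed

lemma V_antimono: "0 < s \<Longrightarrow> s \<le> s' \<Longrightarrow> V s' \<le> V s"
  unfolding V_def by (intro nn_integral_mono maxavg_antimono)

text \<open>\<open>smooth_diff\<close> has four terms, hence the 4. The worst combination smooths at
  the smaller scale \<open>\<rho> j\<close> and takes differences with the longer steps of scale
  \<open>\<rho> (Suc j)\<close>.\<close>

lemma smooth_step_le:
  assumes h: "norm h \<le> K * \<rho> j" and K: "0 \<le> K"
  shows "ennreal \<bar>(smooth (\<rho> j) (x + h) - smooth (\<rho> (Suc j)) (x + h)) - (smooth (\<rho> j) x - smooth (\<rho> (Suc j)) x)\<bar>
    \<le> ennreal (4 * 2 ^ k * tent_const TYPE('a) K * (norm h / \<rho> j) * 2 ^ (k * Suc j)) * V (\<rho> j ^ DIM('a))"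
proof -
  let ?T = "tent_const TYPE('a) K"
  let ?B = "ennreal (2 ^ k * (?T * (norm h / \<rho> j))) * (ennreal (2 ^ (k * Suc j)) * V (\<rho> j ^ DIM('a)))"
  let ?\<Delta> = "\<lambda>a b. Q (\<rho> a) (\<rho> b) (x + h) - Q (\<rho> a) (\<rho> b) x"
  have T: "0 < ?T" by (rule tent_const_pos)
  have B: "ennreal \<bar>?\<Delta> a b\<bar> \<le> ?B" if ab: "a \<in> {j, Suc j}" "b \<in> {j, Suc j}" for a b
  proof -
    have aj: "\<rho> j \<le> \<rho> a" using ab r by (auto simp: \<rho>_def)
    have "norm h \<le> K * \<rho> a" using h aj K by (meson mult_left_mono order_trans)
    then have "ennreal \<bar>?\<Delta> a b\<bar> \<le> ennreal (2 ^ k * (?T * (norm h / \<rho> a))) * (\<integral>\<^sup>+\<theta>. maxavg (\<lambda>x. ennreal \<bar>d (\<rho> b *\<^sub>R \<theta>) x\<bar>) (\<rho> a ^ DIM('a)) \<partial>\<nu>)"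
      by (intro Q_difference_le \<rho>_pos)
    also have "\<dots> \<le> ennreal (2 ^ k * (?T * (norm h / \<rho> j))) * (ennreal (2 ^ (k * b)) * V (\<rho> a ^ DIM('a)))"
      using aj T \<rho>_pos[of j] by (intro mult_mono ennreal_leI mult_left_mono divide_left_mono average_maxavg_le) (auto simp: \<rho>_pos)
    also have "\<dots> \<le> ?B"
    proof (intro mult_left_mono mult_mono ennreal_leI V_antimono power_mono)
      have "k * b \<le> k * Suc j" using ab by (intro mult_le_mono) auto
      then show "(2::real) ^ (k * b) \<le> 2 ^ (k * Suc j)" by (rule power_increasing) simp
    qed (use aj \<rho>_pos[of j] in auto)
    finally show ?thesis .
  qed
  have "(smooth (\<rho> j) (x + h) - smooth (\<rho> (Suc j)) (x + h)) - (smooth (\<rho> j) x - smooth (\<rho> (Suc j)) x)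
    = ?\<Delta> j (Suc j) - ?\<Delta> j j + ?\<Delta> (Suc j) (Suc j) - ?\<Delta> (Suc j) j"
    by (simp add: smooth_diff \<rho>_pos)
  then have "ennreal \<bar>(smooth (\<rho> j) (x + h) - smooth (\<rho> (Suc j)) (x + h)) - (smooth (\<rho> j) x - smooth (\<rho> (Suc j)) x)\<bar>
    \<le> ennreal (\<bar>?\<Delta> j (Suc j)\<bar> + \<bar>?\<Delta> j j\<bar> + \<bar>?\<Delta> (Suc j) (Suc j)\<bar> + \<bar>?\<Delta> (Suc j) j\<bar>)"
    by (intro ennreal_leI) linarith
  also have "\<dots> = ennreal \<bar>?\<Delta> j (Suc j)\<bar> + ennreal \<bar>?\<Delta> j j\<bar> + ennreal \<bar>?\<Delta> (Suc j) (Suc j)\<bar> + ennreal \<bar>?\<Delta> (Suc j) j\<bar>"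
    by simp
  also have "\<dots> \<le> ?B + ?B + ?B + ?B"
    by (intro add_mono B) auto
  also have "\<dots> = ennreal 4 * ?B"
    by (rule ennreal_four_times)
  also have "\<dots> = ennreal (4 * 2 ^ k * ?T * (norm h / \<rho> j) * 2 ^ (k * Suc j)) * V (\<rho> j ^ DIM('a))"
  proof -
    have *: "ennreal 4 * (ennreal (A * (t * q)) * (ennreal B * v)) = ennreal (4 * A * t * q * B) * v"
      if "0 \<le> q" "0 \<le> t" "0 \<le> A" "0 \<le> B" for A t q B :: real and v
      using that by (simp add: ennreal_mult mult.assoc del: ennreal_numeral)
    show ?thesis by (rule *) (use T \<rho>_pos[of j] in auto)
  qed
  finally show ?thesis .
qed

lemma smooth_le:
  assumes a: "0 < a"
  shows "ennreal \<bar>smooth a x\<bar> \<le> ennreal ((\<Sum>i=1..k. \<Sum>j=1..k. \<bar>c i * c j\<bar>) * tent_const TYPE('a) 0) * maxavg (\<lambda>x. ennreal \<bar>f x\<bar>) (a ^ DIM('a))"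
proof -
  let ?M = "\<lambda>a. ennreal (tent_const TYPE('a) 0) * maxavg (\<lambda>x. ennreal \<bar>f x\<bar>) (a ^ DIM('a))"
  have "ennreal \<bar>smooth a x\<bar> \<le> (\<integral>\<^sup>+z. ennreal \<bar>aa (a *\<^sub>R fst z) (a *\<^sub>R snd z) x\<bar> \<partial>\<nu>2)"
    unfolding smooth_def using integral_norm_bound_ennreal[OF integrable_aa[OF a]] by simp
  also have "\<dots> \<le> (\<integral>\<^sup>+z. (\<Sum>i=1..k. \<Sum>j=1..k. ennreal \<bar>c i * c j\<bar> * ennreal \<bar>f (x + (real i * a) *\<^sub>R fst z + (real j * a) *\<^sub>R snd z)\<bar>) \<partial>\<nu>2)"
  proof (intro nn_integral_mono)
    fix z :: "'a \<times> 'a"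
    have "\<bar>aa (a *\<^sub>R fst z) (a *\<^sub>R snd z) x\<bar> \<le> (\<Sum>i=1..k. \<Sum>j=1..k. \<bar>c i * c j\<bar> * \<bar>f (x + (real i * a) *\<^sub>R fst z + (real j * a) *\<^sub>R snd z)\<bar>)"
      unfolding aa_def scaleR_scaleR abs_mult[symmetric]
      by (intro order_trans[OF sum_abs] sum_mono order_refl)
    then show "ennreal \<bar>aa (a *\<^sub>R fst z) (a *\<^sub>R snd z) x\<bar> \<le> (\<Sum>i=1..k. \<Sum>j=1..k. ennreal \<bar>c i * c j\<bar> * ennreal \<bar>f (x + (real i * a) *\<^sub>R fst z + (real j * a) *\<^sub>R snd z)\<bar>)"
      by (simp add: sum_nonneg ennreal_leI flip: ennreal_mult)
  qed
  also have "\<dots> = (\<Sum>i=1..k. \<Sum>j=1..k. ennreal \<bar>c i * c j\<bar> * (\<integral>\<^sup>+z. ennreal \<bar>f (x + (real i * a) *\<^sub>R fst z + (real j * a) *\<^sub>R snd z)\<bar> \<partial>\<nu>2))"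
    by (simp add: nn_integral_sum nn_integral_cmult)
  also have "\<dots> \<le> (\<Sum>i=1..k. \<Sum>j=1..k. ennreal \<bar>c i * c j\<bar> * ?M a)"
  proof (intro sum_mono mult_left_mono)
    fix i j assume i: "i \<in> {1..k}"
    have "(\<integral>\<^sup>+z. ennreal \<bar>f (x + (real i * a) *\<^sub>R fst z + (real j * a) *\<^sub>R snd z)\<bar> \<partial>\<nu>2) \<le> ?M (real i * a)"
      using i a by (intro tent2_f_le) auto
    also have "\<dots> \<le> ?M a"
      using i a by (intro mult_left_mono maxavg_antimono power_mono) auto
    finally show "(\<integral>\<^sup>+z. ennreal \<bar>f (x + (real i * a) *\<^sub>R fst z + (real j * a) *\<^sub>R snd z)\<bar> \<partial>\<nu>2) \<le> ?M a" .
  qed simp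
  also have "\<dots> = (\<Sum>i=1..k. \<Sum>j=1..k. ennreal \<bar>c i * c j\<bar>) * ?M a"
    by (simp only: sum_distrib_right)
  also have "(\<Sum>i=1..k. \<Sum>j=1..k. ennreal \<bar>c i * c j\<bar>) = ennreal (\<Sum>i=1..k. \<Sum>j=1..k. \<bar>c i * c j\<bar>)"
    by (simp add: sum_nonneg)
  finally show ?thesis
    using tent_const_pos[of 0, where 'a = 'a] by (simp add: ennreal_mult sum_nonneg mult.assoc)
qed

text \<open>Ends the telescoping over scales: smoothing at scale \<open>\<rho> J\<close> is bounded
  by the maximal average of \<open>f\<close> at measure \<open>\<rho> J ^ n\<close>, which vanishes
  in the limit because \<open>f\<close> has finite \<open>p\<close>-norm.\<close>

lemma smooth_tendsto_0: "(\<lambda>J. ennreal \<bar>smooth (\<rho> J) x\<bar>) \<longlonglongrightarrow> 0"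
proof (rule tendsto_sandwich[where f = "\<lambda>_. 0"])
  let ?S = "(\<Sum>i=1..k. \<Sum>j=1..k. \<bar>c i * c j\<bar>) * tent_const TYPE('a) 0"
  have "filterlim (\<lambda>J. \<rho> J ^ DIM('a)) at_top sequentially"
  proof (rule filterlim_at_top_mono)
    show "filterlim (\<lambda>J. r ^ DIM('a) * 2 ^ J) at_top sequentially"
      using r by (intro filterlim_tendsto_pos_mult_at_top[OF tendsto_const]
          filterlim_at_infinity_imp_filterlim_at_top[OF filterlim_realpow_sequentially_gt1]) auto
    show "\<forall>\<^sub>F J in sequentially. r ^ DIM('a) * 2 ^ J \<le> \<rho> J ^ DIM('a)"
    proof (rule always_eventually, rule allI)
      fix J :: nat
      have "(2::real) ^ J \<le> (2 ^ J) ^ DIM('a)"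
        using DIM_positive[where 'a = 'a] by (intro self_le_power) auto
      then show "r ^ DIM('a) * 2 ^ J \<le> \<rho> J ^ DIM('a)"
        using r by (simp add: \<rho>_def power_mult_distrib mult.commute)
    qed
  qed
  then have "(\<lambda>J. maxavg (\<lambda>x. ennreal \<bar>f x\<bar>) (\<rho> J ^ DIM('a))) \<longlonglongrightarrow> 0"
    using maxavg_tendsto_0[OF _ Lp' p] by (rule filterlim_compose[rotated]) measurable
  then have "(\<lambda>J. ennreal ?S * maxavg (\<lambda>x. ennreal \<bar>f x\<bar>) (\<rho> J ^ DIM('a))) \<longlonglongrightarrow> ennreal ?S * 0"
    by (intro ennreal_tendsto_cmult) auto
  then show "(\<lambda>J. ennreal ?S * maxavg (\<lambda>x. ennreal \<bar>f x\<bar>) (\<rho> J ^ DIM('a))) \<longlonglongrightarrow> 0"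
    by simp
  show "\<forall>\<^sub>F J in sequentially. ennreal \<bar>smooth (\<rho> J) x\<bar> \<le> ennreal ?S * maxavg (\<lambda>x. ennreal \<bar>f x\<bar>) (\<rho> J ^ DIM('a))"
    by (intro always_eventually allI smooth_le \<rho>_pos)
qed auto

lemma measurable_rest [measurable]: "rest a \<in> borel_measurable borel"
proof -
  interpret sigma_finite_measure \<nu>2
    using finite_measureI[of \<nu>2] by (intro finite_measure.axioms(1)) (simp add: emeasure_\<nu>2)
  show ?thesis unfolding rest_def[abs_def] by measurable
qed

text \<open>Here the integral over \<open>E\<close> supplies the averaging, so the maximal average
  is taken at the measure \<open>s\<close> and not at a measure tied to the scale
  \<open>a\<close>.\<close>

lemma rest_le:
  assumes [measurable]: "E \<in> sets borel" and s: "0 < s" and E: "emeasure lborel E \<le> ennreal s"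
  shows "(\<integral>\<^sup>+x\<in>E. rest a (x + u) \<partial>lborel) \<le> ennreal s * (ennreal (1 + 2 ^ k) * (\<integral>\<^sup>+\<theta>. maxavg (\<lambda>x. ennreal \<bar>d (a *\<^sub>R \<theta>) x\<bar>) s \<partial>\<nu>))"
proof -
  let ?G = "\<lambda>\<theta>. maxavg (\<lambda>x. ennreal \<bar>d (a *\<^sub>R \<theta>) x\<bar>) s"
  interpret sf: sigma_finite_measure \<nu>2
    using finite_measureI[of \<nu>2] by (intro finite_measure.axioms(1)) (simp add: emeasure_\<nu>2)
  have ps: "pair_sigma_finite lborel \<nu>2"
    by (simp add: pair_sigma_finite_def sigma_finite_lborel sf.sigma_finite_measure_axioms)
  have tr: "(\<integral>\<^sup>+x\<in>E. ennreal \<bar>d (a *\<^sub>R \<theta>) (x + w)\<bar> \<partial>lborel) \<le> ennreal s * ?G \<theta>" for \<theta> w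
  proof -
    have "(\<integral>\<^sup>+x\<in>E. ennreal \<bar>d (a *\<^sub>R \<theta>) (x + w)\<bar> \<partial>lborel) \<le> ennreal s * maxavg (\<lambda>x. ennreal \<bar>d (a *\<^sub>R \<theta>) (x + w)\<bar>) s"
      using s E by (intro set_nn_integral_le_maxavg) auto
    \<comment> \<open>Translation invariance, as the one-term case of domination by
      translates.\<close>
    also have "maxavg (\<lambda>x. ennreal \<bar>d (a *\<^sub>R \<theta>) (x + w)\<bar>) s \<le> ennreal (real 1) * ?G \<theta>"
      by (rule maxavg_le_translates[where A = "{()}" and b = "\<lambda>_. 1" and v = "\<lambda>_. w"]) auto
    finally show ?thesis by (simp add: mult_left_mono)
  qed
  let ?F = "\<lambda>z x. ennreal \<bar>d (a *\<^sub>R fst z) (x + u)\<bar> + (\<Sum>i=1..k. ennreal \<bar>c i\<bar> * ennreal \<bar>d (a *\<^sub>R snd z) (x + u + real i *\<^sub>R a *\<^sub>R fst z)\<bar>)"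
  have "(\<integral>\<^sup>+x\<in>E. rest a (x + u) \<partial>lborel) = (\<integral>\<^sup>+x. (\<integral>\<^sup>+z. ?F z x * indicator E x \<partial>\<nu>2) \<partial>lborel)"
    unfolding rest_def by (intro nn_integral_cong nn_integral_multc[symmetric]) measurable
  also have "\<dots> = (\<integral>\<^sup>+z. (\<integral>\<^sup>+x. ?F z x * indicator E x \<partial>lborel) \<partial>\<nu>2)"
    by (rule pair_sigma_finite.Fubini'[OF ps, symmetric]) measurable
  also have "\<dots> \<le> (\<integral>\<^sup>+z. ennreal s * ?G (fst z) + ennreal (2 ^ k * s) * ?G (snd z) \<partial>\<nu>2)"
  proof (intro nn_integral_mono)
    fix z :: "'a \<times> 'a"
    have "(\<integral>\<^sup>+x. ?F z x * indicator E x \<partial>lborel) = (\<integral>\<^sup>+x\<in>E. ennreal \<bar>d (a *\<^sub>R fst z) (x + u)\<bar> \<partial>lborel)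
      + (\<Sum>i=1..k. ennreal \<bar>c i\<bar> * (\<integral>\<^sup>+x\<in>E. ennreal \<bar>d (a *\<^sub>R snd z) (x + (u + real i *\<^sub>R a *\<^sub>R fst z))\<bar> \<partial>lborel))"
      by (simp add: distrib_right sum_distrib_right nn_integral_add nn_integral_sum mult.assoc nn_integral_cmult add.assoc)
    also have "\<dots> \<le> ennreal s * ?G (fst z) + (\<Sum>i=1..k. ennreal \<bar>c i\<bar> * (ennreal s * ?G (snd z)))"
      by (intro add_mono sum_mono mult_left_mono tr) auto
    also have "(\<Sum>i=1..k. ennreal \<bar>c i\<bar> * (ennreal s * ?G (snd z))) = ennreal (\<Sum>i=1..k. \<bar>c i\<bar>) * (ennreal s * ?G (snd z))"
      by (simp add: sum_distrib_right flip: sum_ennreal)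
    also have "ennreal s * ?G (fst z) + \<dots> \<le> ennreal s * ?G (fst z) + ennreal (2 ^ k) * (ennreal s * ?G (snd z))"
      by (intro add_left_mono mult_right_mono ennreal_leI sum_abs_c) auto
    finally show "(\<integral>\<^sup>+x. ?F z x * indicator E x \<partial>lborel) \<le> ennreal s * ?G (fst z) + ennreal (2 ^ k * s) * ?G (snd z)"
      using s by (simp add: ennreal_mult mult.assoc)
  qed
  also have "\<dots> = ennreal s * (\<integral>\<^sup>+z. ?G (fst z) \<partial>\<nu>2) + ennreal (2 ^ k * s) * (\<integral>\<^sup>+z. ?G (snd z) \<partial>\<nu>2)"
    by (simp add: nn_integral_add nn_integral_cmult)
  also have "(\<integral>\<^sup>+z. ?G (fst z) \<partial>\<nu>2) = (\<integral>\<^sup>+\<theta>. ?G \<theta> \<partial>\<nu>)"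
    by (subst pair_sigma_finite.nn_integral_snd[OF pair_sigma_finite_tent(1), symmetric]) (auto simp: emeasure_tent_measure)
  also have "(\<integral>\<^sup>+z. ?G (snd z) \<partial>\<nu>2) = (\<integral>\<^sup>+\<theta>. ?G \<theta> \<partial>\<nu>)"
    by (subst pair_sigma_finite.nn_integral_snd[OF pair_sigma_finite_tent(1), symmetric]) (auto simp: emeasure_tent_measure)
  also have "ennreal s * (\<integral>\<^sup>+\<theta>. ?G \<theta> \<partial>\<nu>) + ennreal (2 ^ k * s) * (\<integral>\<^sup>+\<theta>. ?G \<theta> \<partial>\<nu>)
     = ennreal s * (ennreal (1 + 2 ^ k) * (\<integral>\<^sup>+\<theta>. ?G \<theta> \<partial>\<nu>))"
    using s by (simp add: ennreal_mult distrib_left distrib_right mult_ac)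
  finally show ?thesis .
qed

end

text \<open>Multiplied by \<open>s powr (1 / n)\<close>, this is the radius of a ball of volume
  \<open>2 * s\<close>, the volume required by \<open>rearrangement_gap_le\<close>.\<close>

definition gap_radius :: "'a::euclidean_space itself \<Rightarrow> real" where
  "gap_radius _ = (2 / unit_ball_vol (real DIM('a))) powr (1 / real DIM('a))"

text \<open>Collects \<open>4 * 2 ^ k\<close> from \<open>smooth_step_le\<close>, a further
  \<open>2 ^ k\<close> from the successor in its exponent, and \<open>gap_radius\<close> as the
  bound for \<open>norm h\<close> relative to the starting scale.\<close>

definition step_const :: "'a::euclidean_space itself \<Rightarrow> nat \<Rightarrow> real" where
  "step_const _ k = 4 * 2 ^ k * 2 ^ k * tent_const TYPE('a) (gap_radius TYPE('a)) * gap_radius TYPE('a)"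

text \<open>The outer 2 comes from \<open>rearrangement_gap_le\<close>, the inner 2 from the two
  terms \<open>rest\<close> at \<open>x + h\<close> and at \<open>x\<close>.\<close>

definition gap_const :: "'a::euclidean_space itself \<Rightarrow> nat \<Rightarrow> real" where
  "gap_const _ k = 2 * (2 * (1 + 2 ^ k) + step_const TYPE('a) k)"

lemma gap_radius_nonneg: "0 \<le> gap_radius TYPE('a::euclidean_space)"
  by (simp add: gap_radius_def)

lemma step_const_nonneg: "0 \<le> step_const TYPE('a::euclidean_space) k"
  using tent_const_pos[of "gap_radius TYPE('a)", where 'a = 'a] gap_radius_nonneg[where 'a = 'a]
  by (simp add: step_const_def)

lemma gap_const_pos: "0 < gap_const TYPE('a::euclidean_space) k"
  using step_const_nonneg[of k, where 'a = 'a] by (simp add: gap_const_def add_pos_nonneg)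

section \<open>The gap in terms of \<open>V\<close> and its sums over larger scales\<close>

context Lp_function
begin

text \<open>Collects the levels from \<open>m\<close> on. Per level, \<open>2 ^ k\<close> is the
  price of doubling the step and \<open>1 / 2\<close> the gain from the Lipschitz kernel.\<close>

definition W :: "nat \<Rightarrow> ennreal" where
  "W m = (\<Sum>i. ennreal ((2 ^ k / 2) ^ i) * V (\<rho> (m + i) ^ DIM('a)))"

lemma difference_le:
  assumes h: "norm h \<le> gap_radius TYPE('a) * \<rho> m"
  shows "ennreal \<bar>f (x + h) - f x\<bar> \<le> rest (\<rho> m) (x + h) + rest (\<rho> m) x + ennreal (step_const TYPE('a) k * 2 ^ (k * m)) * W m"
proof -
  let ?K = "gap_radius TYPE('a)" and ?S = "step_const TYPE('a) k * 2 ^ (k * m)"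
  let ?g = "\<lambda>x i. smooth (\<rho> (m + i)) x"
  let ?D = "\<lambda>i. (?g (x + h) i - ?g (x + h) (Suc i)) - (?g x i - ?g x (Suc i))"
  have S: "0 \<le> ?S" using step_const_nonneg[of k, where 'a = 'a] by simp
  have T: "0 < tent_const TYPE('a) ?K" by (rule tent_const_pos)
  have D: "ennreal \<bar>?D i\<bar> \<le> ennreal ?S * (ennreal ((2 ^ k / 2) ^ i) * V (\<rho> (m + i) ^ DIM('a)))" for i
  proof -
    have \<rho>i: "\<rho> (m + i) = 2 ^ i * \<rho> m" by (simp add: \<rho>_def power_add)
    have "\<rho> m \<le> \<rho> (m + i)" using \<rho>_pos[of m] by (simp add: \<rho>i)
    then have "norm h \<le> ?K * \<rho> (m + i)"
      using h gap_radius_nonneg[where 'a = 'a] by (meson mult_left_mono order_trans)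
    then have "ennreal \<bar>?D i\<bar> \<le> ennreal (4 * 2 ^ k * tent_const TYPE('a) ?K * (norm h / \<rho> (m + i)) * 2 ^ (k * Suc (m + i))) * V (\<rho> (m + i) ^ DIM('a))"
      using smooth_step_le[of h ?K "m + i" x] gap_radius_nonneg[where 'a = 'a] by simp
    also have "\<dots> \<le> ennreal (?S * (2 ^ k / 2) ^ i) * V (\<rho> (m + i) ^ DIM('a))"
    proof (intro mult_right_mono ennreal_leI)
      have "norm h / \<rho> (m + i) \<le> ?K / 2 ^ i"
        using h \<rho>_pos[of m] unfolding \<rho>i by (simp add: field_simps)
      then have "4 * 2 ^ k * tent_const TYPE('a) ?K * (norm h / \<rho> (m + i)) * 2 ^ (k * Suc (m + i))
        \<le> 4 * 2 ^ k * tent_const TYPE('a) ?K * (?K / 2 ^ i) * 2 ^ (k * Suc (m + i))"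
        using T by (intro mult_right_mono mult_left_mono) auto
      also have "\<dots> = ?S * (2 ^ k / 2) ^ i"
        using power_mult[of "2::real" i k] power_mult[of "2::real" k i]
        by (simp add: step_const_def power_divide power_mult power_add algebra_simps)
      finally show "4 * 2 ^ k * tent_const TYPE('a) ?K * (norm h / \<rho> (m + i)) * 2 ^ (k * Suc (m + i)) \<le> ?S * (2 ^ k / 2) ^ i" .
    qed simp
    also have "\<dots> = ennreal ?S * (ennreal ((2 ^ k / 2) ^ i) * V (\<rho> (m + i) ^ DIM('a)))"
      using S by (subst ennreal_mult) (auto simp: mult.assoc)
    finally show ?thesis .
  qed
  \<comment> \<open>The telescoping sum stops at a finite level \<open>J\<close>; the two leftover
    smoothings tend to 0 and disappear in the limit taken at the end.\<close>
  have J: "ennreal \<bar>f (x + h) - f x\<bar> \<le> (rest (\<rho> m) (x + h) + rest (\<rho> m) x + ennreal ?S * W m) + (ennreal \<bar>?g (x + h) J\<bar> + ennreal \<bar>?g x J\<bar>)" for J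
  proof -
    have "(\<Sum>i<J. ?g y i - ?g y (Suc i)) = ?g y 0 - ?g y J" for y
      by (rule sum_lessThan_telescope')
    then have "(\<Sum>i<J. ?D i) = (?g (x + h) 0 - ?g (x + h) J) - (?g x 0 - ?g x J)"
      by (subst sum_subtractf) (simp only:)
    then have "f (x + h) - f x = (f (x + h) - smooth (\<rho> m) (x + h)) - (f x - smooth (\<rho> m) x) + (\<Sum>i<J. ?D i) + ?g (x + h) J - ?g x J"
      by simp
    then have "\<bar>f (x + h) - f x\<bar> \<le> \<bar>f (x + h) - smooth (\<rho> m) (x + h)\<bar> + \<bar>f x - smooth (\<rho> m) x\<bar> + (\<Sum>i<J. \<bar>?D i\<bar>) + (\<bar>?g (x + h) J\<bar> + \<bar>?g x J\<bar>)"
      using sum_abs[of ?D "{..<J}"] by linarith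
    then have "ennreal \<bar>f (x + h) - f x\<bar> \<le> ennreal \<bar>f (x + h) - smooth (\<rho> m) (x + h)\<bar> + ennreal \<bar>f x - smooth (\<rho> m) x\<bar> + (\<Sum>i<J. ennreal \<bar>?D i\<bar>) + (ennreal \<bar>?g (x + h) J\<bar> + ennreal \<bar>?g x J\<bar>)"
      by (simp add: ennreal_leI sum_nonneg del: ennreal_plus flip: ennreal_plus)
    also have "\<dots> \<le> rest (\<rho> m) (x + h) + rest (\<rho> m) x + ennreal ?S * W m + (ennreal \<bar>?g (x + h) J\<bar> + ennreal \<bar>?g x J\<bar>)"
    proof (intro add_mono f_minus_smooth_le \<rho>_pos order_refl)
      have "(\<Sum>i<J. ennreal \<bar>?D i\<bar>) \<le> (\<Sum>i<J. ennreal ?S * (ennreal ((2 ^ k / 2) ^ i) * V (\<rho> (m + i) ^ DIM('a))))"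
        by (intro sum_mono D)
      also have "\<dots> \<le> (\<Sum>i. ennreal ?S * (ennreal ((2 ^ k / 2) ^ i) * V (\<rho> (m + i) ^ DIM('a))))"
        by (intro sum_le_suminf) auto
      also have "\<dots> = ennreal ?S * W m"
        unfolding W_def by (rule ennreal_suminf_cmult)
      finally show "(\<Sum>i<J. ennreal \<bar>?D i\<bar>) \<le> ennreal ?S * W m" .
    qed
    finally show ?thesis .
  qed
  let ?B = "rest (\<rho> m) (x + h) + rest (\<rho> m) x + ennreal ?S * W m"
  have lim: "(\<lambda>J. ennreal \<bar>?g y J\<bar>) \<longlonglongrightarrow> 0" for y
    using LIMSEQ_ignore_initial_segment[OF smooth_tendsto_0[of y], of m] by (simp add: add.commute)
  have "(\<lambda>J. ?B + (ennreal \<bar>?g (x + h) J\<bar> + ennreal \<bar>?g x J\<bar>)) \<longlonglongrightarrow> ?B + (0 + 0)"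
    by (intro tendsto_add tendsto_const lim)
  then have "ennreal \<bar>f (x + h) - f x\<bar> \<le> ?B + (0 + 0)"
    by (rule LIMSEQ_le_const) (use J in blast)
  then show ?thesis by simp
qed

text \<open>The bound on \<open>s\<close> guarantees that all vectors in a ball of volume
  \<open>2 * s\<close> are short enough for \<open>difference_le\<close> at level
  \<open>m\<close>.\<close>

lemma rearrangement_gap_le_V:
  assumes s: "0 < s" "s \<le> \<rho> m ^ DIM('a)"
  shows "maximal_rearrangement f s - rearrangement f s \<le> ennreal (gap_const TYPE('a) k * 2 ^ (k * m)) * (V s + W m)"
proof -
  let ?n = "DIM('a)" and ?S = "step_const TYPE('a) k * 2 ^ (k * m)"
  let ?w = "unit_ball_vol (real ?n)"
  define R where "R = gap_radius TYPE('a) * s powr (1 / ?n)"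
  have n: "0 < ?n" by (rule DIM_positive)
  have w: "0 < ?w" by simp
  then have w': "?w \<noteq> 0" by linarith
  have R0: "0 \<le> R" using gap_radius_nonneg[where 'a = 'a] by (simp add: R_def)
  have "R = (2 * s / ?w) powr (1 / ?n)"
    using s w by (simp add: R_def gap_radius_def powr_mult flip: times_divide_eq_left)
  then have "R powr ?n = 2 * s / ?w"
    using s w n by (simp add: powr_powr)
  then have Rn: "R ^ ?n = 2 * s / ?w"
    using R0 n by (cases "R = 0") (auto simp: powr_realpow)
  have Q: "emeasure lborel (cball (0::'a) R) = ennreal (2 * s)"
    by (simp add: emeasure_cball[OF R0] Rn w')
  have "s powr (1 / ?n) \<le> (\<rho> m ^ ?n) powr (1 / ?n)"
    using s by (intro powr_mono2) auto
  also have "\<dots> = \<rho> m"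
    using \<rho>_pos[of m] n by (simp add: powr_powr flip: powr_realpow)
  finally have R: "R \<le> gap_radius TYPE('a) * \<rho> m"
    unfolding R_def using gap_radius_nonneg[where 'a = 'a] by (rule mult_left_mono)
  let ?X = "ennreal (2 * (1 + 2 ^ k) * 2 ^ (k * m)) * V s + ennreal ?S * W m"
  have "maximal_rearrangement f s - rearrangement f s \<le> ennreal 2 * ?X"
  proof (rule rearrangement_gap_le[OF meas _ s(1) Lp _ Q])
    fix h :: 'a and E :: "'a set"
    assume "h \<in> cball 0 R" and E [measurable]: "E \<in> sets borel" and Es: "emeasure lborel E \<le> ennreal s"
    then have h: "norm h \<le> gap_radius TYPE('a) * \<rho> m" using R by simp
    let ?Y = "ennreal s * (ennreal (1 + 2 ^ k) * (ennreal (2 ^ (k * m)) * V s))"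
    have rest: "(\<integral>\<^sup>+x\<in>E. rest (\<rho> m) (x + u) \<partial>lborel) \<le> ?Y" for u
      by (rule order_trans[OF rest_le[OF E s(1) Es]]) (intro mult_left_mono average_maxavg_le, auto)
    have "(\<integral>\<^sup>+x\<in>E. ennreal \<bar>f (x + h) - f x\<bar> \<partial>lborel)
      \<le> (\<integral>\<^sup>+x. (rest (\<rho> m) (x + h) * indicator E x + rest (\<rho> m) (x + 0) * indicator E x) + ennreal ?S * W m * indicator E x \<partial>lborel)"
      using difference_le[OF h] by (intro nn_integral_mono) (auto simp: indicator_def)
    also have "\<dots> = (\<integral>\<^sup>+x\<in>E. rest (\<rho> m) (x + h) \<partial>lborel) + (\<integral>\<^sup>+x\<in>E. rest (\<rho> m) (x + 0) \<partial>lborel) + ennreal ?S * W m * emeasure lborel E"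
      by (simp add: nn_integral_add nn_integral_cmult)
    also have "\<dots> \<le> ?Y + ?Y + ennreal ?S * W m * ennreal s"
      by (intro add_mono rest mult_left_mono Es) simp
    also have "\<dots> = ennreal s * ?X"
    proof -
      have "?Y + ?Y = ennreal s * (ennreal (2 * (1 + 2 ^ k) * 2 ^ (k * m)) * V s)"
        by (simp add: ennreal_mult mult.assoc distrib_left distrib_right flip: mult_2)
          (simp add: mult_ac distrib_left flip: mult_2)
      then show ?thesis by (simp add: distrib_left mult_ac)
    qed
    finally show "(\<integral>\<^sup>+x\<in>E. ennreal \<bar>f (x + h) - f x\<bar> \<partial>lborel) \<le> ennreal s * ?X" .
  qed (use p in auto)
  also have "\<dots> \<le> ennreal (gap_const TYPE('a) k * 2 ^ (k * m)) * (V s + W m)"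
  proof -
    have "ennreal 2 * (ennreal A * v) = ennreal (2 * A) * v" if "0 \<le> A" for A v
      using that by (simp add: ennreal_mult mult.assoc)
    then have "ennreal 2 * ?X = ennreal (2 * (2 * (1 + 2 ^ k) * 2 ^ (k * m))) * V s + ennreal (2 * ?S) * W m"
      using step_const_nonneg[of k, where 'a = 'a] unfolding distrib_left by simp
    also have "\<dots> \<le> ennreal (gap_const TYPE('a) k * 2 ^ (k * m)) * V s + ennreal (gap_const TYPE('a) k * 2 ^ (k * m)) * W m"
      using step_const_nonneg[of k, where 'a = 'a]
      by (intro add_mono mult_right_mono ennreal_leI) (auto simp: gap_const_def)
    finally show ?thesis by (simp add: distrib_left)
  qed
  finally show ?thesis .
qed

end

section \<open>Summation over dyadic scales\<close>

text \<open>Jensen's inequality for the probability weights \<open>(1 - q) * q ^ i\<close>.\<close>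

lemma geometric_Jensen:
  fixes Y :: "nat \<Rightarrow> ennreal"
  assumes q: "0 < q" "q < 1" and p: "1 < p"
  shows "ennpowr (\<Sum>i. ennreal (q ^ i) * Y i) p \<le> ennreal ((1 / (1 - q)) powr p) * (\<Sum>i. ennreal (q ^ i) * ennpowr (Y i) p)"
proof -
  define M where "M = density (count_space UNIV) (\<lambda>i::nat. ennreal ((1 - q) * q ^ i))"
  have int: "(\<integral>\<^sup>+i. g i \<partial>M) = ennreal (1 - q) * (\<Sum>i. ennreal (q ^ i) * g i)" for g
    unfolding M_def using q
    by (subst nn_integral_density) (auto simp: nn_integral_count_space_nat ennreal_mult mult.assoc)
  have "(\<Sum>i. ennreal (q ^ i)) = ennreal (1 / (1 - q))"
    using q by (intro suminf_ennreal_eq geometric_sums) auto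
  then have "emeasure M (space M) = 1"
    using q int[of "\<lambda>_. 1"] by (simp flip: ennreal_mult)
  then have "ennpowr (\<integral>\<^sup>+i. Y i \<partial>M) p \<le> (\<integral>\<^sup>+i. ennpowr (Y i) p \<partial>M)"
    by (intro Jensen_ennpowr p) (auto simp: M_def)
  then have "ennreal ((1 - q) powr p) * ennpowr (\<Sum>i. ennreal (q ^ i) * Y i) p \<le> ennreal (1 - q) * (\<Sum>i. ennreal (q ^ i) * ennpowr (Y i) p)"
    using q p by (simp add: int ennpowr_mult ennpowr_ennreal)
  also have "\<dots> \<le> 1 * (\<Sum>i. ennreal (q ^ i) * ennpowr (Y i) p)"
    using q by (intro mult_right_mono) auto
  finally have "ennreal ((1 / (1 - q)) powr p) * (ennreal ((1 - q) powr p) * ennpowr (\<Sum>i. ennreal (q ^ i) * Y i) p)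
    \<le> ennreal ((1 / (1 - q)) powr p) * (\<Sum>i. ennreal (q ^ i) * ennpowr (Y i) p)"
    by (intro mult_left_mono) auto
  moreover have "ennreal ((1 / (1 - q)) powr p) * ennreal ((1 - q) powr p) = 1"
    using q by (simp flip: ennreal_mult powr_mult)
  ultimately show ?thesis by (simp flip: mult.assoc)
qed

lemma suminf_shift_le:
  fixes g :: "nat \<Rightarrow> ennreal"
  shows "(\<Sum>m. g (m + i)) \<le> (\<Sum>m. g m)"
proof (rule suminf_le_const)
  fix N
  have "(\<Sum>m<N. g (m + i)) = (\<Sum>j\<in>(\<lambda>m. m + i) ` {..<N}. g j)"
    by (simp add: sum.reindex)
  also have "\<dots> \<le> (\<Sum>m. g m)"
    by (intro sum_le_suminf) auto
  finally show "(\<Sum>m<N. g (m + i)) \<le> (\<Sum>m. g m)" .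
qed simp

lemma suminf_swap_ennreal:
  fixes g :: "nat \<Rightarrow> nat \<Rightarrow> ennreal"
  shows "(\<Sum>m. \<Sum>i. g m i) = (\<Sum>i. \<Sum>m. g m i)"
proof -
  have "(\<integral>\<^sup>+m. (\<Sum>i. g m i) \<partial>count_space UNIV) = (\<Sum>i. (\<integral>\<^sup>+m. g m i \<partial>count_space UNIV))"
    by (intro nn_integral_suminf) auto
  then show ?thesis by (simp add: nn_integral_count_space_nat)
qed

text \<open>Jensen in each row, then the order of summation is exchanged: every fixed shift
  \<open>i\<close> contributes at most the full sum, and the weights add up to
  \<open>1 / (1 - q)\<close>.\<close>

lemma geometric_Hardy:
  fixes Y :: "nat \<Rightarrow> ennreal"
  assumes q: "0 < q" "q < 1" and p: "1 < p"
  shows "(\<Sum>m. ennpowr (\<Sum>i. ennreal (q ^ i) * Y (m + i)) p) \<le> ennreal ((1 / (1 - q)) powr p * (1 / (1 - q))) * (\<Sum>j. ennpowr (Y j) p)"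
proof -
  let ?c = "ennreal ((1 / (1 - q)) powr p)"
  have "(\<Sum>m. ennpowr (\<Sum>i. ennreal (q ^ i) * Y (m + i)) p) \<le> (\<Sum>m. ?c * (\<Sum>i. ennreal (q ^ i) * ennpowr (Y (m + i)) p))"
    by (intro suminf_le geometric_Jensen q p) auto
  also have "\<dots> = ?c * (\<Sum>i. ennreal (q ^ i) * (\<Sum>m. ennpowr (Y (m + i)) p))"
    by (subst ennreal_suminf_cmult, subst suminf_swap_ennreal) simp
  also have "\<dots> \<le> ?c * (\<Sum>i. ennreal (q ^ i) * (\<Sum>j. ennpowr (Y j) p))"
    by (intro mult_left_mono suminf_le suminf_shift_le[of "\<lambda>j. ennpowr (Y j) p"]) auto
  also have "\<dots> = ?c * (ennreal (1 / (1 - q)) * (\<Sum>j. ennpowr (Y j) p))"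
  proof -
    have "(\<Sum>i. ennreal (q ^ i)) = ennreal (1 / (1 - q))"
      using q by (intro suminf_ennreal_eq geometric_sums) auto
    then show ?thesis by simp
  qed
  also have "\<dots> = ennreal ((1 / (1 - q)) powr p * (1 / (1 - q))) * (\<Sum>j. ennpowr (Y j) p)"
    using q by (subst ennreal_mult) (auto simp: mult.assoc)
  finally show ?thesis .
qed

definition Hardy_const :: "real \<Rightarrow> real" where
  "Hardy_const p = 2 * p / (p - 1) * 4 powr (p - 1)"

text \<open>Equals \<open>2 powr (k - 1 - n / p)\<close>: the growth per level of the coefficients
  in \<open>W\<close> against the decay of \<open>V\<close> in the weighted
  \<open>p\<close>-sum.\<close>

definition sum_ratio :: "'a::euclidean_space itself \<Rightarrow> nat \<Rightarrow> real \<Rightarrow> real" where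
  "sum_ratio _ k p = 2 ^ k / 2 * (1 / 2 powr (real DIM('a) / p))"

text \<open>The constant of \<open>geometric_Hardy\<close>, doubled by
  \<open>sum_V_le\<close>.\<close>

definition sum_const :: "'a::euclidean_space itself \<Rightarrow> nat \<Rightarrow> real \<Rightarrow> real" where
  "sum_const _ k p = (let q = sum_ratio TYPE('a) k p in 2 * ((1 / (1 - q)) powr p * (1 / (1 - q))))"

section \<open>The \<open>p\<close>-norms of \<open>V\<close> and \<open>W\<close> over dyadic
  blocks\<close>

context Lp_function
begin

lemma measurable_V [measurable]: "V \<in> borel_measurable borel"
proof -
  interpret sigma_finite_measure \<nu> by (rule sigma_finite_tent)
  show ?thesis unfolding V_def[abs_def] by measurable
qed

text \<open>Jensen pulls the power inside the average over steps, so the Hardy inequality is used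
  for one fixed step at a time; almost every \<open>\<theta>\<close> has norm at most 1, so only
  steps up to \<open>r\<close> occur.\<close>

lemma V_Lp:
  assumes M: "\<And>v. norm v \<le> r \<Longrightarrow> (\<integral>\<^sup>+x. ennreal (\<bar>d v x\<bar> powr p) \<partial>lborel) \<le> M"
  shows "(\<integral>\<^sup>+s\<in>{0<..}. ennpowr (V s) p \<partial>lborel) \<le> ennreal (Hardy_const p) * M"
proof -
  let ?g = "\<lambda>\<theta> x. ennreal \<bar>d (r *\<^sub>R \<theta>) x\<bar>"
  have "(\<integral>\<^sup>+s\<in>{0<..}. ennpowr (V s) p \<partial>lborel) \<le> (\<integral>\<^sup>+s. (\<integral>\<^sup>+\<theta>. ennpowr (maxavg (?g \<theta>) s) p * indicator {0<..} s \<partial>\<nu>) \<partial>lborel)"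
  proof (intro nn_integral_mono)
    fix s :: real
    have "ennpowr (V s) p \<le> (\<integral>\<^sup>+\<theta>. ennpowr (maxavg (?g \<theta>) s) p \<partial>\<nu>)"
      unfolding V_def by (intro Jensen_ennpowr p) (auto simp: emeasure_tent_measure)
    then have "ennpowr (V s) p * indicator {0<..} s \<le> (\<integral>\<^sup>+\<theta>. ennpowr (maxavg (?g \<theta>) s) p \<partial>\<nu>) * indicator {0<..} s"
      by (rule mult_right_mono) simp
    then show "ennpowr (V s) p * indicator {0<..} s \<le> (\<integral>\<^sup>+\<theta>. ennpowr (maxavg (?g \<theta>) s) p * indicator {0<..} s \<partial>\<nu>)"
      by (simp add: nn_integral_multc)
  qed
  also have "\<dots> = (\<integral>\<^sup>+\<theta>. (\<integral>\<^sup>+s. ennpowr (maxavg (?g \<theta>) s) p * indicator {0<..} s \<partial>lborel) \<partial>\<nu>)"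
    by (rule pair_sigma_finite.Fubini'[OF pair_sigma_finite_tent(2)]) measurable
  also have "\<dots> \<le> (\<integral>\<^sup>+\<theta>. ennreal (Hardy_const p) * M \<partial>\<nu>)"
  proof (intro nn_integral_mono_AE)
    show "AE \<theta> in \<nu>. (\<integral>\<^sup>+s\<in>{0<..}. ennpowr (maxavg (?g \<theta>) s) p \<partial>lborel) \<le> ennreal (Hardy_const p) * M"
      using AE_tent_measure
    proof eventually_elim
      case (elim \<theta>)
      have "(\<integral>\<^sup>+s\<in>{0<..}. ennpowr (maxavg (?g \<theta>) s) p \<partial>lborel) \<le> ennreal (Hardy_const p) * (\<integral>\<^sup>+x. ennpowr (?g \<theta> x) p \<partial>lborel)"
        unfolding Hardy_const_def by (intro Hardy_maxavg p) auto
      also have "\<dots> \<le> ennreal (Hardy_const p) * M"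
        using M[of "r *\<^sub>R \<theta>"] elim r by (intro mult_left_mono) (auto simp: ennpowr_ennreal)
      finally show ?case .
    qed
  qed
  also have "\<dots> = ennreal (Hardy_const p) * M"
    by (simp add: emeasure_tent_measure)
  finally show ?thesis .
qed

text \<open>The block for \<open>m = 0\<close> reaches down to 0, so that all \<open>s\<close> up to
  \<open>r ^ n\<close> are treated at level 0; the later blocks lie between consecutive values of
  \<open>\<rho> m ^ n\<close>.\<close>

definition I :: "nat \<Rightarrow> real set" where
  "I m = {(if m = 0 then 0 else (\<rho> (m - 1) ^ DIM('a))) <.. (\<rho> m ^ DIM('a))}"

lemma radius_Suc: "2 * (\<rho> m ^ DIM('a)) \<le> (\<rho> (Suc m) ^ DIM('a))"
proof -
  have "(2::real) \<le> 2 ^ DIM('a)"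
    using DIM_positive[where 'a = 'a] by (intro self_le_power) auto
  then have "2 * (\<rho> m ^ DIM('a)) \<le> 2 ^ DIM('a) * (\<rho> m ^ DIM('a))"
    using \<rho>_pos[of m] by (intro mult_right_mono) auto
  then show ?thesis by (simp add: \<rho>_def power_mult_distrib mult_ac)
qed

lemma radius_pos: "0 < (\<rho> m ^ DIM('a))"
  using \<rho>_pos[of m] by simp

lemma radius_mono: "m \<le> m' \<Longrightarrow> (\<rho> m ^ DIM('a)) \<le> (\<rho> m' ^ DIM('a))"
  using r by (intro power_mono) (auto simp: \<rho>_def)

lemma measurable_I [measurable]: "I m \<in> sets borel"
  by (simp add: I_def)

lemma I_cover: "0 < s \<Longrightarrow> \<exists>m. s \<in> I m"
proof -
  assume s: "0 < s"
  have "\<exists>m. s \<le> (\<rho> m ^ DIM('a))"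
  proof -
    obtain m where m: "s / (\<rho> 0 ^ DIM('a)) < 2 ^ m"
      using real_arch_pow[of 2 "s / (\<rho> 0 ^ DIM('a))"] by auto
    have "2 ^ m * (\<rho> 0 ^ DIM('a)) \<le> (\<rho> m ^ DIM('a))"
    proof (induction m)
      case (Suc m)
      then show ?case using radius_Suc[of m] by simp
    qed simp
    moreover have "s < 2 ^ m * (\<rho> 0 ^ DIM('a))"
      using m radius_pos[of 0] by (simp add: divide_less_eq)
    ultimately show ?thesis by (intro exI[of _ m]) linarith
  qed
  define m where "m = (LEAST m. s \<le> (\<rho> m ^ DIM('a)))"
  have 1: "s \<le> (\<rho> m ^ DIM('a))" unfolding m_def using \<open>\<exists>m. s \<le> (\<rho> m ^ DIM('a))\<close> by (rule LeastI_ex)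
  have 2: "(\<rho> (m - 1) ^ DIM('a)) < s" if "m \<noteq> 0"
    using not_less_Least[of "m - 1" "\<lambda>m. s \<le> (\<rho> m ^ DIM('a))"] that unfolding m_def[symmetric] by simp
  show ?thesis using 1 2 s by (intro exI[of _ m]) (auto simp: I_def)
qed

lemma disjoint_I: "disjoint_family I"
  unfolding disjoint_family_on_def
proof (intro ballI impI)
  have *: "I m \<inter> I m' = {}" if "m < m'" for m m'
  proof -
    have "(\<rho> m ^ DIM('a)) \<le> (\<rho> (m' - 1) ^ DIM('a))" using that by (intro radius_mono) auto
    then show ?thesis using that by (auto simp: I_def)
  qed
  show "I m \<inter> I m' = {}" if "m \<noteq> m'" for m m'
    using that *[of m m'] *[of m' m] by (auto simp: neq_iff)
qed

lemma I_Union: "(\<Union>m. I m) = {0<..}"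
proof
  have "0 < s" if "s \<in> I m" for s m
    using that radius_pos[of "m - 1"] by (auto simp: I_def split: if_splits)
  then show "(\<Union>m. I m) \<subseteq> {0<..}" by auto
  show "{0<..} \<subseteq> (\<Union>m. I m)" using I_cover by auto
qed

lemma emeasure_I: "emeasure lborel (I m) \<le> ennreal (\<rho> m ^ DIM('a))" "ennreal ((\<rho> m ^ DIM('a)) / 2) \<le> emeasure lborel (I m)"
proof -
  define a where "a = (if m = 0 then 0 else (\<rho> (m - 1) ^ DIM('a)))"
  have "0 \<le> a" using radius_pos[of "m - 1"] by (simp add: a_def)
  moreover have "a \<le> (\<rho> m ^ DIM('a)) / 2" using radius_Suc[of "m - 1"] radius_pos[of m] by (auto simp: a_def)
  moreover have "emeasure lborel (I m) = ennreal ((\<rho> m ^ DIM('a)) - a)"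
    using calculation radius_pos[of m] unfolding I_def a_def[symmetric] by simp
  ultimately show "emeasure lborel (I m) \<le> ennreal (\<rho> m ^ DIM('a))" "ennreal ((\<rho> m ^ DIM('a)) / 2) \<le> emeasure lborel (I m)"
    by (auto intro!: ennreal_leI)
qed

lemma sum_integral_I: "(\<Sum>m. \<integral>\<^sup>+s\<in>I m. ennpowr (V s) p \<partial>lborel) = (\<integral>\<^sup>+s\<in>{0<..}. ennpowr (V s) p \<partial>lborel)"
  unfolding I_Union[symmetric] by (rule nn_integral_disjoint_family[symmetric]) (auto simp: disjoint_I)

text \<open>\<open>V\<close> is decreasing, so its value at the right end of a block is at most its
  values inside, and a block fills at least half of the interval from 0 to its right end.\<close>

lemma sum_V_le: "(\<Sum>j. ennreal (\<rho> j ^ DIM('a)) * ennpowr (V (\<rho> j ^ DIM('a))) p) \<le> ennreal 2 * (\<integral>\<^sup>+s\<in>{0<..}. ennpowr (V s) p \<partial>lborel)"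
proof -
  have "ennreal (\<rho> j ^ DIM('a)) * ennpowr (V (\<rho> j ^ DIM('a))) p \<le> ennreal 2 * (\<integral>\<^sup>+s\<in>I j. ennpowr (V s) p \<partial>lborel)" for j
  proof -
    have "ennreal (\<rho> j ^ DIM('a)) * ennpowr (V (\<rho> j ^ DIM('a))) p = ennreal 2 * (ennreal ((\<rho> j ^ DIM('a)) / 2) * ennpowr (V (\<rho> j ^ DIM('a))) p)"
      using radius_pos[of j] by (simp flip: mult.assoc ennreal_mult del: ennreal_numeral)
    also have "\<dots> \<le> ennreal 2 * (emeasure lborel (I j) * ennpowr (V (\<rho> j ^ DIM('a))) p)"
      by (intro mult_left_mono mult_right_mono emeasure_I) auto
    also have "emeasure lborel (I j) * ennpowr (V (\<rho> j ^ DIM('a))) p = (\<integral>\<^sup>+s. ennpowr (V (\<rho> j ^ DIM('a))) p * indicator (I j) s \<partial>lborel)"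
      by (simp add: nn_integral_cmult) (simp add: mult.commute)
    also have "ennreal 2 * \<dots> \<le> ennreal 2 * (\<integral>\<^sup>+s\<in>I j. ennpowr (V s) p \<partial>lborel)"
    proof (intro mult_left_mono nn_integral_mono)
      fix s
      have "ennpowr (V (\<rho> j ^ DIM('a))) p \<le> ennpowr (V s) p" if "s \<in> I j"
      proof (intro ennpowr_mono V_antimono)
        show "0 < s" using that I_Union by auto
        show "s \<le> (\<rho> j ^ DIM('a))" using that by (auto simp: I_def)
      qed (use p in auto)
      then show "ennpowr (V (\<rho> j ^ DIM('a))) p * indicator (I j) s \<le> ennpowr (V s) p * indicator (I j) s"
        by (auto simp: indicator_def)
    qed simp
    finally show ?thesis .
  qed
  then have "(\<Sum>j. ennreal (\<rho> j ^ DIM('a)) * ennpowr (V (\<rho> j ^ DIM('a))) p) \<le> (\<Sum>j. ennreal 2 * (\<integral>\<^sup>+s\<in>I j. ennpowr (V s) p \<partial>lborel))"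
    by (intro suminf_le) auto
  then show ?thesis by (simp only: ennreal_suminf_cmult sum_integral_I)
qed

text \<open>The factor \<open>\<rho> m ^ n\<close> is pulled under the power and regrouped into
  \<open>Y j = (\<rho> j ^ n) powr (1 / p) * V (\<rho> j ^ n)\<close>. What remains of the
  coefficients in \<open>W m\<close> is \<open>q ^ i\<close>, so \<open>geometric_Hardy\<close>
  applies.\<close>

lemma sum_W_le:
  assumes q: "sum_ratio TYPE('a) k p < 1"
  shows "(\<Sum>m. ennreal (\<rho> m ^ DIM('a)) * ennpowr (W m) p) \<le> ennreal (sum_const TYPE('a) k p) * (\<integral>\<^sup>+s\<in>{0<..}. ennpowr (V s) p \<partial>lborel)"
proof -
  define q where "q = sum_ratio TYPE('a) k p"
  have q01: "0 < q" "q < 1" using q by (auto simp: q_def sum_ratio_def)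
  define Y where "Y j = ennreal ((\<rho> j ^ DIM('a)) powr (1 / p)) * V (\<rho> j ^ DIM('a))" for j
  have Yp: "ennpowr (Y j) p = ennreal (\<rho> j ^ DIM('a)) * ennpowr (V (\<rho> j ^ DIM('a))) p" for j
    unfolding Y_def using p radius_pos[of j] by (simp add: ennpowr_mult ennpowr_ennreal powr_powr)
  have eq: "ennreal (\<rho> m ^ DIM('a)) * ennpowr (W m) p = ennpowr (\<Sum>i. ennreal (q ^ i) * Y (m + i)) p" for m
  proof -
    have "(\<rho> m ^ DIM('a)) powr (1 / p) * (2 ^ k / 2) ^ i = q ^ i * (\<rho> (m + i) ^ DIM('a)) powr (1 / p)" for i
    proof -
      have "(\<rho> (m + i) ^ DIM('a)) = (\<rho> m ^ DIM('a)) * (2 ^ i) ^ DIM('a)"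
        by (simp add: \<rho>_def power_add power_mult_distrib mult_ac)
      moreover have "(((2::real) ^ i) ^ DIM('a)) powr (1 / p) = (2 powr (DIM('a) / p)) ^ i"
        by (simp add: powr_powr mult.commute flip: power_mult powr_realpow)
      ultimately have "(\<rho> (m + i) ^ DIM('a)) powr (1 / p) = (\<rho> m ^ DIM('a)) powr (1 / p) * (2 powr (DIM('a) / p)) ^ i"
        using radius_pos[of m] by (simp add: powr_mult)
      moreover have "q ^ i * (2 powr (DIM('a) / p)) ^ i = (2 ^ k / 2) ^ i"
        unfolding power_mult_distrib[symmetric] by (simp add: q_def sum_ratio_def)
      ultimately show ?thesis by (simp add: mult.left_commute mult.commute)
    qed
    then have "ennreal ((\<rho> m ^ DIM('a)) powr (1 / p)) * (ennreal ((2 ^ k / 2) ^ i) * V (\<rho> (m + i) ^ DIM('a))) = ennreal (q ^ i) * Y (m + i)" for i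
      using q01 unfolding Y_def mult.assoc[symmetric] by (simp flip: ennreal_mult)
    then have "ennreal ((\<rho> m ^ DIM('a)) powr (1 / p)) * W m = (\<Sum>i. ennreal (q ^ i) * Y (m + i))"
      unfolding W_def by (simp flip: ennreal_suminf_cmult)
    then have "ennpowr (\<Sum>i. ennreal (q ^ i) * Y (m + i)) p = ennpowr (ennreal ((\<rho> m ^ DIM('a)) powr (1 / p))) p * ennpowr (W m) p"
      using p by (simp flip: ennpowr_mult)
    then show ?thesis using p radius_pos[of m] by (simp add: ennpowr_ennreal powr_powr)
  qed
  have "(\<Sum>m. ennreal (\<rho> m ^ DIM('a)) * ennpowr (W m) p) \<le> ennreal ((1 / (1 - q)) powr p * (1 / (1 - q))) * (\<Sum>j. ennpowr (Y j) p)"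
    unfolding eq by (intro geometric_Hardy q01 p)
  also have "\<dots> \<le> ennreal ((1 / (1 - q)) powr p * (1 / (1 - q))) * (ennreal 2 * (\<integral>\<^sup>+s\<in>{0<..}. ennpowr (V s) p \<partial>lborel))"
    unfolding Yp by (intro mult_left_mono sum_V_le) simp
  also have "\<dots> = ennreal (sum_const TYPE('a) k p) * (\<integral>\<^sup>+s\<in>{0<..}. ennpowr (V s) p \<partial>lborel)"
    using q01 unfolding sum_const_def q_def[symmetric] Let_def
    by (simp add: mult.commute flip: mult.assoc ennreal_mult del: ennreal_numeral)
  finally show ?thesis .
qed

end

text \<open>The first power is the constant of the gap bound once the weight has absorbed the growth
  in \<open>m\<close>, \<open>2 powr p\<close> separates \<open>V\<close> from \<open>W\<close>, and
  the summands 1 and \<open>sum_const\<close> belong to \<open>V\<close> and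
  \<open>W\<close>.\<close>

definition main_const :: "'a::euclidean_space itself \<Rightarrow> nat \<Rightarrow> real \<Rightarrow> real" where
  "main_const _ k p = (gap_const TYPE('a) k * 2 ^ k) powr p * 2 powr p * ((1 + sum_const TYPE('a) k p) * Hardy_const p)"

lemma Hardy_const_pos: "1 < p \<Longrightarrow> 0 < Hardy_const p"
  by (simp add: Hardy_const_def)

lemma sum_const_nonneg: "sum_ratio TYPE('a::euclidean_space) k p < 1 \<Longrightarrow> 0 \<le> sum_const TYPE('a) k p"
  by (simp add: sum_const_def Let_def)

lemma main_const_pos:
  assumes "1 < p" "sum_ratio TYPE('a::euclidean_space) k p < 1"
  shows "0 < main_const TYPE('a) k p"
  using assms gap_const_pos[of k, where 'a = 'a] Hardy_const_pos[of p] sum_const_nonneg[OF assms(2)]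
  by (simp add: main_const_def)

section \<open>The weighted integral of the gap\<close>

context Lp_function
begin

text \<open>One weight serves both integrals: in the application \<open>\<rho> 0 ^ n = t\<close>, so
  it is 1 on the first range and carries the \<open>p\<close>-th power of
  \<open>t powr (k / n)\<close> into the second.\<close>

definition weight :: "real \<Rightarrow> real" where
  "weight s = (if s \<le> (\<rho> 0 ^ DIM('a)) then 1 else ((\<rho> 0 ^ DIM('a)) / s) powr (real k * p / real DIM('a)))"

lemma weight_nonneg: "0 \<le> weight s"
  by (simp add: weight_def)

lemma measurable_weight [measurable]: "weight \<in> borel_measurable borel"
  unfolding weight_def[abs_def] by measurable

text \<open>A point of a block with \<open>m \<ge> 1\<close> is only known to exceed
  \<open>\<rho> (m - 1) ^ n\<close>, so the weight cancels the \<open>p\<close>-th power of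
  \<open>2 ^ (k * (m - 1))\<close> and one factor \<open>(2 ^ k) powr p\<close> remains.\<close>

lemma weight_le:
  assumes s: "s \<in> I m"
  shows "(2 ^ (k * m)) powr p * weight s \<le> (2 ^ k) powr p"
proof (cases "s \<le> (\<rho> 0 ^ DIM('a))")
  case True
  have "m = 0"
  proof (rule ccontr)
    assume "m \<noteq> 0"
    then have "(\<rho> (m - 1) ^ DIM('a)) < s" using s by (simp add: I_def)
    then show False using radius_mono[of 0 "m - 1"] True by simp
  qed
  then show ?thesis using True p by (simp add: weight_def ge_one_powr_ge_zero)
next
  case False
  let ?n = "real DIM('a)"
  have m: "m \<noteq> 0" using False s by (auto simp: I_def split: if_splits)
  then obtain l where l: "m = Suc l" by (cases m) auto
  have s': "(\<rho> l ^ DIM('a)) < s" using s m l by (simp add: I_def)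
  have Sl: "(\<rho> l ^ DIM('a)) = (\<rho> 0 ^ DIM('a)) * (2 ^ l) ^ DIM('a)"
    by (simp add: \<rho>_def power_mult_distrib mult_ac)
  have n: "0 < ?n" by simp
  have "weight s \<le> ((\<rho> 0 ^ DIM('a)) / (\<rho> l ^ DIM('a))) powr (real k * p / ?n)"
    using False s' radius_pos[of 0] radius_pos[of l] p n
    by (auto simp: weight_def intro!: powr_mono2 divide_left_mono mult_pos_pos)
  also have "(\<rho> 0 ^ DIM('a)) / (\<rho> l ^ DIM('a)) = 2 powr (- (real l * ?n))"
    using \<rho>_pos[of 0] by (simp add: Sl powr_minus powr_realpow[symmetric] powr_powr field_simps flip: power_mult)
  also have "(2 powr (- (real l * ?n))) powr (real k * p / ?n) = 2 powr (- (real l * real k * p))"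
    using n by (simp add: powr_powr mult.assoc)
  finally have "(2 ^ (k * m)) powr p * weight s \<le> (2 ^ (k * m)) powr p * 2 powr (- (real l * real k * p))"
    by (intro mult_left_mono) auto
  also have "\<dots> = 2 powr (real (k * m) * p - real l * real k * p)"
    by (simp add: powr_powr powr_diff powr_minus_divide flip: powr_realpow)
  also have "real (k * m) * p - real l * real k * p = real k * p"
    by (simp add: l algebra_simps)
  also have "2 powr (real k * p) = (2 ^ k) powr p"
    by (simp add: powr_powr flip: powr_realpow)
  finally show ?thesis .
qed

text \<open>A visibly measurable bound for the \<open>p\<close>-th power of the gap. The blocks are
  disjoint, so at most one term is nonzero at each \<open>s\<close>.\<close>

definition majorant :: "real \<Rightarrow> ennreal" where
  "majorant s = (\<Sum>m. ennpowr (ennreal (gap_const TYPE('a) k * 2 ^ (k * m)) * (V s + W m)) p * indicator (I m) s)"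

lemma measurable_majorant [measurable]: "majorant \<in> borel_measurable borel"
  unfolding majorant_def[abs_def] by measurable

lemma gap_le_majorant:
  assumes s: "0 < s"
  shows "ennpowr (maximal_rearrangement f s - rearrangement f s) p \<le> majorant s"
proof -
  obtain m where m: "s \<in> I m" using I_cover[OF s] by auto
  then have "s \<le> (\<rho> m ^ DIM('a))" by (simp add: I_def)
  then have "ennpowr (maximal_rearrangement f s - rearrangement f s) p
    \<le> ennpowr (ennreal (gap_const TYPE('a) k * 2 ^ (k * m)) * (V s + W m)) p"
    using p s by (intro ennpowr_mono rearrangement_gap_le_V) auto
  also have "\<dots> = (\<Sum>m\<in>{m}. ennpowr (ennreal (gap_const TYPE('a) k * 2 ^ (k * m)) * (V s + W m)) p * indicator (I m) s)"
    using m by simp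
  also have "\<dots> \<le> majorant s"
    unfolding majorant_def by (rule sum_le_suminf) auto
  finally show ?thesis .
qed

text \<open>On each block the weight absorbs the growth in \<open>m\<close>; \<open>W m\<close> is
  constant there, so it only meets the measure of the block.\<close>

lemma majorant_weight_integral_le:
  assumes M: "\<And>v. norm v \<le> r \<Longrightarrow> (\<integral>\<^sup>+x. ennreal (\<bar>d v x\<bar> powr p) \<partial>lborel) \<le> M"
    and q: "sum_ratio TYPE('a) k p < 1"
  shows "(\<integral>\<^sup>+s. majorant s * ennreal (weight s) \<partial>lborel) \<le> ennreal (main_const TYPE('a) k p) * M"
proof -
  let ?G = "gap_const TYPE('a) k"
  let ?c = "(?G * 2 ^ k) powr p * 2 powr p"
  have G: "0 < ?G" by (rule gap_const_pos)
  have pt: "ennpowr (ennreal (?G * 2 ^ (k * m)) * (V s + W m)) p * indicator (I m) s * ennreal (weight s)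
    \<le> ennreal ?c * (ennpowr (V s) p * indicator (I m) s + ennpowr (W m) p * indicator (I m) s)" for m s
  proof (cases "s \<in> I m")
    case True
    have "ennpowr (ennreal (?G * 2 ^ (k * m)) * (V s + W m)) p * ennreal (weight s)
      = ennreal ((?G * 2 ^ (k * m)) powr p * weight s) * ennpowr (V s + W m) p"
      using p G weight_nonneg[of s] by (simp add: ennpowr_mult ennpowr_ennreal mult_ac flip: ennreal_mult)
        (simp add: ennreal_mult mult_ac)
    also have "\<dots> \<le> ennreal ((?G * 2 ^ k) powr p) * (ennreal (2 powr p) * (ennpowr (V s) p + ennpowr (W m) p))"
    proof (intro mult_mono ennreal_leI ennpowr_add_le)
      have "?G powr p * ((2 ^ (k * m)) powr p * weight s) \<le> ?G powr p * (2 ^ k) powr p"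
        by (intro mult_left_mono weight_le True) simp
      then show "(?G * 2 ^ (k * m)) powr p * weight s \<le> (?G * 2 ^ k) powr p"
        using G by (simp add: powr_mult mult.assoc)
    qed (use p in auto)
    also have "\<dots> = ennreal ?c * (ennpowr (V s) p + ennpowr (W m) p)"
      by (simp add: ennreal_mult mult.assoc)
    finally show ?thesis using True by simp
  qed simp
  have "(\<integral>\<^sup>+s. majorant s * ennreal (weight s) \<partial>lborel)
    = (\<integral>\<^sup>+s. (\<Sum>m. ennpowr (ennreal (?G * 2 ^ (k * m)) * (V s + W m)) p * indicator (I m) s * ennreal (weight s)) \<partial>lborel)"
    unfolding majorant_def by (intro nn_integral_cong) simp
  also have "\<dots> = (\<Sum>m. \<integral>\<^sup>+s. ennpowr (ennreal (?G * 2 ^ (k * m)) * (V s + W m)) p * indicator (I m) s * ennreal (weight s) \<partial>lborel)"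
    by (intro nn_integral_suminf) measurable
  also have "\<dots> \<le> (\<Sum>m. \<integral>\<^sup>+s. ennreal ?c * (ennpowr (V s) p * indicator (I m) s + ennpowr (W m) p * indicator (I m) s) \<partial>lborel)"
    by (intro suminf_le nn_integral_mono pt) auto
  also have "\<dots> = (\<Sum>m. ennreal ?c * ((\<integral>\<^sup>+s\<in>I m. ennpowr (V s) p \<partial>lborel) + ennpowr (W m) p * emeasure lborel (I m)))"
    by (simp add: nn_integral_cmult nn_integral_add)
  also have "\<dots> \<le> (\<Sum>m. ennreal ?c * ((\<integral>\<^sup>+s\<in>I m. ennpowr (V s) p \<partial>lborel) + ennreal (\<rho> m ^ DIM('a)) * ennpowr (W m) p))"
    by (subst (2) mult.commute) (intro suminf_le mult_left_mono add_left_mono mult_right_mono emeasure_I, auto)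
  also have "\<dots> = ennreal ?c * ((\<integral>\<^sup>+s\<in>{0<..}. ennpowr (V s) p \<partial>lborel) + (\<Sum>m. ennreal (\<rho> m ^ DIM('a)) * ennpowr (W m) p))"
    by (simp add: suminf_add[symmetric] flip: sum_integral_I)
  also have "\<dots> \<le> ennreal ?c * ((\<integral>\<^sup>+s\<in>{0<..}. ennpowr (V s) p \<partial>lborel) + ennreal (sum_const TYPE('a) k p) * (\<integral>\<^sup>+s\<in>{0<..}. ennpowr (V s) p \<partial>lborel))"
    by (intro mult_left_mono add_left_mono sum_W_le q) simp
  also have "\<dots> = ennreal (?c * (1 + sum_const TYPE('a) k p)) * (\<integral>\<^sup>+s\<in>{0<..}. ennpowr (V s) p \<partial>lborel)"
    using sum_const_nonneg[OF q] by (simp add: ennreal_mult distrib_left distrib_right mult.assoc)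
  also have "\<dots> \<le> ennreal (?c * (1 + sum_const TYPE('a) k p)) * (ennreal (Hardy_const p) * M)"
    by (intro mult_left_mono V_Lp M) auto
  also have "\<dots> = ennreal (main_const TYPE('a) k p) * M"
    using sum_const_nonneg[OF q] Hardy_const_pos[OF p]
    unfolding main_const_def by (simp add: mult.assoc flip: mult.assoc[of "ennreal _"] ennreal_mult)
  finally show ?thesis .
qed

end

section \<open>The estimate for Lebesgue measurable functions\<close>

lemma AE_lborel_translate:
  assumes "AE x in lborel. P (x::'a::euclidean_space)"
  shows "AE x in lborel. P (x + v)"
proof -
  obtain N where N: "{x. \<not> P x} \<subseteq> N" "N \<in> null_sets lborel"
    using assms by (auto elim!: AE_E simp: null_sets_def)
  have [measurable]: "N \<in> sets borel" using N(2) by auto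
  have "emeasure lborel {x. x + v \<in> N} = (\<integral>\<^sup>+x. indicator {x. x + v \<in> N} x \<partial>lborel)"
    by simp
  also have "\<dots> = (\<integral>\<^sup>+x. indicator N (x + v) \<partial>lborel)"
    by (intro nn_integral_cong) (simp add: indicator_def)
  also have "\<dots> = 0"
    using N(2) by (subst nn_integral_translate) (auto simp: null_sets_def)
  finally have "{x. x + v \<in> N} \<in> null_sets lborel"
    by (auto simp: null_sets_def)
  then show ?thesis
    using N(1) by (intro AE_I'[of "{x. x + v \<in> N}"]) auto
qed

lemma rearrangement_cong_AE:
  fixes f g :: "'a::euclidean_space \<Rightarrow> real"
  assumes [measurable]: "f \<in> borel_measurable lebesgue" "g \<in> borel_measurable lebesgue"
    and ae: "AE x in lborel. f x = g x"
  shows "rearrangement f = rearrangement g"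
proof -
  have "emeasure lebesgue {x. \<bar>f x\<bar> > l} = emeasure lebesgue {x. \<bar>g x\<bar> > l}" for l
  proof (rule emeasure_eq_AE)
    show "AE x in lebesgue. x \<in> {x. \<bar>f x\<bar> > l} \<longleftrightarrow> x \<in> {x. \<bar>g x\<bar> > l}"
      using AE_completion[OF ae] by eventually_elim simp
    have "{x \<in> space lebesgue. \<bar>f x\<bar> > l} \<in> sets lebesgue" "{x \<in> space lebesgue. \<bar>g x\<bar> > l} \<in> sets lebesgue"
      by measurable
    then show "{x. \<bar>f x\<bar> > l} \<in> sets lebesgue" "{x. \<bar>g x\<bar> > l} \<in> sets lebesgue"
      by simp_all
  qed
  then show ?thesis by (simp add: rearrangement_def fun_eq_iff)
qed

text \<open>A k-th difference involves finitely many translates, so it changes only on a null set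
  when \<open>f\<close> is replaced by a Borel representative.\<close>

lemma Lp_norm_difference_cong_AE:
  fixes f g :: "'a::euclidean_space \<Rightarrow> real"
  assumes [measurable]: "g \<in> borel_measurable borel" and ae: "AE x in lborel. f x = g x"
  shows "Lp_norm p ((difference h ^^ k) f) = ennpowr (\<integral>\<^sup>+x. ennreal (\<bar>kdiff k g h x\<bar> powr p) \<partial>lborel) (1 / p)"
proof -
  have "AE x in lborel. \<forall>l\<in>{..k}. f (x + real l *\<^sub>R h) = g (x + real l *\<^sub>R h)"
    by (intro AE_finite_allI AE_lborel_translate ae) auto
  then have "AE x in lborel. kdiff k f h x = kdiff k g h x"
    by eventually_elim (auto simp: kdiff_def intro!: sum.cong)
  from AE_completion[OF this]
  have "(\<integral>\<^sup>+x. ennreal (\<bar>(difference h ^^ k) f x\<bar> powr p) \<partial>lebesgue) = (\<integral>\<^sup>+x. ennreal (\<bar>kdiff k g h x\<bar> powr p) \<partial>lebesgue)"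
    by (intro nn_integral_cong_AE) (auto simp flip: abs_kdiff)
  also have "\<dots> = (\<integral>\<^sup>+x. ennreal (\<bar>kdiff k g h x\<bar> powr p) \<partial>lborel)"
    by (rule nn_integral_completion)
  finally show ?thesis by (simp add: Lp_norm_def)
qed

text \<open>The upper bound on \<open>k\<close> enters here, as convergence of the sum over
  scales.\<close>

lemma sum_ratio_less_1:
  assumes "real k < real DIM('a::euclidean_space) / p + 1"
  shows "sum_ratio TYPE('a) k p < 1"
proof -
  have "(2::real) ^ k / 2 = 2 powr (real k - 1)"
    by (simp add: powr_diff powr_realpow)
  also have "\<dots> < 2 powr (real DIM('a) / p)"
    using assms by (intro powr_less_mono) auto
  finally show ?thesis by (simp add: sum_ratio_def field_simps)
qed

lemma gap_estimate:
  fixes f :: "'a::euclidean_space \<Rightarrow> real"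
  assumes p: "1 < p" and k: "real k < real DIM('a) / p + 1" and t: "0 < t" and f: "f \<in> Lp_space p"
  shows "ennpowr (\<integral>\<^sup>+ s \<in> {0<..<t}. ennpowr (maximal_rearrangement f s - rearrangement f s) p \<partial>lborel) (1 / p)
       + ennreal (t powr (real k / real DIM('a))) *
         ennpowr (\<integral>\<^sup>+ s \<in> {t<..}. ennpowr (maximal_rearrangement f s - rearrangement f s) p *
           ennreal (s powr (- (real k * p / real DIM('a)))) \<partial>lborel) (1 / p)
       \<le> ennreal (2 * main_const TYPE('a) k p powr (1 / p)) * modulus_of_smoothness k f (t powr (1 / real DIM('a))) p"
proof -
  let ?n = "real DIM('a)"
  define r where "r = t powr (1 / ?n)"
  define \<Omega> where "\<Omega> = modulus_of_smoothness k f r p"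
  have fm [measurable]: "f \<in> borel_measurable lebesgue" and fL: "Lp_norm p f < \<infinity>"
    using f by (auto simp: Lp_space_def)
  \<comment> \<open>The uses of Tonelli rest on joint measurability of \<open>f (x + h)\<close>,
    hence a Borel representative \<open>g\<close>; neither side of the claim distinguishes it from
    \<open>f\<close>.\<close>
  obtain g where g [measurable]: "g \<in> borel_measurable borel" and ae: "AE x in lborel. f x = g x"
    using completion_ex_borel_measurable_real[OF fm] by auto
  have gm: "g \<in> borel_measurable lebesgue"
    using g by (intro measurable_completion) simp
  have re: "rearrangement f = rearrangement g"
    by (rule rearrangement_cong_AE[OF fm gm ae])
  then have mre: "maximal_rearrangement f = maximal_rearrangement g"
    by (simp add: maximal_rearrangement_def fun_eq_iff)
  \<comment> \<open>The case of the zeroth difference turns the norm of \<open>f\<close> into that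
    of \<open>g\<close>.\<close>
  have "ennpowr (\<integral>\<^sup>+x. ennreal (\<bar>g x\<bar> powr p) \<partial>lborel) (1 / p) < top"
    using fL Lp_norm_difference_cong_AE[OF g ae, of p 0 0] by (simp add: kdiff_def)
  then have gL: "(\<integral>\<^sup>+x. ennreal (\<bar>g x\<bar> powr p) \<partial>lborel) < top"
    by (auto simp: ennpowr_def less_top split: if_splits)
  have r: "0 < r" using t by (simp add: r_def)
  interpret Lp_function g k p r
    by unfold_locales (use g gL p r in auto)
  have rn: "\<rho> 0 ^ DIM('a) = t"
  proof -
    have "r ^ DIM('a) = t"
      using t by (simp add: r_def powr_powr flip: powr_realpow)
    then show ?thesis by (simp add: \<rho>_def)
  qed
  have M: "(\<integral>\<^sup>+x. ennreal (\<bar>d v x\<bar> powr p) \<partial>lborel) \<le> ennpowr \<Omega> p" if v: "norm v \<le> r" for v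
  proof -
    have "Lp_norm p ((difference v ^^ k) f) \<le> \<Omega>"
      unfolding \<Omega>_def modulus_of_smoothness_def using v by (intro SUP_upper) simp
    then have "ennpowr (ennpowr (\<integral>\<^sup>+x. ennreal (\<bar>d v x\<bar> powr p) \<partial>lborel) (1 / p)) p \<le> ennpowr \<Omega> p"
      unfolding Lp_norm_difference_cong_AE[OF g ae] using p by (intro ennpowr_mono) auto
    then show ?thesis using p by (simp add: ennpowr_ennpowr)
  qed
  let ?c = "main_const TYPE('a) k p"
  let ?gap = "\<lambda>s. maximal_rearrangement g s - rearrangement g s"
  have q: "sum_ratio TYPE('a) k p < 1" by (rule sum_ratio_less_1[OF k])
  have c: "0 < ?c" by (rule main_const_pos[OF p q])
  have main: "(\<integral>\<^sup>+s. majorant s * ennreal (weight s) \<partial>lborel) \<le> ennreal ?c * ennpowr \<Omega> p"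
    by (rule majorant_weight_integral_le[OF M q])
  have root: "ennpowr (ennreal ?c * ennpowr \<Omega> p) (1 / p) = ennreal (?c powr (1 / p)) * \<Omega>"
    using p c by (simp add: ennpowr_mult ennpowr_ennpowr ennpowr_ennreal)
  have "(\<integral>\<^sup>+ s \<in> {0<..<t}. ennpowr (?gap s) p \<partial>lborel) \<le> (\<integral>\<^sup>+s. majorant s * ennreal (weight s) \<partial>lborel)"
    using gap_le_majorant by (intro nn_integral_mono) (auto simp: indicator_def weight_def rn)
  then have "ennpowr (\<integral>\<^sup>+ s \<in> {0<..<t}. ennpowr (?gap s) p \<partial>lborel) (1 / p) \<le> ennpowr (ennreal ?c * ennpowr \<Omega> p) (1 / p)"
    using main p by (intro ennpowr_mono) auto
  then have first: "ennpowr (\<integral>\<^sup>+ s \<in> {0<..<t}. ennpowr (?gap s) p \<partial>lborel) (1 / p) \<le> ennreal (?c powr (1 / p)) * \<Omega>"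
    by (simp only: root)
  let ?e = "real k * p / ?n"
  let ?J = "\<integral>\<^sup>+ s \<in> {t<..}. ennpowr (?gap s) p * ennreal (s powr (- ?e)) \<partial>lborel"
  \<comment> \<open>Under the root the prefactor becomes \<open>t powr ?e\<close>, and its product
    with \<open>s powr (- ?e)\<close> is the weight on this range.\<close>
  have "ennreal (t powr ?e) * ?J \<le> ennreal (t powr ?e) * (\<integral>\<^sup>+ s \<in> {t<..}. majorant s * ennreal (s powr (- ?e)) \<partial>lborel)"
    using t gap_le_majorant by (intro mult_left_mono nn_integral_mono) (auto simp: indicator_def intro!: mult_right_mono)
  also have "\<dots> = (\<integral>\<^sup>+ s. ennreal (t powr ?e) * (majorant s * ennreal (s powr (- ?e)) * indicator {t<..} s) \<partial>lborel)"
    by (rule nn_integral_cmult[symmetric]) measurable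
  also have "\<dots> \<le> (\<integral>\<^sup>+s. majorant s * ennreal (weight s) \<partial>lborel)"
  proof (intro nn_integral_mono)
    fix s
    show "ennreal (t powr ?e) * (majorant s * ennreal (s powr (- ?e)) * indicator {t<..} s) \<le> majorant s * ennreal (weight s)"
    proof (cases "t < s")
      case True
      then have "weight s = t powr ?e * s powr (- ?e)"
        using t by (simp add: weight_def rn powr_divide powr_minus_divide)
      then have "ennreal (weight s) = ennreal (t powr ?e) * ennreal (s powr (- ?e))"
        by (simp only: ennreal_mult powr_ge_zero)
      moreover have "indicator {t<..} s = (1::ennreal)" using True by simp
      ultimately show ?thesis by (simp only: mult_1_right mult.left_commute order_refl)
    qed simp
  qed
  finally have "ennpowr (ennreal (t powr ?e) * ?J) (1 / p) \<le> ennpowr (ennreal ?c * ennpowr \<Omega> p) (1 / p)"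
    using main p by (intro ennpowr_mono) auto
  moreover have "ennpowr (ennreal (t powr ?e) * ?J) (1 / p) = ennreal (t powr (real k / ?n)) * ennpowr ?J (1 / p)"
    using p by (simp add: ennpowr_mult ennpowr_ennreal powr_powr)
  ultimately have second: "ennreal (t powr (real k / ?n)) * ennpowr ?J (1 / p) \<le> ennreal (?c powr (1 / p)) * \<Omega>"
    by (simp only: root)
  \<comment> \<open>Both summands are bounded by the root of the same weighted integral, whence the
    2 in the constant.\<close>
  have "ennreal (?c powr (1 / p)) + ennreal (?c powr (1 / p)) = ennreal (2 * ?c powr (1 / p))"
    by (simp flip: ennreal_plus)
  then have "ennreal (?c powr (1 / p)) * \<Omega> + ennreal (?c powr (1 / p)) * \<Omega> = ennreal (2 * ?c powr (1 / p)) * \<Omega>"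
    by (simp only: flip: distrib_right)
  then show ?thesis
    using add_mono[OF first second] unfolding re mre \<Omega>_def r_def by (simp only:)
qed

theorem corollary1p6:
  fixes p :: real and k :: nat
  assumes "CARD('n::finite) \<ge> 2"
    and "1 < p" and "p < real CARD('n)"
    and "2 \<le> k" and "real k < real CARD('n) / p + 1"
  shows "\<exists>C::real. C > 0 \<and>
    (\<forall>t::real. \<forall>f :: real^'n \<Rightarrow> real.
       0 < t \<longrightarrow> weakly_differentiable (k - 1) f \<longrightarrow> f \<in> Lp_space p \<longrightarrow>
       (\<forall>j \<in> {0..k - 1}. (maximal_rearrangement (grad_length j f) \<longlongrightarrow> 0) at_top) \<longrightarrow>
       ennpowr (\<integral>\<^sup>+ s \<in> {0<..<t}.
           ennpowr (maximal_rearrangement f s - rearrangement f s) p \<partial>lborel) (1 / p)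
       + ennreal (t powr (real k / real CARD('n))) *
         ennpowr (\<integral>\<^sup>+ s \<in> {t<..}.
           ennpowr (maximal_rearrangement f s - rearrangement f s) p *
           ennreal (s powr (- (real k * p / real CARD('n)))) \<partial>lborel) (1 / p)
       \<le> ennreal C * modulus_of_smoothness k f (t powr (1 / real CARD('n))) p)"
proof -
  have k: "real k < real DIM(real^'n) / p + 1"
    using assms(5) by simp
  have "0 < 2 * main_const TYPE(real^'n) k p powr (1 / p)"
    using main_const_pos[OF assms(2) sum_ratio_less_1[OF k]] by simp
  moreover have "DIM(real^'n) = CARD('n)" by simp
  ultimately show ?thesis
    using gap_estimate[OF assms(2) k] by (intro exI conjI allI impI) (assumption, simp only:)
qed

end
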